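(* Let $m\in(0,1)\cup\mathbb{N}$, $2m<n$, $\alpha\in(0,2m)$, $p\in\left(\frac{n-\alpha}{n-2m},\infty\right)$, $q_c=\frac{n(p-1)}{2m-\alpha}$, and let $F:\mathbb{R}\to\mathbb{R}$ satisfy $F(0)=0$ and $|F(a)-F(b)|\le C|a-b|(|a|^{p-1}+|b|^{p-1})$ for some constant $C>0$ and all $a,b\in\mathbb{R}$. Let $u,v\in C_b([0,\infty);L^{q_c}(\mathbb{R}^n))$ be two global solutions, with the same initial value $u_0\in L^{q_c}(\mathbb{R}^n)$, of the integral equation $$u(t)=e^{-t(-\Delta)^m}u_0+\int_0^t e^{-(t-\tau)(-\Delta)^m}|\cdot|^{-\alpha}F(u(\tau))\,d\tau,\qquad t>0.$$ Then $u=v$ a.e. in $\mathbb{R}^n\times(0,\infty)$.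
   Context: $e^{-t(-\Delta)^m}$ is the semigroup given by convolution with the kernel $g_m(\cdot,t)$, $\widehat{g_m}(\xi,t)=e^{-t|\xi|^{2m}}$. $C_b([0,\infty);L^{q_c}(\mathbb{R}^n))$ is the space of bounded continuous functions of $t\in[0,\infty)$ with values in $L^{q_c}(\mathbb{R}^n)$ (continuity, including at $t=0$ with $u(0)=u_0$, in the norm topology). *)

theory Defs
  imports "HOL-Analysis.Analysis"
begin

text \<open>
  Elements of \<open>L\<^sup>q\<close> are represented by Lebesgue measurable functions; equality in \<open>L\<^sup>q\<close> is
  equality almost everywhere and is written out as such.
\<close>

definition in_Lp :: "real \<Rightarrow> (real ^ 'n::finite \<Rightarrow> real) \<Rightarrow> bool" where
  "in_Lp q f \<longleftrightarrow> f \<in> borel_measurable lebesgue \<and> integrable lebesgue (\<lambda>x. \<bar>f x\<bar> powr q)"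

definition Lp_norm :: "real \<Rightarrow> (real ^ 'n::finite \<Rightarrow> real) \<Rightarrow> real" where
  "Lp_norm q f = (LINT x|lebesgue. \<bar>f x\<bar> powr q) powr (1 / q)"

text \<open>
  \<open>u t\<close> is a representative of the class of \<open>u(t)\<close>. Only norms occur, so the predicate does not
  depend on which representative is chosen for each \<open>t\<close>.
\<close>

definition Cb_Lp :: "real \<Rightarrow> (real \<Rightarrow> real ^ 'n::finite \<Rightarrow> real) \<Rightarrow> bool" where
  "Cb_Lp q u \<longleftrightarrow>
     (\<forall>t\<ge>0. in_Lp q (u t)) \<and>
     (\<exists>B. \<forall>t\<ge>0. Lp_norm q (u t) \<le> B) \<and>
     (\<forall>t\<ge>0. ((\<lambda>s. Lp_norm q (\<lambda>x. u s x - u t x)) \<longlongrightarrow> 0) (at t within {0..}))"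

text \<open>
  The normalisation without \<open>2\<pi>\<close> in the exponent is the one for which \<open>(-\<Delta>)\<^sup>m\<close> has symbol
  \<open>|\<xi>|\<close> to the power \<open>2m\<close>.
\<close>

definition fourier :: "(real ^ 'n::finite \<Rightarrow> real) \<Rightarrow> real ^ 'n \<Rightarrow> complex" where
  "fourier f \<xi> = (LINT x|lebesgue. exp (- \<i> * of_real (\<xi> \<bullet> x)) * of_real (f x))"

text \<open>
  This determines each \<open>g t\<close> with \<open>t > 0\<close> up to a null set, which does not affect convolutions
  with \<open>g t\<close>.
\<close>

definition is_heat_kernel :: "real \<Rightarrow> (real \<Rightarrow> real ^ 'n::finite \<Rightarrow> real) \<Rightarrow> bool" where
  "is_heat_kernel m g \<longleftrightarrow>
     (\<forall>t>0. integrable lebesgue (g t) \<and>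
        (\<forall>\<xi>. fourier (g t) \<xi> = of_real (exp (- t * norm \<xi> powr (2 * m)))))"

definition heat_semigroup ::
  "(real \<Rightarrow> real ^ 'n::finite \<Rightarrow> real) \<Rightarrow> real \<Rightarrow> (real ^ 'n \<Rightarrow> real) \<Rightarrow> real ^ 'n \<Rightarrow> real" where
  "heat_semigroup g t f x = (LINT y|lebesgue. g t (x - y) * f y)"

text \<open>
  The equation holds in \<open>L\<^sup>q\<close>, that is, for every \<open>t > 0\<close> and almost every \<open>x\<close>. For exponents in
  the range \<open>p > (n - \<alpha>) / (n - 2 * m)\<close>, \<open>q = n * (p - 1) / (2 * m - \<alpha>)\<close> and \<open>u\<close> satisfying
  \<open>Cb_Lp q u\<close>, both integrals converge absolutely for almost every \<open>x\<close> (the time integral even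
  absolutely in \<open>L\<^sup>a\<close> for \<open>a < q\<close> close to \<open>q\<close>), so the default value of a divergent integral
  plays no role.
\<close>

definition mild_solution ::
  "(real \<Rightarrow> real ^ 'n::finite \<Rightarrow> real) \<Rightarrow> real \<Rightarrow> (real \<Rightarrow> real) \<Rightarrow> (real ^ 'n \<Rightarrow> real) \<Rightarrow>
   (real \<Rightarrow> real ^ 'n \<Rightarrow> real) \<Rightarrow> bool" where
  "mild_solution g \<alpha> F u0 u \<longleftrightarrow>
     (AE x in lebesgue. u 0 x = u0 x) \<and>
     (\<forall>t>0. AE x in lebesgue.
        u t x = heat_semigroup g t u0 x +
          (LINT \<tau>:{0<..<t}|lebesgue.
             heat_semigroup g (t - \<tau>) (\<lambda>y. norm y powr (- \<alpha>) * F (u \<tau> y)) x))"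

end

theory Submission
  imports Defs "HOL-Probability.Characteristic_Functions" "HOL-Real_Asymp.Real_Asymp"
begin

text \<open>
  Write \<open>n\<close> for the dimension, \<open>q = q\<^sub>c\<close> and \<open>w = u - v\<close>. Subtracting the two integral equations gives
  \<open>|w(t)| \<le> \<integral>\<^sub>0\<^sup>t |g(t - \<tau>)| * (V(\<tau>) |w(\<tau>)|) d\<tau>\<close> with the potential
  \<open>V = C |x| powr (-\<alpha>) (|u| powr (p - 1) + |v| powr (p - 1))\<close>. Since \<open>|x| powr (-\<alpha>)\<close> lies in weak
  \<open>L\<close> with exponent \<open>n/\<alpha>\<close> and \<open>|u| powr (p - 1)\<close> in \<open>L\<close> with exponent \<open>n/(2m - \<alpha>)\<close>, the product
  \<open>V w\<close> is controlled in weak \<open>L\<^sup>r\<close> with \<open>1/r = 2m/n + 1/q\<close>. For this pair of exponents the smoothing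
  of the semigroup from \<open>L\<^sup>r\<close> to \<open>L\<^sup>q\<close> costs exactly \<open>1/(t - \<tau>)\<close>, which is not integrable, so a
  fixed-time estimate followed by integration in time fails.

  The remedy is to measure \<open>w(t)\<close> in weak \<open>L\<^sup>q\<close>, that is, to integrate only over sets \<open>E\<close> of finite
  measure, and to move the kernel onto the indicator of \<open>E\<close>. The functions \<open>h\<^sub>s = |g(s)| * 1\<^sub>E\<close> satisfy
  \<open>h\<^sub>s \<le> K min(1, s powr (-n/2m) |E|)\<close> and have integral at most \<open>K |E|\<close>; hence their pairing with a
  function in weak \<open>L\<^sup>r\<close> is at most a multiple of
  \<open>min(1, s powr (-n/2m) |E|) powr (1/r) |E| powr (1 - 1/r)\<close> (\<open>nn_integral_weak_Lp_mult_le\<close>). Because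
  \<open>n/(2mr) = 1 + n/(2mq) > 1\<close>, this is integrable over all \<open>s > 0\<close>, with integral a multiple of
  \<open>|E| powr (1 - 1/q)\<close>. So the Duhamel integral maps functions bounded in time with values in weak
  \<open>L\<^sup>r\<close> to functions bounded in time with values in weak \<open>L\<^sup>q\<close> (\<open>duhamel_weak_estimate\<close>). The
  condition on \<open>p\<close> says precisely that \<open>r > 1\<close>.

  This operator norm is not small, so smallness must come from \<open>V\<close>. Suppose \<open>u = v\<close> before time \<open>T\<close>.
  For \<open>\<tau>\<close> slightly larger than \<open>T\<close>, \<open>u(\<tau>)\<close> differs little from \<open>u(T)\<close> in \<open>L\<^sup>q\<close>, and \<open>u(T)\<close> is the sum
  of a bounded function and a function that is small in \<open>L\<^sup>q\<close>; the same holds for \<open>v\<close>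
  (\<open>Cb_Lp_split_near\<close>). The small parts contribute a small multiple of the norm of \<open>w\<close>. The bounded
  parts contribute a multiple of \<open>|x| powr (-\<alpha>) |w|\<close>, which is less singular because \<open>\<alpha> < 2m\<close>, and
  the corresponding Duhamel integral gains the factor \<open>H powr (1 - \<alpha>/2m)\<close> on a time interval of
  length \<open>H\<close>. For small \<open>H\<close> every bound \<open>S\<close> for the weak norm of \<open>w\<close> on that interval therefore
  improves to \<open>S/2\<close>, so \<open>w\<close> vanishes up to time \<open>T + H\<close> (\<open>uniqueness_extension\<close>). As this holds for
  every \<open>T\<close>, the solutions never separate (\<open>global_from_extension\<close>).

  The bounds on the kernel have to be extracted from its Fourier transform. If the transform of an
  integrable function is dominated by an integrable \<open>\<Phi>\<close>, the function is almost everywhere at most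
  \<open>(2\<pi>)\<close> to the power \<open>-n\<close> times the integral of \<open>\<Phi>\<close> (\<open>AE_abs_le_of_fourier_bound\<close>). This bounds
  \<open>g 1\<close>, and for \<open>\<Phi> = 0\<close> it is the injectivity of the Fourier transform, which yields the scaling
  relation between \<open>g s\<close> and \<open>g 1\<close> and thus all the estimates (\<open>heat_kernel_representative\<close>).
\<close>

section \<open>Functions with integrable Fourier transform are bounded\<close>

definition gauss :: "'a::euclidean_space \<Rightarrow> real" where
  "gauss x = (\<Prod>b\<in>Basis. std_normal_density (x \<bullet> b))"

lemma continuous_gauss: "continuous_on UNIV (gauss :: 'a::euclidean_space \<Rightarrow> real)"
  unfolding gauss_def normal_density_def by (intro continuous_intros) auto

lemma borel_measurable_gauss [measurable]: "(gauss :: 'a::euclidean_space \<Rightarrow> real) \<in> borel_measurable borel"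
  using continuous_gauss by (rule borel_measurable_continuous_onI)

lemma gauss_nonneg [simp]: "0 \<le> gauss x"
  unfolding gauss_def by (intro prod_nonneg) simp

lemma gauss_le:
  fixes x :: "'a::euclidean_space"
  shows "gauss x \<le> (1 / sqrt (2 * pi)) ^ DIM('a)"
proof -
  have "gauss x \<le> (\<Prod>b\<in>(Basis::'a set). 1 / sqrt (2 * pi))"
    unfolding gauss_def
  proof (rule prod_mono, intro conjI)
    fix b :: 'a
    have "exp (- (x \<bullet> b)\<^sup>2 / 2) \<le> 1" by simp
    then show "std_normal_density (x \<bullet> b) \<le> 1 / sqrt (2 * pi)"
      by (simp add: normal_density_def divide_right_mono)
  qed simp
  then show ?thesis by simp
qed

lemma nn_integral_gauss: "(\<integral>\<^sup>+ x. ennreal (gauss (x::'a::euclidean_space)) \<partial>lborel) = 1"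
proof -
  interpret prob_space "density lborel std_normal_density"
    by (rule prob_space_normal_density) simp
  have "(\<integral>\<^sup>+ x. ennreal (std_normal_density x) \<partial>lborel) = 1"
    using emeasure_space_1 by (simp add: emeasure_density)
  then show ?thesis
    unfolding gauss_def
    using nn_integral_lborel_prod[where f="\<lambda>_::'a. std_normal_density"]
    by (simp add: prod_ennreal)
qed

lemma integrable_gauss: "integrable lborel (gauss :: 'a::euclidean_space \<Rightarrow> real)"
  by (rule integrableI_nonneg) (auto simp: nn_integral_gauss)

lemma integral_gauss: "(\<integral>x. gauss (x::'a::euclidean_space) \<partial>lborel) = 1"
  by (subst integral_eq_nn_integral) (auto simp: nn_integral_gauss)

text \<open>
  Up to its normalisation the Gaussian is its own Fourier transform: the integral factorises over the
  coordinates, and in one coordinate it is the characteristic function of the normal distribution.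
\<close>
lemma gauss_eq_fourier:
  fixes z :: "'a::euclidean_space"
  shows "complex_of_real (gauss z) =
    (1 / sqrt (2 * pi)) ^ DIM('a) * (\<integral>\<xi>. gauss \<xi> * iexp (\<xi> \<bullet> z) \<partial>lborel)"
proof -
  interpret product_sigma_finite "\<lambda>_::'a. lborel :: real measure" ..
  have int1: "integrable lborel (\<lambda>x. complex_of_real (std_normal_density x) * iexp (t * x))" for t
  proof (rule Bochner_Integration.integrable_bound)
    show "integrable lborel std_normal_density" by (rule integrable_normal_density) simp
  qed (auto simp: norm_mult)
  have one: "(\<integral>x. complex_of_real (std_normal_density x) * iexp (t * x) \<partial>lborel) = exp (- t\<^sup>2 / 2)" for t
  proof -
    have "char std_normal_distribution t = (\<integral>x. std_normal_density x *\<^sub>R iexp (t * x) \<partial>lborel)"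
      unfolding char_def by (subst integral_density) auto
    then show ?thesis by (simp add: char_std_normal_distribution scaleR_conv_of_real)
  qed
  have "(\<integral>\<xi>. complex_of_real (gauss \<xi>) * iexp (\<xi> \<bullet> z) \<partial>lborel)
      = (\<integral>f. gauss (\<Sum>b\<in>Basis. f b *\<^sub>R b :: 'a) * iexp ((\<Sum>b\<in>Basis. f b *\<^sub>R b) \<bullet> z)
          \<partial>(\<Pi>\<^sub>M b\<in>(Basis::'a set). lborel))"
    by (subst lborel_eq, subst integral_distr) auto
  also have "\<dots> = (\<integral>f. (\<Prod>b\<in>Basis. std_normal_density (f b) * iexp ((z \<bullet> b) * f b))
          \<partial>(\<Pi>\<^sub>M b\<in>(Basis::'a set). lborel))"
  proof (rule Bochner_Integration.integral_cong[OF refl])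
    fix f :: "'a \<Rightarrow> real"
    have 1: "(\<Sum>b\<in>Basis. f b *\<^sub>R b :: 'a) \<bullet> z = (\<Sum>b\<in>Basis. (z \<bullet> b) * f b)"
      by (simp add: inner_sum_left mult.commute inner_commute[of z])
    show "gauss (\<Sum>b\<in>Basis. f b *\<^sub>R b :: 'a) * iexp ((\<Sum>b\<in>Basis. f b *\<^sub>R b) \<bullet> z) =
      (\<Prod>b\<in>Basis. std_normal_density (f b) * iexp ((z \<bullet> b) * f b))"
      unfolding 1 gauss_def
      by (simp add: prod.distrib exp_sum sum_distrib_left)
  qed
  also have "\<dots> = (\<Prod>b\<in>(Basis::'a set). complex_of_real (exp (- (z \<bullet> b)\<^sup>2 / 2)))"
    by (subst product_integral_prod) (simp_all only: int1 one finite_Basis)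
  finally have *: "(\<integral>\<xi>. complex_of_real (gauss \<xi>) * iexp (\<xi> \<bullet> z) \<partial>lborel)
      = (\<Prod>b\<in>(Basis::'a set). complex_of_real (exp (- (z \<bullet> b)\<^sup>2 / 2)))" .
  have "gauss z = (1 / sqrt (2 * pi)) ^ DIM('a) * (\<Prod>b\<in>Basis. exp (- (z \<bullet> b)\<^sup>2 / 2))"
    unfolding gauss_def normal_density_def by (simp add: prod_dividef power_one_over)
  then show ?thesis unfolding * by simp
qed

lemma integral_lborel_affine:
  fixes h :: "'a::euclidean_space \<Rightarrow> 'b::{banach, second_countable_topology}"
  assumes [measurable]: "h \<in> borel_measurable borel" and "c \<noteq> 0"
  shows "(\<integral>x. h x \<partial>lborel) = \<bar>c\<bar> ^ DIM('a) *\<^sub>R (\<integral>x. h (t + c *\<^sub>R x) \<partial>lborel)"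
  using assms(2)
  by (subst lborel_affine[OF assms(2), of t])
    (simp add: integral_density integral_distr)

lemma nn_integral_lborel_affine:
  fixes h :: "'a::euclidean_space \<Rightarrow> ennreal"
  assumes [measurable]: "h \<in> borel_measurable borel" and "c \<noteq> 0"
  shows "(\<integral>\<^sup>+x. h x \<partial>lborel) = ennreal (\<bar>c\<bar> ^ DIM('a)) * (\<integral>\<^sup>+x. h (t + c *\<^sub>R x) \<partial>lborel)"
  using assms(2)
  by (subst lborel_affine[OF assms(2), of t])
    (simp add: nn_integral_density nn_integral_distr nn_integral_cmult)

lemma lborel_integrable_scaleR:
  fixes h :: "'a::euclidean_space \<Rightarrow> 'b::{banach, second_countable_topology}"
  assumes h: "integrable lborel h" and "c \<noteq> 0"
  shows "integrable lborel (\<lambda>x. h (c *\<^sub>R x))"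
proof -
  have [measurable]: "h \<in> borel_measurable borel" using h by auto
  have "ennreal (\<bar>c\<bar> ^ DIM('a)) * (\<integral>\<^sup>+x. ennreal (norm (h (0 + c *\<^sub>R x))) \<partial>lborel) < \<infinity>"
    using h nn_integral_lborel_affine[OF _ \<open>c \<noteq> 0\<close>, of "\<lambda>x. ennreal (norm (h x))" 0]
    by (simp add: integrable_iff_bounded)
  then show ?thesis using \<open>c \<noteq> 0\<close>
    by (auto simp: integrable_iff_bounded ennreal_mult_less_top)
qed

text \<open>
  Writing the Gaussian as a Fourier integral and exchanging the integrals turns its convolution with
  \<open>f\<close> into an integral of the Fourier transform of \<open>f\<close> against a Gaussian. The bound that results does
  not depend on the width \<open>e\<close>, except for the factor that normalises the Gaussian of that width.
\<close>
lemma integral_gauss_conv_bound: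
  fixes f :: "'a::euclidean_space \<Rightarrow> real" and \<Phi> :: "'a \<Rightarrow> real"
  assumes f: "integrable lborel f" and \<Phi>: "integrable lborel \<Phi>"
    and le: "\<And>\<xi>. cmod (\<integral>y. f y * iexp (- (\<xi> \<bullet> y)) \<partial>lborel) \<le> \<Phi> \<xi>"
    and e: "e > 0"
  shows "\<bar>\<integral>y. f y * gauss ((1/e) *\<^sub>R (x - y)) \<partial>lborel\<bar>
    \<le> e ^ DIM('a) * ((1 / (2 * pi)) ^ DIM('a) * (\<integral>\<xi>. \<Phi> \<xi> \<partial>lborel))"
proof -
  define c where "c = (1 / sqrt (2 * pi)) ^ DIM('a)"
  have c0: "c \<ge> 0" unfolding c_def by simp
  have [measurable]: "f \<in> borel_measurable borel" "\<Phi> \<in> borel_measurable borel" using f \<Phi> by auto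
  have \<Phi>0: "0 \<le> \<Phi> \<xi>" for \<xi> using le[of \<xi>] norm_ge_zero order_trans by blast
  have int: "integrable (lborel \<Otimes>\<^sub>M lborel) (\<lambda>(y, \<xi>). complex_of_real (f y) * (gauss \<xi> * iexp (\<xi> \<bullet> ((1/e) *\<^sub>R (x - y)))))"
  proof (rule Bochner_Integration.integrable_bound)
    show "integrable (lborel \<Otimes>\<^sub>M lborel) (\<lambda>(y::'a, \<xi>::'a). f y * gauss \<xi>)"
      by (rule lborel_pair.Fubini_integrable)
        (auto simp: abs_mult f integrable_gauss intro!: Bochner_Integration.integrable_mult_right AE_I2)
  qed (auto simp: norm_mult split: prod.splits)
  have "complex_of_real (\<integral>y. f y * gauss ((1/e) *\<^sub>R (x - y)) \<partial>lborel)
     = (\<integral>y. complex_of_real (f y) * gauss ((1/e) *\<^sub>R (x - y)) \<partial>lborel)"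
    by (simp flip: integral_complex_of_real)
  also have "\<dots> = (\<integral>y. c * (\<integral>\<xi>. f y * (gauss \<xi> * iexp (\<xi> \<bullet> ((1/e) *\<^sub>R (x - y)))) \<partial>lborel) \<partial>lborel)"
  proof (rule Bochner_Integration.integral_cong[OF refl])
    fix y
    have "(\<integral>\<xi>. f y * (gauss \<xi> * iexp (\<xi> \<bullet> ((1/e) *\<^sub>R (x - y)))) \<partial>lborel) =
      f y * (\<integral>\<xi>. gauss \<xi> * iexp (\<xi> \<bullet> ((1/e) *\<^sub>R (x - y))) \<partial>lborel)"
      by (rule integral_mult_right_zero)
    moreover have "complex_of_real (gauss ((1/e) *\<^sub>R (x - y))) =
      c * (\<integral>\<xi>. gauss \<xi> * iexp (\<xi> \<bullet> ((1/e) *\<^sub>R (x - y))) \<partial>lborel)"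
      unfolding c_def by (rule gauss_eq_fourier)
    ultimately show "f y * complex_of_real (gauss ((1/e) *\<^sub>R (x - y))) =
      c * (\<integral>\<xi>. f y * (gauss \<xi> * iexp (\<xi> \<bullet> ((1/e) *\<^sub>R (x - y)))) \<partial>lborel)"
      by (simp only: mult.left_commute)
  qed
  also have "\<dots> = c * (\<integral>\<xi>. (\<integral>y. f y * (gauss \<xi> * iexp (\<xi> \<bullet> ((1/e) *\<^sub>R (x - y)))) \<partial>lborel) \<partial>lborel)"
    using lborel_pair.Fubini_integral[OF int] by simp
  also have "\<dots> = c * (\<integral>\<xi>. gauss \<xi> * iexp (\<xi> \<bullet> ((1/e) *\<^sub>R x)) * (\<integral>y. f y * iexp (- (((1/e) *\<^sub>R \<xi>) \<bullet> y)) \<partial>lborel) \<partial>lborel)"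
  proof -
    have "(\<integral>y. f y * (gauss \<xi> * iexp (\<xi> \<bullet> ((1/e) *\<^sub>R (x - y)))) \<partial>lborel)
      = gauss \<xi> * iexp (\<xi> \<bullet> ((1/e) *\<^sub>R x)) * (\<integral>y. f y * iexp (- (((1/e) *\<^sub>R \<xi>) \<bullet> y)) \<partial>lborel)" for \<xi>
      unfolding integral_mult_right_zero[symmetric]
      by (intro Bochner_Integration.integral_cong refl)
        (simp add: exp_diff exp_minus inner_diff_right right_diff_distrib diff_divide_distrib field_simps)
    then show ?thesis by simp
  qed
  finally have eq: "complex_of_real (\<integral>y. f y * gauss ((1/e) *\<^sub>R (x - y)) \<partial>lborel) =
    c * (\<integral>\<xi>. gauss \<xi> * iexp (\<xi> \<bullet> ((1/e) *\<^sub>R x)) * (\<integral>y. f y * iexp (- (((1/e) *\<^sub>R \<xi>) \<bullet> y)) \<partial>lborel) \<partial>lborel)" .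
  have \<Phi>e: "integrable lborel (\<lambda>\<xi>. \<Phi> ((1/e) *\<^sub>R \<xi>))"
    using lborel_integrable_scaleR[OF \<Phi>] e by simp
  have "\<bar>\<integral>y. f y * gauss ((1/e) *\<^sub>R (x - y)) \<partial>lborel\<bar> =
    c * cmod (\<integral>\<xi>. gauss \<xi> * iexp (\<xi> \<bullet> ((1/e) *\<^sub>R x)) * (\<integral>y. f y * iexp (- (((1/e) *\<^sub>R \<xi>) \<bullet> y)) \<partial>lborel) \<partial>lborel)"
    using arg_cong[OF eq, of cmod] c0 by (simp add: norm_mult)
  also have "\<dots> \<le> c * (\<integral>\<xi>. c * \<Phi> ((1/e) *\<^sub>R \<xi>) \<partial>lborel)"
  proof (intro mult_left_mono c0 order_trans[OF integral_norm_bound] integral_mono')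
    fix \<xi> :: 'a
    show "cmod (gauss \<xi> * iexp (\<xi> \<bullet> ((1/e) *\<^sub>R x)) * (\<integral>y. f y * iexp (- (((1/e) *\<^sub>R \<xi>) \<bullet> y)) \<partial>lborel)) \<le> c * \<Phi> ((1/e) *\<^sub>R \<xi>)"
      using gauss_le[of \<xi>] le[of "(1/e) *\<^sub>R \<xi>"] c0
      by (simp add: norm_mult c_def mult_mono del: of_real_minus inner_scaleR_left)
  qed (use \<Phi>e c0 \<Phi>0 in auto)
  also have "\<dots> = c * c * (\<integral>\<xi>. \<Phi> ((1/e) *\<^sub>R \<xi>) \<partial>lborel)" by simp
  also have "(\<integral>\<xi>. \<Phi> ((1/e) *\<^sub>R \<xi>) \<partial>lborel) = e ^ DIM('a) * (\<integral>\<xi>. \<Phi> \<xi> \<partial>lborel)"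
    using integral_lborel_affine[of "\<lambda>\<xi>. \<Phi> ((1/e) *\<^sub>R \<xi>)" e 0] e by simp
  also have "c * c = (1 / (2 * pi)) ^ DIM('a)"
    unfolding c_def by (simp flip: power_mult_distrib)
  finally show ?thesis by (simp add: mult_ac)
qed

text \<open>
  The bound of the previous lemma survives the limit of vanishing width when \<open>f\<close> is tested against a
  bounded continuous function: by Fubini the Gaussian may be moved to \<open>\<phi>\<close>, and the mollified \<open>\<phi>\<close>
  converge to \<open>\<phi>\<close> pointwise and boundedly.
\<close>
lemma integral_test_bound:
  fixes f \<phi> :: "'a::euclidean_space \<Rightarrow> real" and \<Phi> :: "'a \<Rightarrow> real"
  assumes f: "integrable lborel f" and \<Phi>: "integrable lborel \<Phi>"
    and le: "\<And>\<xi>. cmod (\<integral>y. f y * iexp (- (\<xi> \<bullet> y)) \<partial>lborel) \<le> \<Phi> \<xi>"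
    and \<phi>: "integrable lborel \<phi>" "continuous_on UNIV \<phi>" "\<And>x. \<bar>\<phi> x\<bar> \<le> B"
  shows "\<bar>\<integral>y. f y * \<phi> y \<partial>lborel\<bar>
    \<le> (1 / (2 * pi)) ^ DIM('a) * (\<integral>\<xi>. \<Phi> \<xi> \<partial>lborel) * (\<integral>x. \<bar>\<phi> x\<bar> \<partial>lborel)"
proof -
  define D where "D = (1 / (2 * pi)) ^ DIM('a) * (\<integral>\<xi>. \<Phi> \<xi> \<partial>lborel)"
  have [measurable]: "f \<in> borel_measurable borel" "\<phi> \<in> borel_measurable borel" using f \<phi> by auto
  have B0: "B \<ge> 0" using \<phi>(3)[of 0] by linarith
  define \<phi>' where "\<phi>' e y = (\<integral>z. \<phi> (y + e *\<^sub>R z) * gauss z \<partial>lborel)" for e y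
  have bound: "\<bar>\<integral>y. f y * \<phi>' e y \<partial>lborel\<bar> \<le> D * (\<integral>x. \<bar>\<phi> x\<bar> \<partial>lborel)" if e: "e > 0" for e
  proof -
    define G where "G = (1 / sqrt (2 * pi)) ^ DIM('a)"
    have int: "integrable (lborel \<Otimes>\<^sub>M lborel) (\<lambda>(y, x). f y * (\<phi> x * gauss ((1/e) *\<^sub>R (x - y))))"
    proof (rule Bochner_Integration.integrable_bound)
      show "integrable (lborel \<Otimes>\<^sub>M lborel) (\<lambda>(y::'a, x::'a). G * (f y * \<phi> x))"
        by (rule lborel_pair.Fubini_integrable)
          (auto simp: abs_mult f \<phi> intro!: Bochner_Integration.integrable_mult_right AE_I2)
      have "\<bar>f y * (\<phi> x * gauss ((1/e) *\<^sub>R (x - y)))\<bar> \<le> \<bar>G * (f y * \<phi> x)\<bar>" for x y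
        using gauss_le[of "(1/e) *\<^sub>R (x - y)"] mult_right_mono[of "gauss ((1/e) *\<^sub>R (x - y))" G "\<bar>f y * \<phi> x\<bar>"]
        by (simp add: abs_mult G_def mult_ac)
      then show "AE p in lborel \<Otimes>\<^sub>M lborel. norm (case p of (y, x) \<Rightarrow> f y * (\<phi> x * gauss ((1/e) *\<^sub>R (x - y))))
        \<le> norm (case p of (y, x) \<Rightarrow> G * (f y * \<phi> x))"
        by (auto intro!: AE_I2)
    qed auto
    have "e ^ DIM('a) * (\<integral>y. f y * \<phi>' e y \<partial>lborel) = (\<integral>y. f y * (e ^ DIM('a) * \<phi>' e y) \<partial>lborel)"
      unfolding integral_mult_right_zero[symmetric] by (simp only: mult.left_commute)
    also have "\<dots> = (\<integral>y. (\<integral>x. f y * (\<phi> x * gauss ((1/e) *\<^sub>R (x - y))) \<partial>lborel) \<partial>lborel)"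
    proof (rule Bochner_Integration.integral_cong[OF refl])
      fix y
      show "f y * (e ^ DIM('a) * \<phi>' e y) = (\<integral>x. f y * (\<phi> x * gauss ((1/e) *\<^sub>R (x - y))) \<partial>lborel)"
        using integral_lborel_affine[of "\<lambda>x. \<phi> x * gauss ((1/e) *\<^sub>R (x - y))" e y] e
        by (simp add: \<phi>'_def)
    qed
    also have "\<dots> = (\<integral>x. (\<integral>y. f y * (\<phi> x * gauss ((1/e) *\<^sub>R (x - y))) \<partial>lborel) \<partial>lborel)"
      using lborel_pair.Fubini_integral[OF int] by simp
    also have "\<dots> = (\<integral>x. \<phi> x * (\<integral>y. f y * gauss ((1/e) *\<^sub>R (x - y)) \<partial>lborel) \<partial>lborel)"
      by (simp add: mult.left_commute[of _ "\<phi> _"])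
    finally have eq: "e ^ DIM('a) * (\<integral>y. f y * \<phi>' e y \<partial>lborel) =
      (\<integral>x. \<phi> x * (\<integral>y. f y * gauss ((1/e) *\<^sub>R (x - y)) \<partial>lborel) \<partial>lborel)" .
    have "e ^ DIM('a) * \<bar>\<integral>y. f y * \<phi>' e y \<partial>lborel\<bar> =
      \<bar>\<integral>x. \<phi> x * (\<integral>y. f y * gauss ((1/e) *\<^sub>R (x - y)) \<partial>lborel) \<partial>lborel\<bar>"
      unfolding eq[symmetric] using e by (simp add: abs_mult power_abs)
    also have "\<dots> \<le> (\<integral>x. e ^ DIM('a) * D * \<bar>\<phi> x\<bar> \<partial>lborel)"
      unfolding real_norm_def[symmetric]
    proof (intro order_trans[OF integral_norm_bound] integral_mono')
      fix x
      show "norm (\<phi> x * (\<integral>y. f y * gauss ((1/e) *\<^sub>R (x - y)) \<partial>lborel)) \<le> e ^ DIM('a) * D * norm (\<phi> x)"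
        using mult_left_mono[OF integral_gauss_conv_bound[OF f \<Phi> le e, of x], of "\<bar>\<phi> x\<bar>"]
        by (simp add: abs_mult D_def mult_ac)
      show "0 \<le> e ^ DIM('a) * D * norm (\<phi> x)"
        using e le by (auto simp: D_def intro!: mult_nonneg_nonneg integral_nonneg_AE AE_I2 intro: order_trans[OF norm_ge_zero])
    qed (use \<phi> in auto)
    finally show ?thesis using e by (simp add: mult.assoc)
  qed
  \<comment> \<open>The widths of the Gaussians along which the limit is taken.\<close>
  define e where "e k = 1 / real (Suc k)" for k
  have e0: "e \<longlonglongrightarrow> 0" unfolding e_def by (rule LIMSEQ_Suc[OF lim_1_over_n])
  have lim1: "(\<lambda>k. \<phi>' (e k) y) \<longlonglongrightarrow> (\<integral>z. \<phi> y * gauss (z::'a) \<partial>lborel)" for y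
    unfolding \<phi>'_def
  proof (rule Bochner_Integration.integral_dominated_convergence)
    show "integrable lborel (\<lambda>z::'a. B * gauss z)" by (simp add: integrable_gauss)
    show "AE z in lborel. (\<lambda>k. \<phi> (y + e k *\<^sub>R z) * gauss z) \<longlonglongrightarrow> \<phi> y * gauss z"
    proof (intro AE_I2 tendsto_mult tendsto_const)
      fix z
      have "(\<lambda>k. y + e k *\<^sub>R z) \<longlonglongrightarrow> y + 0 *\<^sub>R z" by (intro tendsto_intros e0)
      moreover have "isCont \<phi> (y + 0 *\<^sub>R z)" using \<phi>(2) by (simp add: continuous_on_eq_continuous_at)
      ultimately show "(\<lambda>k. \<phi> (y + e k *\<^sub>R z)) \<longlonglongrightarrow> \<phi> y"
        using isCont_tendsto_compose by fastforce
    qed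
  qed (auto simp: abs_mult \<phi>(3) mult_right_mono)
  have \<phi>'_le: "\<bar>\<phi>' e y\<bar> \<le> B" for e y
  proof -
    have "\<bar>\<phi>' e y\<bar> \<le> (\<integral>z. B * gauss (z::'a) \<partial>lborel)"
      unfolding \<phi>'_def real_norm_def[symmetric]
      by (intro order_trans[OF integral_norm_bound] integral_mono')
        (auto simp: abs_mult \<phi>(3) mult_right_mono B0 integrable_gauss)
    then show ?thesis by (simp add: integral_gauss)
  qed
  have [measurable]: "\<phi>' e \<in> borel_measurable borel" for e
    unfolding \<phi>'_def by measurable
  have "(\<lambda>k. \<integral>y. f y * \<phi>' (e k) y \<partial>lborel) \<longlonglongrightarrow> (\<integral>y. f y * \<phi> y \<partial>lborel)"
  proof (rule Bochner_Integration.integral_dominated_convergence)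
    show "integrable lborel (\<lambda>y. B * \<bar>f y\<bar>)" using f by simp
    show "AE y in lborel. (\<lambda>k. f y * \<phi>' (e k) y) \<longlonglongrightarrow> f y * \<phi> y"
      using lim1 by (auto simp: integral_gauss intro!: tendsto_mult)
  qed (auto simp: abs_mult \<phi>'_le mult_left_mono mult.commute[of B])
  then have "(\<lambda>k. \<bar>\<integral>y. f y * \<phi>' (e k) y \<partial>lborel\<bar>) \<longlonglongrightarrow> \<bar>\<integral>y. f y * \<phi> y \<partial>lborel\<bar>"
    by (rule tendsto_rabs)
  moreover have "\<bar>\<integral>y. f y * \<phi>' (e k) y \<partial>lborel\<bar> \<le> D * (\<integral>x. \<bar>\<phi> x\<bar> \<partial>lborel)" for k
    by (rule bound) (simp add: e_def)
  ultimately show ?thesis unfolding D_def[symmetric]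
    by (intro LIMSEQ_le_const2) auto
qed

text \<open>
  The indicator of a compact set is the bounded limit of continuous functions supported in a fixed ball.
\<close>
lemma integral_compact_bound:
  fixes f :: "'a::euclidean_space \<Rightarrow> real"
  assumes f: "integrable lborel f" 
    and test: "\<And>\<phi> B. integrable lborel \<phi> \<Longrightarrow> continuous_on UNIV \<phi> \<Longrightarrow> (\<And>x. \<bar>\<phi> x\<bar> \<le> B) \<Longrightarrow>
      \<bar>\<integral>y. f y * \<phi> y \<partial>lborel\<bar> \<le> D * (\<integral>x. \<bar>\<phi> x\<bar> \<partial>lborel)"
    and K: "compact K"
  shows "\<bar>\<integral>y. f y * indicator K y \<partial>lborel\<bar> \<le> D * measure lborel K"
proof (cases "K = {}")
  case False
  have [measurable]: "f \<in> borel_measurable borel" "K \<in> sets borel" using f K by (auto intro: borel_compact)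
  define \<phi> where "\<phi> k x = max 0 (1 - real (Suc k) * infdist x K)" for k x
  obtain R where R: "K \<subseteq> cball 0 R" using compact_imp_bounded[OF K] by (auto simp: bounded_iff subset_iff)
  have \<phi>0: "0 \<le> \<phi> k x" "\<phi> k x \<le> 1" for k x unfolding \<phi>_def by (auto simp: infdist_nonneg)
  have \<phi>_le: "\<phi> k x \<le> indicator (cball 0 (R + 1)) x" for k x
  proof (cases "x \<in> cball 0 (R + 1)")
    case False
    have "1 \<le> infdist x K"
      unfolding infdist_notempty[OF \<open>K \<noteq> {}\<close>]
    proof (rule cINF_greatest[OF \<open>K \<noteq> {}\<close>])
      fix a assume "a \<in> K"
      with R have "norm a \<le> R" by auto
      then show "1 \<le> dist x a" using False norm_triangle_ineq2[of x a] by (simp add: dist_norm)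
    qed
    then have "1 \<le> real (Suc k) * infdist x K"
      using mult_mono[of 1 "real (Suc k)" 1 "infdist x K"] by simp
    then show ?thesis using False by (simp add: \<phi>_def)
  qed (simp add: \<phi>0)
  have cont: "continuous_on UNIV (\<phi> k)" for k
    unfolding \<phi>_def by (intro continuous_intros)
  have [measurable]: "\<phi> k \<in> borel_measurable borel" for k
    using cont by (rule borel_measurable_continuous_onI)
  have ind: "integrable lborel (indicator (cball (0::'a) (R + 1)) :: 'a \<Rightarrow> real)"
    using emeasure_compact_finite[OF compact_cball, of 0 "R + 1"] by (intro integrable_real_indicator) auto
  have int: "integrable lborel (\<phi> k)" for k
    by (rule Bochner_Integration.integrable_bound[OF ind]) (use \<phi>_le \<phi>0 in auto)
  have lim: "(\<lambda>k. \<phi> k x) \<longlonglongrightarrow> indicator K x" for x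
  proof (cases "x \<in> K")
    case True
    then show ?thesis by (simp add: \<phi>_def)
  next
    case False
    then have pos: "infdist x K > 0"
      using in_closed_iff_infdist_zero[OF compact_imp_closed[OF K] \<open>K \<noteq> {}\<close>, of x] infdist_nonneg[of x K] by auto
    obtain N where N: "1 < real N * infdist x K" using ex_less_of_nat_mult[OF pos] by auto
    have "\<phi> k x = 0" if "k \<ge> N" for k
    proof -
      have "real N * infdist x K \<le> real (Suc k) * infdist x K" using that pos by (intro mult_right_mono) auto
      then show ?thesis using N by (simp add: \<phi>_def)
    qed
    then have "\<forall>\<^sub>F k in sequentially. \<phi> k x = indicator K x"
      using False by (auto simp: eventually_sequentially)
    then show ?thesis by (rule tendsto_eventually)
  qed
  have 1: "(\<lambda>k. \<integral>y. f y * \<phi> k y \<partial>lborel) \<longlonglongrightarrow> (\<integral>y. f y * indicator K y \<partial>lborel)"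
  proof (rule Bochner_Integration.integral_dominated_convergence)
    show "integrable lborel (\<lambda>y. \<bar>f y\<bar>)" using f by simp
  qed (use lim \<phi>0 in \<open>auto simp: abs_mult mult_left_le intro!: tendsto_mult\<close>)
  have 2: "(\<lambda>k. \<integral>y. \<bar>\<phi> k y\<bar> \<partial>lborel) \<longlonglongrightarrow> (\<integral>y. indicator K y \<partial>lborel)"
  proof (rule Bochner_Integration.integral_dominated_convergence[OF _ _ ind])
    show "AE x in lborel. (\<lambda>k. \<bar>\<phi> k x\<bar>) \<longlonglongrightarrow> indicator K x"
      using lim \<phi>0 by simp
  qed (use \<phi>_le \<phi>0 in auto)
  have "\<bar>\<integral>y. f y * indicator K y \<partial>lborel\<bar> \<le> D * (\<integral>y. indicator K y \<partial>lborel)"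
  proof (rule LIMSEQ_le[OF tendsto_rabs[OF 1] tendsto_mult[OF tendsto_const 2]], intro exI[of _ 0] allI impI)
    fix k
    show "\<bar>\<integral>y. f y * \<phi> k y \<partial>lborel\<bar> \<le> D * (\<integral>y. \<bar>\<phi> k y\<bar> \<partial>lborel)"
      by (rule test[OF int cont, where B=1]) (use \<phi>0 in auto)
  qed
  then show ?thesis by simp
qed simp

text \<open>
  If \<open>f\<close> exceeded \<open>D\<close> by some \<open>d > 0\<close> on a set of positive measure, then by inner regularity it would
  do so on a compact set of positive measure, whose average would be too large.
\<close>
lemma AE_le_of_compact_averages:
  fixes f :: "'a::euclidean_space \<Rightarrow> real"
  assumes f: "integrable lborel f" 
    and K: "\<And>K. compact K \<Longrightarrow> (\<integral>y. f y * indicator K y \<partial>lborel) \<le> D * measure lborel K"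
  shows "AE x in lborel. f x \<le> D"
proof -
  have [measurable]: "f \<in> borel_measurable borel" using f by auto
  have *: "measure lborel K = 0" if "compact K" "K \<subseteq> {x. D + d < f x}" "d > 0" for K d
  proof -
    have [measurable]: "K \<in> sets borel" using that by (auto intro: borel_compact)
    have fin: "emeasure lborel K < \<infinity>" using that(1) by (rule emeasure_compact_finite)
    have "(D + d) * measure lborel K = (\<integral>y. (D + d) * indicator K y \<partial>lborel)" by simp
    also have "\<dots> \<le> (\<integral>y. f y * indicator K y \<partial>lborel)"
    proof (rule integral_mono)
      show "integrable lborel (\<lambda>y. (D + d) * indicator K y)"
        using fin by (intro integrable_mult_right integrable_real_indicator) auto
      show "integrable lborel (\<lambda>y. f y * indicator K y)"
        by (rule Bochner_Integration.integrable_bound[OF f]) (auto simp: indicator_def)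
      show "(D + d) * indicator K y \<le> f y * indicator K y" for y
        using that(2) by (auto simp: indicator_def intro: less_imp_le)
    qed
    also have "\<dots> \<le> D * measure lborel K" using K that by auto
    finally have "d * measure lborel K \<le> 0" by (simp add: algebra_simps)
    then show ?thesis using \<open>d > 0\<close> measure_nonneg[of lborel K] by (simp add: mult_le_0_iff antisym)
  qed
  have null: "{x. D + d < f x} \<inter> cball 0 R \<in> null_sets lborel" if "d > 0" for d R
  proof -
    let ?S = "{x. D + d < f x} \<inter> cball 0 R"
    have S: "?S \<in> sets lborel" by measurable
    have S_leb: "?S \<in> sets lebesgue" using sets_completionI_sets[OF S] .
    have le: "emeasure lborel ?S \<le> ennreal e" if "e > 0" for e
    proof -
      obtain T where T: "closed T" "T \<subseteq> ?S" "?S - T \<in> lmeasurable" "emeasure lebesgue (?S - T) < ennreal e"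
        by (rule sets_lebesgue_inner_closed[OF S_leb \<open>e > 0\<close>])
      have "T \<subseteq> cball 0 R" using T(2) by auto
      then have "bounded T" by (rule bounded_subset[OF bounded_cball])
      then have cT: "compact T" using T(1) by (simp add: compact_eq_bounded_closed)
      have "measure lborel T = 0" using *[OF cT _ \<open>d > 0\<close>] T(2) by blast
      then have eT: "emeasure lborel T = 0" using emeasure_compact_finite[OF cT]
        by (simp add: measure_eq_emeasure_eq_ennreal emeasure_eq_ennreal_measure)
      have [measurable]: "T \<in> sets borel" using T(1) by auto
      have "emeasure lborel ?S \<le> emeasure lborel (T \<union> (?S - T))" by (rule emeasure_mono) auto
      also have "\<dots> \<le> emeasure lborel T + emeasure lborel (?S - T)"
        by (rule emeasure_subadditive) auto
      also have "\<dots> \<le> ennreal e" using T(4) eT by (simp add: less_imp_le)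
      finally show ?thesis .
    qed
    have "emeasure lborel ?S \<le> 0"
      by (rule ennreal_le_epsilon) (simp add: le)
    then show ?thesis using S by (auto simp: null_sets_def)
  qed
  have "AE x in lborel. \<forall>j R. \<not> (D + 1 / real (Suc j) < f x \<and> x \<in> cball 0 (real R))"
    unfolding AE_all_countable
  proof (intro allI)
    fix j R :: nat
    show "AE x in lborel. \<not> (D + 1 / real (Suc j) < f x \<and> x \<in> cball 0 (real R))"
      using AE_not_in[OF null[of "1 / real (Suc j)" "real R"]] by simp
  qed
  then show ?thesis
  proof (rule AE_mp, intro AE_I2 impI)
    fix x assume x: "\<forall>j R. \<not> (D + 1 / real (Suc j) < f x \<and> x \<in> cball 0 (real R))"
    obtain R :: nat where "norm x \<le> real R" using real_arch_simple by blast
    then have le: "f x \<le> D + 1 / real (Suc j)" for j using x by (auto simp: not_less)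
    have "(\<lambda>j. D + 1 / real (Suc j)) \<longlonglongrightarrow> D + 0"
      by (intro tendsto_intros LIMSEQ_Suc[OF lim_1_over_n])
    then show "f x \<le> D" using le by (intro LIMSEQ_le_const) auto
  qed
qed

text \<open>
  The quantitative form of Fourier inversion that the kernel estimates rest on; with \<open>\<Phi> = 0\<close> it says
  that an integrable function with vanishing Fourier transform vanishes almost everywhere.
\<close>
theorem AE_abs_le_of_fourier_bound:
  fixes f :: "'a::euclidean_space \<Rightarrow> real" and \<Phi> :: "'a \<Rightarrow> real"
  assumes f: "integrable lborel f" and \<Phi>: "integrable lborel \<Phi>"
    and le: "\<And>\<xi>. cmod (\<integral>y. f y * iexp (- (\<xi> \<bullet> y)) \<partial>lborel) \<le> \<Phi> \<xi>"
  shows "AE x in lborel. \<bar>f x\<bar> \<le> (1 / (2 * pi)) ^ DIM('a) * (\<integral>\<xi>. \<Phi> \<xi> \<partial>lborel)"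
proof -
  define D where "D = (1 / (2 * pi)) ^ DIM('a) * (\<integral>\<xi>. \<Phi> \<xi> \<partial>lborel)"
  have K: "\<bar>\<integral>y. f y * indicator K y \<partial>lborel\<bar> \<le> D * measure lborel K" if "compact K" for K
    using integral_compact_bound[OF f _ that, of D] integral_test_bound[OF f \<Phi> le]
    unfolding D_def by blast
  have "AE x in lborel. f x \<le> D"
    by (rule AE_le_of_compact_averages[OF f]) (use K abs_le_D1 in blast)
  moreover have "AE x in lborel. - f x \<le> D"
    by (rule AE_le_of_compact_averages) (use f K abs_le_D2 in auto)
  ultimately show ?thesis unfolding D_def[symmetric] by (auto simp: abs_le_iff)
qed

section \<open>Pointwise and integral bounds for the heat kernel\<close>

text \<open>
  The given functions are only Lebesgue measurable, whereas Fubini needs Borel functions on the product.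
  This lemma replaces an integrand by a Borel representative; completeness of the Lebesgue measure
  supplies the measurability of \<open>f\<close>.
\<close>
lemma lebesgue_integral_AE_eq_lborel:
  fixes f g :: "'a::euclidean_space \<Rightarrow> 'b::{banach, second_countable_topology}"
  assumes g: "g \<in> borel_measurable lborel" and eq: "AE x in lebesgue. f x = g x"
  shows "f \<in> borel_measurable lebesgue" and "integral\<^sup>L lebesgue f = integral\<^sup>L lborel g"
proof -
  obtain N where N: "N \<in> null_sets lebesgue" "{x. f x \<noteq> g x} \<subseteq> N"
    using eq by (auto simp: eventually_ae_filter)
  have g': "g \<in> borel_measurable lebesgue" using g by (rule measurable_completion)
  show f: "f \<in> borel_measurable lebesgue"
  proof (rule measurableI)
    fix S :: "'b set" assume S: "S \<in> sets borel"
    have eq: "f -` S \<inter> space lebesgue = (g -` S - N) \<union> (f -` S \<inter> N)" using N(2) by auto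
    have "g -` S \<in> sets lebesgue" using measurable_sets[OF g' S] by simp
    moreover have "f -` S \<inter> N \<in> sets lebesgue"
      using N(1) null_sets_completion_subset[of "f -` S \<inter> N" N lborel] by auto
    moreover have "N \<in> sets lebesgue" using N(1) by auto
    ultimately show "f -` S \<inter> space lebesgue \<in> sets lebesgue"
      unfolding eq by (intro sets.Un sets.Diff)
  qed simp
  have "integral\<^sup>L lebesgue f = integral\<^sup>L lebesgue g" by (rule integral_cong_AE[OF f g' eq])
  then show "integral\<^sup>L lebesgue f = integral\<^sup>L lborel g" using g by (simp add: integral_completion)
qed

lemma le_suminf_ennreal:
  fixes F :: "nat \<Rightarrow> ennreal"
  shows "F k \<le> (\<Sum>j. F j)"
  using sum_le_suminf[of F "{k}"] by simp

text \<open>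
  On the shell between the radii \<open>k\<close> and \<open>k + 1\<close> the function is at most \<open>exp (- (k powr a))\<close>, which
  beats the polynomial growth of the volumes.
\<close>
lemma integrable_exp_minus_norm_powr:
  assumes a: "a > 0"
  shows "integrable lborel (\<lambda>\<xi>::'a::euclidean_space. exp (- (norm \<xi> powr a)))"
proof (rule integrableI_nonneg)
  define d where "d = DIM('a)"
  define c where "c k = exp (- (real k powr a))" for k
  have "summable (\<lambda>k. c k * (real k + 1) powr real d)"
  proof (rule summable_comparison_test_bigo)
    show "summable (\<lambda>k. norm (1 / real k ^ 2))" using inverse_power_summable[of 2, where 'a=real] by (simp add: inverse_eq_divide)
    show "(\<lambda>k. c k * (real k + 1) powr real d) \<in> O(\<lambda>k. 1 / real k ^ 2)"
      unfolding c_def using a by real_asymp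
  qed
  then have "summable (\<lambda>k. unit_ball_vol d * (c k * (real k + 1) powr real d))" by (rule summable_mult)
  then have sum: "summable (\<lambda>k. c k * (unit_ball_vol d * (real k + 1) ^ d))"
    by (simp add: powr_realpow mult_ac)
  have pw: "ennreal (exp (- (norm \<xi> powr a))) \<le> (\<Sum>k. ennreal (c k) * indicator (cball 0 (real k + 1)) \<xi>)" for \<xi> :: 'a
  proof -
    define k where "k = nat \<lfloor>norm \<xi>\<rfloor>"
    have k: "real k \<le> norm \<xi>" "norm \<xi> \<le> real k + 1" 
    proof -
      have "real k = of_int \<lfloor>norm \<xi>\<rfloor>" unfolding k_def by (simp add: of_nat_nat)
      then show "real k \<le> norm \<xi>" "norm \<xi> \<le> real k + 1" by linarith+
    qed
    have "ennreal (exp (- (norm \<xi> powr a))) \<le> ennreal (c k) * indicator (cball 0 (real k + 1)) \<xi>"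
      using k a by (auto simp: c_def intro!: ennreal_leI powr_mono2)
    also have "\<dots> \<le> (\<Sum>j. ennreal (c j) * indicator (cball 0 (real j + 1)) \<xi>)"
      by (rule le_suminf_ennreal)
    finally show ?thesis .
  qed
  have "(\<integral>\<^sup>+\<xi>. ennreal (exp (- (norm (\<xi>::'a) powr a))) \<partial>lborel) \<le>
      (\<integral>\<^sup>+\<xi>. (\<Sum>k. ennreal (c k) * indicator (cball 0 (real k + 1)) (\<xi>::'a)) \<partial>lborel)"
    by (intro nn_integral_mono pw)
  also have "\<dots> = (\<Sum>k. \<integral>\<^sup>+\<xi>. ennreal (c k) * indicator (cball 0 (real k + 1)) (\<xi>::'a) \<partial>lborel)"
  proof (rule nn_integral_suminf)
    fix k
    have [measurable]: "cball (0::'a) (real k + 1) \<in> sets lborel" by simp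
    show "(\<lambda>\<xi>::'a. ennreal (c k) * indicator (cball 0 (real k + 1)) \<xi>) \<in> borel_measurable lborel" by measurable
  qed
  also have "\<dots> = (\<Sum>k. ennreal (c k * (unit_ball_vol d * (real k + 1) ^ d)))"
    by (simp add: nn_integral_cmult_indicator emeasure_cball ennreal_mult c_def d_def)
  also have "\<dots> = ennreal (\<Sum>k. c k * (unit_ball_vol d * (real k + 1) ^ d))"
    by (rule suminf_ennreal2[OF _ sum]) (simp add: c_def)
  finally show "(\<integral>\<^sup>+\<xi>. ennreal (exp (- (norm (\<xi>::'a) powr a))) \<partial>lborel) < \<infinity>"
    using le_less_trans by fastforce
qed auto

text \<open>
  For \<open>s > 0\<close> the functions \<open>g s\<close> are unrelated members of their equivalence classes. They are replaced
  by the rescalings of one bounded Borel representative \<open>\<gamma>\<close> of \<open>g 1\<close>, which are jointly measurable and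
  have the same Fourier transforms. The mass is then the same for all \<open>s\<close>, and the supremum scales like
  \<open>s powr (-n/2m)\<close>.
\<close>
lemma heat_kernel_representative:
  fixes g :: "real \<Rightarrow> real ^ 'n::finite \<Rightarrow> real"
  assumes g: "is_heat_kernel m g" and m: "m > 0"
  obtains k :: "real \<Rightarrow> real ^ 'n \<Rightarrow> real" and K :: real where
    "K > 0" "(\<lambda>(s, x). k s x) \<in> borel_measurable borel"
    "\<And>s. s > 0 \<Longrightarrow> AE x in lborel. g s x = k s x"
    "\<And>s. s > 0 \<Longrightarrow> (\<integral>\<^sup>+x. ennreal \<bar>k s x\<bar> \<partial>lborel) \<le> ennreal K"
    "\<And>s x. s > 0 \<Longrightarrow> \<bar>k s x\<bar> \<le> K * s powr (- (real CARD('n) / (2 * m)))"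
proof -
  define \<Phi> where "\<Phi> \<xi> = exp (- (norm \<xi> powr (2 * m)))" for \<xi> :: "real ^ 'n"
  have \<Phi>: "integrable lborel \<Phi>" unfolding \<Phi>_def using m by (intro integrable_exp_minus_norm_powr) simp
  have ex: "\<exists>h. integrable lborel h \<and> (AE x in lborel. g s x = h x) \<and>
      (\<forall>\<xi>. (\<integral>y. h y * iexp (- (\<xi> \<bullet> y)) \<partial>lborel) = of_real (exp (- s * norm \<xi> powr (2 * m))))" if "s > 0" for s
  proof -
    have int: "integrable lebesgue (g s)" and ft: "\<And>\<xi>. fourier (g s) \<xi> = of_real (exp (- s * norm \<xi> powr (2 * m)))"
      using g \<open>s > 0\<close> unfolding is_heat_kernel_def by auto
    obtain h where h: "h \<in> borel_measurable lborel" "AE x in lborel. g s x = h x"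
      using completion_ex_borel_measurable_real[of "g s" lborel] int by auto
    have [measurable]: "h \<in> borel_measurable borel" using h by simp
    have "(\<integral>\<^sup>+x. norm (h x) \<partial>lborel) = (\<integral>\<^sup>+x. norm (g s x) \<partial>lborel)"
      by (rule nn_integral_cong_AE) (use h(2) in auto)
    also have "\<dots> < \<infinity>" using int by (simp add: integrable_iff_bounded nn_integral_completion)
    finally have "integrable lborel h" by (simp add: integrable_iff_bounded)
    moreover have "(\<integral>y. h y * iexp (- (\<xi> \<bullet> y)) \<partial>lborel) = of_real (exp (- s * norm \<xi> powr (2 * m)))" for \<xi>
    proof -
      have "fourier (g s) \<xi> = (\<integral>y. h y * iexp (- (\<xi> \<bullet> y)) \<partial>lborel)"
        unfolding fourier_def
      proof (rule lebesgue_integral_AE_eq_lborel(2))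
        show "AE x in lebesgue. exp (- \<i> * complex_of_real (\<xi> \<bullet> x)) * complex_of_real (g s x) = h x * iexp (- (\<xi> \<bullet> x))"
          using AE_completion[OF h(2)] by eventually_elim simp
      qed measurable
      then show ?thesis using ft by simp
    qed
    ultimately show ?thesis using h(2) by blast
  qed
  define P where "P s h \<longleftrightarrow> integrable lborel h \<and> (AE x in lborel. g s x = h x) \<and>
      (\<forall>\<xi>. (\<integral>y. h y * iexp (- (\<xi> \<bullet> y)) \<partial>lborel) = of_real (exp (- s * norm \<xi> powr (2 * m))))" for s h
  define h where "h s = (SOME h. P s h)" for s
  have "P s (h s)" if "s > 0" for s
  proof -
    have "\<exists>h. P s h" unfolding P_def by (rule ex[OF that])
    then show ?thesis unfolding h_def by (rule someI_ex)
  qed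
  then have h: "\<And>s. s > 0 \<Longrightarrow> integrable lborel (h s)"
      "\<And>s. s > 0 \<Longrightarrow> AE x in lborel. g s x = h s x"
      "\<And>s \<xi>. s > 0 \<Longrightarrow> (\<integral>y. h s y * iexp (- (\<xi> \<bullet> y)) \<partial>lborel) = of_real (exp (- s * norm \<xi> powr (2 * m)))"
    unfolding P_def by blast+
  define D where "D = (1 / (2 * pi)) ^ DIM(real ^ 'n) * (\<integral>\<xi>. \<Phi> \<xi> \<partial>lborel)"
  have D: "AE x in lborel. \<bar>h 1 x\<bar> \<le> D"
  proof -
    have "cmod (\<integral>y. h 1 y * iexp (- (\<xi> \<bullet> y)) \<partial>lborel) \<le> \<Phi> \<xi>" for \<xi>
      using h(3)[of 1 \<xi>] by (simp add: \<Phi>_def)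
    from AE_abs_le_of_fourier_bound[OF h(1)[of 1] \<Phi> this] show ?thesis unfolding D_def by simp
  qed
  have D0: "D \<ge> 0" unfolding D_def \<Phi>_def by (intro mult_nonneg_nonneg integral_nonneg) auto
  define \<gamma> where "\<gamma> x = (if \<bar>h 1 x\<bar> \<le> D then h 1 x else 0)" for x
  have [measurable]: "h s \<in> borel_measurable borel" if "s > 0" for s using h(1)[OF that] by auto
  have h1 [measurable]: "h 1 \<in> borel_measurable borel" using h(1)[of 1] by auto
  have \<gamma>m [measurable]: "\<gamma> \<in> borel_measurable borel" unfolding \<gamma>_def by measurable
  have \<gamma>_eq: "AE x in lborel. \<gamma> x = h 1 x" using D by eventually_elim (simp add: \<gamma>_def)
  have \<gamma>_int: "integrable lborel \<gamma>"
    using integrable_cong_AE[THEN iffD2, OF _ _ \<gamma>_eq] h(1)[of 1] by simp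
  have \<gamma>_le: "\<bar>\<gamma> x\<bar> \<le> D" for x unfolding \<gamma>_def using D0 by auto
  have \<gamma>_ft: "(\<integral>y. \<gamma> y * iexp (- (\<xi> \<bullet> y)) \<partial>lborel) = of_real (\<Phi> \<xi>)" for \<xi>
  proof -
    have "(\<integral>y. \<gamma> y * iexp (- (\<xi> \<bullet> y)) \<partial>lborel) = (\<integral>y. h 1 y * iexp (- (\<xi> \<bullet> y)) \<partial>lborel)"
      by (rule integral_cong_AE) (use \<gamma>_eq in \<open>auto elim!: eventually_mono\<close>)
    then show ?thesis using h(3)[of 1 \<xi>] by (simp add: \<Phi>_def)
  qed
  define c where "c s = s powr (- (1 / (2 * m)))" for s
  define k where "k s x = c s ^ CARD('n) * \<gamma> (c s *\<^sub>R x)" for s x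
  have c0: "c s > 0" if "s > 0" for s using that by (simp add: c_def)
  \<comment> \<open>One constant for the mass and for the supremum; the summand 1 makes it positive.\<close>
  define K where "K = D + (\<integral>x. \<bar>\<gamma> x\<bar> \<partial>lborel) + 1"
  have cn: "c s ^ CARD('n) = s powr (- (real CARD('n) / (2 * m)))" if "s > 0" for s
    using that by (simp add: c_def powr_power)
  show ?thesis
  proof (rule that)
    show "K > 0" using D0 by (simp add: K_def add_nonneg_pos)
    show "(\<lambda>(s, x). k s x) \<in> borel_measurable borel"
      unfolding k_def c_def borel_prod[symmetric] by measurable
    fix s :: real assume s: "s > 0"
    have "(\<integral>\<^sup>+x. ennreal \<bar>k s x\<bar> \<partial>lborel) = ennreal (c s ^ CARD('n)) * (\<integral>\<^sup>+x. ennreal \<bar>\<gamma> (c s *\<^sub>R x)\<bar> \<partial>lborel)"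
      unfolding k_def using c0[OF s]
      by (subst nn_integral_cmult[symmetric]) (auto simp: abs_mult ennreal_mult)
    also have "\<dots> = (\<integral>\<^sup>+x. ennreal \<bar>\<gamma> x\<bar> \<partial>lborel)"
      using nn_integral_lborel_affine[of "\<lambda>x. ennreal \<bar>\<gamma> x\<bar>" "c s" 0] c0[OF s] by simp
    also have "\<dots> = ennreal (\<integral>x. \<bar>\<gamma> x\<bar> \<partial>lborel)"
      using \<gamma>_int by (intro nn_integral_eq_integral) auto
    also have "\<dots> \<le> ennreal K" using D0 by (intro ennreal_leI) (simp add: K_def)
    finally show L1: "(\<integral>\<^sup>+x. ennreal \<bar>k s x\<bar> \<partial>lborel) \<le> ennreal K" .
    have "D \<le> K" unfolding K_def using D0 by simp
    then show "\<bar>k s x\<bar> \<le> K * s powr (- (real CARD('n) / (2 * m)))" for x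
      unfolding k_def cn[OF s, symmetric] using c0[OF s] order_trans[OF \<gamma>_le \<open>D \<le> K\<close>]
      by (simp add: abs_mult mult.commute)
    have km [measurable]: "k s \<in> borel_measurable borel" unfolding k_def by measurable
    have k_int: "integrable lborel (k s)"
      using L1 by (auto simp: integrable_iff_bounded intro: le_less_trans)
    have k_ft: "(\<integral>y. k s y * iexp (- (\<xi> \<bullet> y)) \<partial>lborel) = of_real (exp (- s * norm \<xi> powr (2 * m)))" for \<xi>
    proof -
      let ?f = "\<lambda>y. \<gamma> y * iexp (- (((1 / c s) *\<^sub>R \<xi>) \<bullet> y))"
      have "of_real (\<Phi> ((1 / c s) *\<^sub>R \<xi>)) = (\<integral>y. ?f y \<partial>lborel)" by (rule \<gamma>_ft[symmetric])
      also have "\<dots> = c s ^ CARD('n) *\<^sub>R (\<integral>y. ?f (0 + c s *\<^sub>R y) \<partial>lborel)"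
        using c0[OF s] integral_lborel_affine[of ?f "c s" 0] by simp
      also have "\<dots> = (\<integral>y. k s y * iexp (- (\<xi> \<bullet> y)) \<partial>lborel)"
      proof (subst integral_scaleR_right[symmetric], rule Bochner_Integration.integral_cong[OF refl])
        fix y
        have i: "((1 / c s) *\<^sub>R \<xi>) \<bullet> (c s *\<^sub>R y) = \<xi> \<bullet> y" using c0[OF s] by simp
        show "c s ^ CARD('n) *\<^sub>R ?f (0 + c s *\<^sub>R y) = k s y * iexp (- (\<xi> \<bullet> y))"
          unfolding add_0 i k_def by (simp add: scaleR_conv_of_real[of _ "_::complex"] mult.assoc)
      qed
      finally have "(\<integral>y. k s y * iexp (- (\<xi> \<bullet> y)) \<partial>lborel) = of_real (\<Phi> ((1 / c s) *\<^sub>R \<xi>))" by simp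
      also have "norm ((1 / c s) *\<^sub>R \<xi>) powr (2 * m) = s * norm \<xi> powr (2 * m)"
        using c0[OF s] s m by (simp add: powr_mult powr_divide c_def powr_powr powr_minus_divide)
      then have "\<Phi> ((1 / c s) *\<^sub>R \<xi>) = exp (- s * norm \<xi> powr (2 * m))" by (simp add: \<Phi>_def)
      finally show ?thesis .
    qed
    \<comment> \<open>The rescaled function and the kernel have the same Fourier transform, hence agree.\<close>
    have "AE x in lborel. \<bar>h s x - k s x\<bar> \<le> (1 / (2 * pi)) ^ DIM(real ^ 'n) * integral\<^sup>L lborel (\<lambda>_::real ^ 'n. 0::real)"
    proof (rule AE_abs_le_of_fourier_bound)
      fix \<xi> :: "real ^ 'n"
      have i: "integrable lborel (\<lambda>y. f y * iexp (- (\<xi> \<bullet> y)))" if "integrable lborel f" for f :: "real ^ 'n \<Rightarrow> real"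
      proof (rule Bochner_Integration.integrable_bound[OF that])
        show "(\<lambda>y. f y * iexp (- (\<xi> \<bullet> y))) \<in> borel_measurable lborel"
          using borel_measurable_integrable[OF that] by measurable
      qed (simp add: norm_mult)
      have "(\<integral>y. complex_of_real (h s y - k s y) * iexp (- (\<xi> \<bullet> y)) \<partial>lborel) = 
        (\<integral>y. h s y * iexp (- (\<xi> \<bullet> y)) \<partial>lborel) - (\<integral>y. k s y * iexp (- (\<xi> \<bullet> y)) \<partial>lborel)"
        by (subst Bochner_Integration.integral_diff[symmetric]) (auto simp only: of_real_diff left_diff_distrib i k_int h(1)[OF s])
      then show "cmod (\<integral>y. complex_of_real (h s y - k s y) * iexp (- (\<xi> \<bullet> y)) \<partial>lborel) \<le> 0"
        unfolding k_ft h(3)[OF s] by simp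
    qed (use k_int h(1)[OF s] in auto)
    then show "AE x in lborel. g s x = k s x"
      using h(2)[OF s] by eventually_elim simp
  qed
qed

section \<open>Weak Lebesgue spaces\<close>

text \<open>
  \<open>A\<close> is an upper bound for the usual quasi-norm of weak \<open>L\<^sup>q\<close>. Stating the bound on the distribution
  function makes the inequalities of Hoelder and Minkowski, up to constants, a matter of splitting
  superlevel sets.
\<close>
definition weak_Lp :: "real \<Rightarrow> real \<Rightarrow> ('a::euclidean_space \<Rightarrow> real) \<Rightarrow> bool" where
  "weak_Lp q A f \<longleftrightarrow> f \<in> borel_measurable lebesgue \<and>
     (\<forall>l>0. emeasure lebesgue {x. l < \<bar>f x\<bar>} \<le> ennreal ((A / l) powr q))"

lemma weak_LpD:
  assumes "weak_Lp q A f"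
  shows weak_Lp_measurable: "f \<in> borel_measurable lebesgue"
    and weak_Lp_le: "l > 0 \<Longrightarrow> emeasure lebesgue {x. l < \<bar>f x\<bar>} \<le> ennreal ((A / l) powr q)"
  using assms unfolding weak_Lp_def by auto

lemma sets_superlevel [measurable]:
  fixes f :: "'a::euclidean_space \<Rightarrow> real"
  assumes [measurable]: "f \<in> borel_measurable lebesgue"
  shows "{x. l < \<bar>f x\<bar>} \<in> sets lebesgue"
  using measurable_sets[of "\<lambda>x. \<bar>f x\<bar>" lebesgue borel "{l<..}"] by (simp add: vimage_def)

lemma weak_Lp_AE_mono:
  assumes f: "weak_Lp q A f" and g: "g \<in> borel_measurable lebesgue"
    and le: "AE x in lebesgue. \<bar>g x\<bar> \<le> \<bar>f x\<bar>"
  shows "weak_Lp q A g"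
  unfolding weak_Lp_def
proof (intro conjI allI impI g)
  fix l :: real assume "l > 0"
  have "emeasure lebesgue {x. l < \<bar>g x\<bar>} \<le> emeasure lebesgue {x. l < \<bar>f x\<bar>}"
    by (intro emeasure_mono_AE sets_superlevel weak_Lp_measurable[OF f]) (use le in \<open>auto elim!: eventually_mono\<close>)
  also have "\<dots> \<le> ennreal ((A / l) powr q)" by (rule weak_Lp_le[OF f \<open>l > 0\<close>])
  finally show "emeasure lebesgue {x. l < \<bar>g x\<bar>} \<le> ennreal ((A / l) powr q)" .
qed

lemma weak_Lp_chebyshev:
  fixes f :: "'a::euclidean_space \<Rightarrow> real"
  assumes [measurable]: "f \<in> borel_measurable lebesgue" and int: "integrable lebesgue (\<lambda>x. \<bar>f x\<bar> powr q)"
    and "0 < q" "0 \<le> A" and le: "(LINT x|lebesgue. \<bar>f x\<bar> powr q) \<le> A powr q"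
  shows "weak_Lp q A f"
  unfolding weak_Lp_def
proof (intro conjI allI impI)
  fix l :: real assume l: "l > 0"
  define c where "c = 1 / l powr q"
  have c: "c \<ge> 0" by (simp add: c_def)
  have "emeasure lebesgue {x. l < \<bar>f x\<bar>} \<le> emeasure lebesgue {x\<in>space lebesgue. 1 \<le> ennreal c * ennreal (\<bar>f x\<bar> powr q)}"
  proof (rule emeasure_mono)
    show "{x. l < \<bar>f x\<bar>} \<subseteq> {x\<in>space lebesgue. 1 \<le> ennreal c * ennreal (\<bar>f x\<bar> powr q)}"
    proof (intro subsetI CollectI conjI)
    fix x assume "x \<in> {x. l < \<bar>f x\<bar>}"
    then have "l powr q \<le> \<bar>f x\<bar> powr q" using \<open>q > 0\<close> l by (intro powr_mono2) auto
    then have "1 \<le> c * \<bar>f x\<bar> powr q" using l by (simp add: c_def field_simps)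
    then show "1 \<le> ennreal c * ennreal (\<bar>f x\<bar> powr q)" using c by (simp flip: ennreal_mult)
    qed simp
  qed measurable
  also have "\<dots> \<le> ennreal c * (\<integral>\<^sup>+x. ennreal (\<bar>f x\<bar> powr q) * indicator (space lebesgue) x \<partial>lebesgue)"
    by (rule nn_integral_Markov_inequality) auto
  also have "(\<integral>\<^sup>+x. ennreal (\<bar>f x\<bar> powr q) * indicator (space lebesgue) x \<partial>lebesgue) = ennreal (LINT x|lebesgue. \<bar>f x\<bar> powr q)"
    using nn_integral_eq_integral[OF int] by simp
  also have "ennreal c * ennreal (LINT x|lebesgue. \<bar>f x\<bar> powr q) \<le> ennreal c * ennreal (A powr q)"
    by (intro mult_left_mono ennreal_leI le) auto
  also have "\<dots> = ennreal ((A / l) powr q)"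
    using l \<open>0 \<le> A\<close> c by (simp add: c_def powr_divide flip: ennreal_mult)
  finally show "emeasure lebesgue {x. l < \<bar>f x\<bar>} \<le> ennreal ((A / l) powr q)" .
qed simp

text \<open>
  Hoelder's inequality: if the product exceeds \<open>l\<close>, then one of the two factors exceeds its share of
  \<open>l\<close>, and the shares are chosen so that both superlevel sets get the same bound.
\<close>
lemma weak_Lp_mult:
  fixes f g :: "'a::euclidean_space \<Rightarrow> real"
  assumes f: "weak_Lp a A f" and g: "weak_Lp b B g"
    and pos: "a > 0" "b > 0" "A > 0" "B > 0" and r: "1 / r = 1 / a + 1 / b"
  shows "weak_Lp r (2 powr (1 / r) * (A * B)) (\<lambda>x. f x * g x)"
  unfolding weak_Lp_def
proof (intro conjI allI impI)
  note [measurable] = weak_Lp_measurable[OF f] weak_Lp_measurable[OF g]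
  show "(\<lambda>x. f x * g x) \<in> borel_measurable lebesgue" by measurable
  have r0: "r > 0" using r pos by (metis add_pos_pos zero_less_divide_1_iff)
  fix l :: real assume l: "l > 0"
  define t where "t = l / (A * B)"
  have t: "t > 0" using l pos by (simp add: t_def)
  let ?X = "{x. A * t powr (r / a) < \<bar>f x\<bar>}" and ?Y = "{x. B * t powr (r / b) < \<bar>g x\<bar>}"
  have tt: "t powr (r / a) * t powr (r / b) = t"
  proof -
    have "r / a + r / b = r * (1 / r)" unfolding r by (simp add: algebra_simps)
    then show ?thesis using t r0 by (simp flip: powr_add)
  qed
  have "{x. l < \<bar>f x * g x\<bar>} \<subseteq> ?X \<union> ?Y"
  proof safe
    fix x assume x: "l < \<bar>f x * g x\<bar>" "\<not> B * t powr (r / b) < \<bar>g x\<bar>"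
    show "A * t powr (r / a) < \<bar>f x\<bar>"
    proof (rule ccontr)
      assume "\<not> A * t powr (r / a) < \<bar>f x\<bar>"
      then have "\<bar>f x\<bar> * \<bar>g x\<bar> \<le> (A * t powr (r / a)) * (B * t powr (r / b))"
        using x pos by (intro mult_mono) auto
      also have "\<dots> = A * B * (t powr (r / a) * t powr (r / b))" by (simp add: mult_ac)
      also have "\<dots> = l" unfolding tt using pos by (simp add: t_def)
      finally show False using x(1) by (simp add: abs_mult)
    qed
  qed
  then have "emeasure lebesgue {x. l < \<bar>f x * g x\<bar>} \<le> emeasure lebesgue (?X \<union> ?Y)"
    by (intro emeasure_mono) measurable
  also have "\<dots> \<le> emeasure lebesgue ?X + emeasure lebesgue ?Y"
    by (intro emeasure_subadditive) measurable
  also have "\<dots> \<le> ennreal ((A / (A * t powr (r / a))) powr a) + ennreal ((B / (B * t powr (r / b))) powr b)"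
    using pos t by (intro add_mono weak_Lp_le[OF f] weak_Lp_le[OF g]) auto
  also have "(A / (A * t powr (r / a))) powr a = t powr (- r)"
    using pos t by (simp add: powr_divide powr_powr powr_minus_divide)
  also have "(B / (B * t powr (r / b))) powr b = t powr (- r)"
    using pos t by (simp add: powr_divide powr_powr powr_minus_divide)
  also have "ennreal (t powr (- r)) + ennreal (t powr (- r)) = ennreal (2 * t powr (- r))"
    by (simp flip: ennreal_plus)
  also have "2 * t powr (- r) = (2 powr (1 / r) * (A * B) / l) powr r"
  proof -
    have "2 powr (1 / r) * (A * B) / l = 2 powr (1 / r) / t" using pos l by (simp add: t_def)
    then show ?thesis using r0 t by (simp add: powr_divide powr_powr powr_minus_divide)
  qed
  finally show "emeasure lebesgue {x. l < \<bar>f x * g x\<bar>} \<le> ennreal ((2 powr (1 / r) * (A * B) / l) powr r)" .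
qed

lemma weak_Lp_add:
  fixes f g :: "'a::euclidean_space \<Rightarrow> real"
  assumes f: "weak_Lp q A f" and g: "weak_Lp q A g" and pos: "q > 0" "A \<ge> 0"
  shows "weak_Lp q (2 powr (1 + 1 / q) * A) (\<lambda>x. f x + g x)"
  unfolding weak_Lp_def
proof (intro conjI allI impI)
  note [measurable] = weak_Lp_measurable[OF f] weak_Lp_measurable[OF g]
  show "(\<lambda>x. f x + g x) \<in> borel_measurable lebesgue" by measurable
  fix l :: real assume l: "l > 0"
  let ?X = "{x. l / 2 < \<bar>f x\<bar>}" and ?Y = "{x. l / 2 < \<bar>g x\<bar>}"
  have "emeasure lebesgue {x. l < \<bar>f x + g x\<bar>} \<le> emeasure lebesgue (?X \<union> ?Y)"
    by (intro emeasure_mono sets.Un sets_superlevel) auto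
  also have "\<dots> \<le> emeasure lebesgue ?X + emeasure lebesgue ?Y"
    by (intro emeasure_subadditive) measurable
  also have "\<dots> \<le> ennreal ((A / (l / 2)) powr q) + ennreal ((A / (l / 2)) powr q)"
    using l by (intro add_mono weak_Lp_le[OF f] weak_Lp_le[OF g]) auto
  also have "\<dots> = ennreal (2 * (A / (l / 2)) powr q)"
    by (simp flip: ennreal_plus)
  also have "2 * (A / (l / 2)) powr q = (2 powr (1 + 1 / q) * A / l) powr q"
  proof -
    have "2 powr (1 + 1 / q) * A / l = 2 powr (1 / q) * (A / (l / 2))" by (simp add: powr_add)
    then show ?thesis using pos l by (simp only: powr_mult powr_powr) simp
  qed
  finally show "emeasure lebesgue {x. l < \<bar>f x + g x\<bar>} \<le> ennreal ((2 powr (1 + 1 / q) * A / l) powr q)" .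
qed

lemma weak_Lp_powr:
  fixes f :: "'a::euclidean_space \<Rightarrow> real"
  assumes f: "weak_Lp q A f" and pos: "s > 0" "A \<ge> 0"
  shows "weak_Lp (q / s) (A powr s) (\<lambda>x. \<bar>f x\<bar> powr s)"
  unfolding weak_Lp_def
proof (intro conjI allI impI)
  note [measurable] = weak_Lp_measurable[OF f]
  show "(\<lambda>x. \<bar>f x\<bar> powr s) \<in> borel_measurable lebesgue" by measurable
  fix l :: real assume l: "l > 0"
  have iff: "l < \<bar>f x\<bar> powr s \<longleftrightarrow> l powr (1 / s) < \<bar>f x\<bar>" for x
  proof -
    have l_eq: "(l powr (1 / s)) powr s = l" using l pos by (simp add: powr_powr)
    have f_eq: "(\<bar>f x\<bar> powr s) powr (1 / s) = \<bar>f x\<bar>" using pos by (simp add: powr_powr)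
    have "\<bar>f x\<bar> powr s \<le> l \<longleftrightarrow> \<bar>f x\<bar> \<le> l powr (1 / s)"
    proof
      assume "\<bar>f x\<bar> powr s \<le> l"
      then have "(\<bar>f x\<bar> powr s) powr (1 / s) \<le> l powr (1 / s)" using pos by (intro powr_mono2) auto
      then show "\<bar>f x\<bar> \<le> l powr (1 / s)" unfolding f_eq .
    next
      assume "\<bar>f x\<bar> \<le> l powr (1 / s)"
      then have "\<bar>f x\<bar> powr s \<le> (l powr (1 / s)) powr s" using pos by (intro powr_mono2) auto
      then show "\<bar>f x\<bar> powr s \<le> l" unfolding l_eq .
    qed
    then show ?thesis by linarith
  qed
  have "emeasure lebesgue {x. l < \<bar>\<bar>f x\<bar> powr s\<bar>} = emeasure lebesgue {x. l powr (1 / s) < \<bar>f x\<bar>}"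
    by (simp only: abs_of_nonneg[OF powr_ge_zero] iff)
  also have "\<dots> \<le> ennreal ((A / l powr (1 / s)) powr q)"
    using l by (intro weak_Lp_le[OF f]) simp
  also have "(A / l powr (1 / s)) powr q = (A powr s / l) powr (q / s)"
  proof -
    have "A powr s / l = (A / l powr (1 / s)) powr s"
      using l pos by (subst powr_divide) (auto simp: powr_powr)
    then show ?thesis using pos by (simp only: powr_powr) simp
  qed
  finally show "emeasure lebesgue {x. l < \<bar>\<bar>f x\<bar> powr s\<bar>} \<le> ennreal ((A powr s / l) powr (q / s))" .
qed

lemma weak_Lp_cmult:
  fixes f :: "'a::euclidean_space \<Rightarrow> real"
  assumes f: "weak_Lp q A f" and c: "c > 0"
  shows "weak_Lp q (c * A) (\<lambda>x. c * f x)"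
  unfolding weak_Lp_def
proof (intro conjI allI impI)
  note [measurable] = weak_Lp_measurable[OF f]
  show "(\<lambda>x. c * f x) \<in> borel_measurable lebesgue" by measurable
  fix l :: real assume l: "l > 0"
  have "{x. l < \<bar>c * f x\<bar>} = {x. l / c < \<bar>f x\<bar>}"
    using c by (auto simp: abs_mult field_simps)
  then show "emeasure lebesgue {x. l < \<bar>c * f x\<bar>} \<le> ennreal ((c * A / l) powr q)"
    using weak_Lp_le[OF f, of "l / c"] l c by (simp add: mult.commute)
qed

lemma weak_Lp_norm_powr:
  assumes a: "a > 0"
  shows "weak_Lp (DIM('a) / a) (unit_ball_vol DIM('a) powr (a / DIM('a))) (\<lambda>y::'a::euclidean_space. norm y powr (- a))"
  unfolding weak_Lp_def
proof (intro conjI allI impI)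
  show "(\<lambda>y::'a. norm y powr (- a)) \<in> borel_measurable lebesgue"
    by (intro measurable_completion) measurable
  fix l :: real assume l: "l > 0"
  have "{x::'a. l < \<bar>norm x powr (- a)\<bar>} \<subseteq> ball 0 (l powr (- (1 / a)))"
  proof safe
    fix x :: 'a assume x: "l < \<bar>norm x powr (- a)\<bar>"
    then have "norm x > 0" using l by (cases "x = 0") auto
    have "(norm x powr (- a)) powr (- (1 / a)) < l powr (- (1 / a))"
      using x l a by (intro powr_less_mono2_neg) auto
    then show "x \<in> ball 0 (l powr (- (1 / a)))" using a \<open>norm x > 0\<close> by (simp add: powr_powr)
  qed
  then have "emeasure lebesgue {x::'a. l < \<bar>norm x powr (- a)\<bar>} \<le> emeasure lebesgue (ball (0::'a) (l powr (- (1 / a))))"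
    by (intro emeasure_mono) auto
  also have "\<dots> = ennreal (unit_ball_vol DIM('a) * (l powr (- (1 / a))) ^ DIM('a))"
    by (simp add: emeasure_ball)
  also have "unit_ball_vol DIM('a) * (l powr (- (1 / a))) ^ DIM('a) = (unit_ball_vol DIM('a) powr (a / DIM('a)) / l) powr (DIM('a) / a)"
    using l a unit_ball_vol_pos[of "real DIM('a)"]
    by (simp add: powr_divide powr_powr powr_minus_divide powr_power power_one_over flip: powr_realpow)
  finally show "emeasure lebesgue {x::'a. l < \<bar>norm x powr (- a)\<bar>} \<le>
    ennreal ((unit_ball_vol DIM('a) powr (a / DIM('a)) / l) powr (DIM('a) / a))" .
qed

text \<open>
  The constant in the pairing estimate that follows; the denominator comes from a geometric series of
  ratio \<open>2 powr (1 - r)\<close>.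
\<close>
definition weak_const :: "real \<Rightarrow> real" where
  "weak_const r = 1 + 2 / (1 - 2 powr (1 - r))"

lemma weak_const_pos: "r > 1 \<Longrightarrow> weak_const r > 0"
  unfolding weak_const_def
  using powr_less_mono[of "1 - r" 0 2] by (intro add_pos_pos divide_pos_pos) auto

text \<open>
  Where \<open>|f|\<close> is at most \<open>l\<close>, the integral of \<open>h\<close> is used; where it is larger, the supremum of \<open>h\<close>
  together with the decay of the distribution function over dyadic levels, which is summable because
  \<open>r > 1\<close>. The two contributions balance for \<open>l = M (A/B) powr (1/r)\<close>.
\<close>
lemma nn_integral_weak_Lp_mult_le:
  fixes f :: "'a::euclidean_space \<Rightarrow> real" and h :: "'a \<Rightarrow> ennreal"
  assumes f: "weak_Lp r M f" and r: "r > 1" and pos: "M > 0" "A > 0" "B > 0"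
    and [measurable]: "h \<in> borel_measurable lebesgue" and hA: "\<And>x. h x \<le> ennreal A"
    and hB: "(\<integral>\<^sup>+x. h x \<partial>lebesgue) \<le> ennreal B"
  shows "(\<integral>\<^sup>+x. ennreal \<bar>f x\<bar> * h x \<partial>lebesgue) \<le> ennreal (weak_const r * M * A powr (1 / r) * B powr (1 - 1 / r))"
proof -
  note [measurable] = weak_Lp_measurable[OF f]
  define l where "l = M * (A / B) powr (1 / r)"
  have l: "l > 0" using pos by (simp add: l_def)
  \<comment> \<open>On the dyadic shell between \<open>2 ^ k * l\<close> and twice that value, \<open>|f|\<close> is at most \<open>c k\<close>.\<close>
  define c where "c k = 2 ^ Suc k * l" for k
  have c0: "c k \<ge> 0" for k using l by (simp add: c_def)
  let ?S = "\<lambda>k. {x. 2 ^ k * l < \<bar>f x\<bar>}"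
  have pw: "ennreal \<bar>f x\<bar> \<le> ennreal l + (\<Sum>k. ennreal (c k) * indicator (?S k) x)" for x
  proof (cases "\<bar>f x\<bar> \<le> l")
    case True
    then show ?thesis using add_increasing2[of "(\<Sum>k. ennreal (c k) * indicator (?S k) x)" "ennreal \<bar>f x\<bar>" "ennreal l"]
      by (simp add: ennreal_leI)
  next
    case False
    have ex: "\<exists>n. \<bar>f x\<bar> \<le> 2 ^ n * l"
    proof -
      obtain n where "\<bar>f x\<bar> / l < 2 ^ n" using real_arch_pow[of 2 "\<bar>f x\<bar> / l"] by auto
      then show ?thesis using l by (intro exI[of _ n]) (simp add: field_simps)
    qed
    define n where "n = (LEAST n. \<bar>f x\<bar> \<le> 2 ^ n * l)"
    have n: "\<bar>f x\<bar> \<le> 2 ^ n * l" unfolding n_def by (rule LeastI_ex[OF ex])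
    have "n \<noteq> 0" using n False by (intro notI) auto
    then obtain k where k: "n = Suc k" using not0_implies_Suc by blast
    have "\<not> \<bar>f x\<bar> \<le> 2 ^ k * l"
      using not_less_Least[of k "\<lambda>n. \<bar>f x\<bar> \<le> 2 ^ n * l"] k unfolding n_def by simp
    then have "ennreal \<bar>f x\<bar> \<le> ennreal (c k) * indicator (?S k) x"
      using n k by (auto simp: c_def intro!: ennreal_leI)
    also have "\<dots> \<le> (\<Sum>j. ennreal (c j) * indicator (?S j) x)"
      by (rule le_suminf_ennreal)
    also have "\<dots> \<le> ennreal l + (\<Sum>j. ennreal (c j) * indicator (?S j) x)" by simp
    finally show ?thesis .
  qed
  define \<rho> where "\<rho> = 2 powr (1 - r)"
  have \<rho>: "0 < \<rho>" "\<rho> < 1" using r powr_less_mono[of "1 - r" 0 2] by (auto simp: \<rho>_def)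
  have int_S: "(\<integral>\<^sup>+x. ennreal (c k) * indicator (?S k) x * h x \<partial>lebesgue) \<le> ennreal (2 * l * B * \<rho> ^ k)" for k
  proof -
    have "(\<integral>\<^sup>+x. ennreal (c k) * indicator (?S k) x * h x \<partial>lebesgue)
      \<le> (\<integral>\<^sup>+x. ennreal (c k * A) * indicator (?S k) x \<partial>lebesgue)"
      using hA c0 pos by (intro nn_integral_mono) (auto simp: indicator_def ennreal_mult intro!: mult_left_mono)
    also have "\<dots> = ennreal (c k * A) * emeasure lebesgue (?S k)"
      by (intro nn_integral_cmult_indicator) measurable
    also have "\<dots> \<le> ennreal (c k * A) * ennreal ((M / (2 ^ k * l)) powr r)"
      using l by (intro mult_left_mono weak_Lp_le[OF f]) auto
    also have "\<dots> = ennreal (c k * A * (M / (2 ^ k * l)) powr r)"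
      using c0 pos by (simp add: ennreal_mult)
    also have "c k * A * (M / (2 ^ k * l)) powr r = 2 * l * B * \<rho> ^ k"
    proof -
      have 1: "(M / l) powr r = B / A" using pos r
        by (simp add: l_def powr_divide powr_powr)
      have "(M / (2 ^ k * l)) powr r = (M / l) powr r * (1 / 2 ^ k) powr r"
        using pos l by (simp add: mult.commute flip: powr_mult)
      also have "(1 / 2 ^ k) powr r = 2 powr (- (r * real k))"
        by (simp add: powr_divide powr_minus_divide powr_powr mult.commute flip: powr_realpow)
      finally have "c k * A * (M / (2 ^ k * l)) powr r = 2 * l * B * (2 ^ k * 2 powr (- (r * real k)))"
        unfolding 1 using pos by (simp add: c_def)
      also have "2 ^ k * 2 powr (- (r * real k)) = \<rho> ^ k"
      proof -
        have "\<rho> ^ k = 2 powr ((1 - r) * real k)"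
          by (simp add: \<rho>_def powr_powr flip: powr_realpow)
        moreover have "2 ^ k * 2 powr (- (r * real k)) = 2 powr (real k + - (r * real k))"
          unfolding powr_add by (simp add: powr_realpow)
        ultimately show ?thesis by (simp add: algebra_simps)
      qed
      finally show ?thesis .
    qed
    finally show ?thesis .
  qed
  have "(\<integral>\<^sup>+x. ennreal \<bar>f x\<bar> * h x \<partial>lebesgue) \<le>
    (\<integral>\<^sup>+x. ennreal l * h x + (\<Sum>k. ennreal (c k) * indicator (?S k) x * h x) \<partial>lebesgue)"
    using mult_right_mono[OF pw] by (intro nn_integral_mono) (simp add: distrib_right ennreal_suminf_multc)
  also have "\<dots> = ennreal l * (\<integral>\<^sup>+x. h x \<partial>lebesgue) + (\<Sum>k. \<integral>\<^sup>+x. ennreal (c k) * indicator (?S k) x * h x \<partial>lebesgue)"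
  proof -
    have 1: "(\<integral>\<^sup>+x. ennreal l * h x + (\<Sum>k. ennreal (c k) * indicator (?S k) x * h x) \<partial>lebesgue)
      = (\<integral>\<^sup>+x. ennreal l * h x \<partial>lebesgue) + (\<integral>\<^sup>+x. (\<Sum>k. ennreal (c k) * indicator (?S k) x * h x) \<partial>lebesgue)"
      by (rule nn_integral_add) measurable
    have 2: "(\<integral>\<^sup>+x. ennreal l * h x \<partial>lebesgue) = ennreal l * (\<integral>\<^sup>+x. h x \<partial>lebesgue)"
      by (rule nn_integral_cmult) measurable
    have 3: "(\<integral>\<^sup>+x. (\<Sum>k. ennreal (c k) * indicator (?S k) x * h x) \<partial>lebesgue) =
      (\<Sum>k. \<integral>\<^sup>+x. ennreal (c k) * indicator (?S k) x * h x \<partial>lebesgue)"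
      by (rule nn_integral_suminf) measurable
    show ?thesis unfolding 1 2 3 ..
  qed
  also have "\<dots> \<le> ennreal l * ennreal B + (\<Sum>k. ennreal (2 * l * B * \<rho> ^ k))"
    by (intro add_mono mult_left_mono hB suminf_le int_S) auto
  also have "(\<Sum>k. ennreal (2 * l * B * \<rho> ^ k)) = ennreal (\<Sum>k. 2 * l * B * \<rho> ^ k)"
    using l pos \<rho> by (intro suminf_ennreal2 summable_mult summable_geometric) auto
  also have "(\<Sum>k. 2 * l * B * \<rho> ^ k) = 2 * l * B * (1 / (1 - \<rho>))"
    using \<rho> by (subst suminf_mult) (auto simp: suminf_geometric)
  also have "ennreal l * ennreal B + ennreal (2 * l * B * (1 / (1 - \<rho>))) = ennreal (l * B + 2 * l * B * (1 / (1 - \<rho>)))"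
    using l pos \<rho> by (subst ennreal_plus) (auto simp: ennreal_mult)
  also have "l * B + 2 * l * B * (1 / (1 - \<rho>)) = weak_const r * (l * B)"
    by (simp add: weak_const_def \<rho>_def algebra_simps)
  also have "l * B = M * A powr (1 / r) * B powr (1 - 1 / r)"
    using pos by (simp add: l_def powr_divide powr_diff)
  finally show ?thesis by (simp add: mult.assoc)
qed

text \<open>
  On the superlevel set itself, of measure \<open>e\<close>, the hypothesis reads \<open>l e \<le> N e powr (1 - 1/q)\<close>, which
  is the desired bound on \<open>e\<close>. Since that set might a priori have infinite measure, it is first
  intersected with balls.
\<close>
lemma weak_Lp_of_set_integrals:
  fixes W :: "'a::euclidean_space \<Rightarrow> ennreal" and f :: "'a \<Rightarrow> real"
  assumes [measurable]: "W \<in> borel_measurable borel" "f \<in> borel_measurable lebesgue" and q: "q > 0" "N \<ge> 0"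
    and E: "\<And>E e. E \<in> sets borel \<Longrightarrow> e > 0 \<Longrightarrow> emeasure lborel E = ennreal e \<Longrightarrow>
      (\<integral>\<^sup>+x. W x * indicator E x \<partial>lborel) \<le> ennreal (N * e powr (1 - 1 / q))"
    and le: "AE x in lebesgue. ennreal \<bar>f x\<bar> \<le> W x"
  shows "weak_Lp q N f"
  unfolding weak_Lp_def
proof (intro conjI allI impI)
  show "f \<in> borel_measurable lebesgue" by fact
  fix l :: real assume l: "l > 0"
  let ?S = "{x. ennreal l < W x}"
  have S [measurable]: "?S \<in> sets borel" by measurable
  have R: "emeasure lborel (?S \<inter> cball 0 (real R)) \<le> ennreal ((N / l) powr q)" for R
  proof -
    let ?E = "?S \<inter> cball 0 (real R)"
    have E_sets: "?E \<in> sets borel" by measurable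
    have "emeasure lborel ?E \<le> emeasure lborel (cball (0::'a) (real R))" by (rule emeasure_mono) auto
    also have "\<dots> < \<infinity>" by (rule emeasure_compact_finite[OF compact_cball])
    finally have fin: "emeasure lborel ?E < \<infinity>" .
    define e where "e = measure lborel ?E"
    have e: "emeasure lborel ?E = ennreal e" using fin by (simp add: e_def emeasure_eq_ennreal_measure)
    show ?thesis
    proof (cases "e > 0")
      case True
      have "ennreal (l * e) = (\<integral>\<^sup>+x. ennreal l * indicator ?E x \<partial>lborel)"
        using l True e by (simp add: nn_integral_cmult_indicator ennreal_mult)
      also have "\<dots> \<le> (\<integral>\<^sup>+x. W x * indicator ?E x \<partial>lborel)"
        by (intro nn_integral_mono) (auto simp: indicator_def)
      also have "\<dots> \<le> ennreal (N * e powr (1 - 1 / q))" by (rule E[OF E_sets True e])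
      finally have "l * e \<le> N * e powr (1 - 1 / q)" using q True by (subst (asm) ennreal_le_iff) auto
      then have "e powr (1 / q) \<le> N / l" using l True
        by (simp add: powr_diff field_simps)
      then have "(e powr (1 / q)) powr q \<le> (N / l) powr q" using q by (intro powr_mono2) auto
      then show ?thesis unfolding e using True q by (intro ennreal_leI) (simp add: powr_powr)
    next
      case False
      then show ?thesis unfolding e by (simp add: ennreal_neg)
    qed
  qed
  have "emeasure lebesgue {x. l < \<bar>f x\<bar>} \<le> emeasure lebesgue ?S"
  proof (rule emeasure_mono_AE)
    show "AE x in lebesgue. x \<in> {x. l < \<bar>f x\<bar>} \<longrightarrow> x \<in> ?S"
      using le
    proof eventually_elim
      case (elim x)
      show ?case
      proof
        assume "x \<in> {x. l < \<bar>f x\<bar>}"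
        then have "ennreal l < ennreal \<bar>f x\<bar>" using l by (intro ennreal_lessI) auto
        also note elim
        finally show "x \<in> ?S" by simp
      qed
    qed
  qed simp
  also have "\<dots> = emeasure lborel ?S" by simp
  also have "\<dots> = emeasure lborel (\<Union>R. ?S \<inter> cball 0 (real R))"
    by (rule arg_cong[of _ _ "emeasure lborel"]) (auto intro: real_arch_simple)
  also have "\<dots> = (SUP R. emeasure lborel (?S \<inter> cball 0 (real R)))"
    by (intro SUP_emeasure_incseq[symmetric]) (auto simp: incseq_def)
  also have "\<dots> \<le> ennreal ((N / l) powr q)" by (intro SUP_least R)
  finally show "emeasure lebesgue {x. l < \<bar>f x\<bar>} \<le> ennreal ((N / l) powr q)" .
qed

section \<open>The Duhamel operator between weak Lebesgue spaces\<close>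

text \<open>
  The time integral at the critical exponent: the two arguments of the minimum cross at
  \<open>s = e powr (1/d)\<close>, and beyond that time the integrand is an integrable power because \<open>d/r > 1\<close>.
\<close>
lemma nn_integral_min_powr_le:
  assumes d: "d > 0" and r: "r > 0" and dr: "d / r > 1" and e: "e > 0"
  shows "(\<integral>\<^sup>+s. ennreal (min 1 (s powr (- d) * e) powr (1 / r)) * indicator {0<..} s \<partial>lborel)
    \<le> ennreal (e powr (1 / d) * (1 + 1 / (d / r - 1)))"
proof -
  define x0 where "x0 = e powr (1 / d)"
  have x0: "x0 > 0" using e by (simp add: x0_def)
  define J where "J = e powr (1 / r)"
  have J: "J \<ge> 0" by (simp add: J_def)
  have pw: "ennreal (min 1 (s powr (- d) * e) powr (1 / r)) * indicator {0<..} s \<le>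
    indicator {0..x0} s + ennreal J * (ennreal (s powr (- (d / r))) * indicator {x0..} s)" for s
  proof (cases "s > 0")
    case s: True
    show ?thesis
    proof (cases "s \<le> x0")
      case True
      have "min 1 (s powr (- d) * e) powr (1 / r) \<le> 1 powr (1 / r)"
        using r e by (intro powr_mono2) auto
      then show ?thesis using s True by (auto intro!: add_increasing2 simp: ennreal_le_1)
    next
      case False
      have "min 1 (s powr (- d) * e) powr (1 / r) \<le> (s powr (- d) * e) powr (1 / r)"
        using r e by (intro powr_mono2) auto
      also have "\<dots> = J * s powr (- (d / r))" using s e by (simp add: J_def powr_mult powr_powr)
      finally show ?thesis using s False J by (simp add: ennreal_leI flip: ennreal_mult)
    qed
  qed simp
  have "(\<integral>\<^sup>+s. ennreal (s powr (- (d / r))) * indicator {x0..} s \<partial>lborel) =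
    ennreal (- (x0 powr (- (d / r) + 1)) / (- (d / r) + 1))"
    by (rule nn_integral_has_integral_lebesgue'[OF _ has_integral_powr_to_inf]) (use dr x0 in auto)
  also have "- (x0 powr (- (d / r) + 1)) / (- (d / r) + 1) = x0 powr (1 - d / r) / (d / r - 1)"
    using minus_divide_right[of "x0 powr (1 - d / r)" "1 - d / r"] by (simp add: add.commute)
  finally have tail: "(\<integral>\<^sup>+s. ennreal (s powr (- (d / r))) * indicator {x0..} s \<partial>lborel) =
    ennreal (x0 powr (1 - d / r) / (d / r - 1))" .
  have "(\<integral>\<^sup>+s. ennreal (min 1 (s powr (- d) * e) powr (1 / r)) * indicator {0<..} s \<partial>lborel) \<le>
    (\<integral>\<^sup>+s. indicator {0..x0} s + ennreal J * (ennreal (s powr (- (d / r))) * indicator {x0..} s) \<partial>lborel)"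
    by (intro nn_integral_mono pw)
  also have "\<dots> = (\<integral>\<^sup>+s. indicator {0..x0} s \<partial>lborel) +
     (\<integral>\<^sup>+s. ennreal J * (ennreal (s powr (- (d / r))) * indicator {x0..} s) \<partial>lborel)"
    by (rule nn_integral_add) measurable
  also have "(\<integral>\<^sup>+s. ennreal J * (ennreal (s powr (- (d / r))) * indicator {x0..} s) \<partial>lborel) =
    ennreal J * (\<integral>\<^sup>+s. ennreal (s powr (- (d / r))) * indicator {x0..} s \<partial>lborel)"
    by (rule nn_integral_cmult) measurable
  also have "\<dots> = ennreal (J * (x0 powr (1 - d / r) / (d / r - 1)))"
    unfolding tail using J dr by (simp flip: ennreal_mult)
  also have "J * (x0 powr (1 - d / r) / (d / r - 1)) = x0 * (1 / (d / r - 1))"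
  proof -
    have "J = x0 powr (d / r)" using d r e by (simp add: J_def x0_def powr_powr)
    then have "J * x0 powr (1 - d / r) = x0" using x0 by (simp flip: powr_add)
    then show ?thesis by (metis times_divide_eq_right mult.right_neutral)
  qed
  also have "(\<integral>\<^sup>+s. indicator {0..x0} s \<partial>lborel) = ennreal x0"
    using x0 by (simp add: nn_integral_indicator)
  also have "ennreal x0 + ennreal (x0 * (1 / (d / r - 1))) = ennreal (x0 * (1 + 1 / (d / r - 1)))"
  proof -
    have "0 \<le> x0 * (1 / (d / r - 1))" using x0 dr by simp
    then show ?thesis using x0 by (simp add: distrib_left flip: ennreal_plus)
  qed
  finally show ?thesis by (simp add: x0_def)
qed

lemma nn_integral_powr_Ioo:
  assumes "a < 1" "H > 0"
  shows "(\<integral>\<^sup>+s. ennreal (s powr (- a)) * indicator {0<..<H} s \<partial>lborel) \<le> ennreal (H powr (1 - a) / (1 - a))"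
proof -
  have "(\<integral>\<^sup>+s. ennreal (s powr (- a)) * indicator {0<..<H} s \<partial>lborel) \<le>
    (\<integral>\<^sup>+s. ennreal (s powr (- a)) * indicator {0..H} s \<partial>lborel)"
    by (intro nn_integral_mono) (auto simp: indicator_def)
  also have "\<dots> = ennreal (H powr (- a + 1) / (- a + 1))"
    by (rule nn_integral_has_integral_lebesgue'[OF _ has_integral_powr_from_0]) (use assms in auto)
  finally show ?thesis by (simp add: add.commute)
qed

text \<open>
  The bound for the integral of a convolution over a set of measure \<open>e\<close>, for a kernel with mass at most
  \<open>K\<close> and supremum at most \<open>K b\<close> and a function in weak \<open>L\<^sup>r\<close> of quasi-norm \<open>M\<close>.
\<close>
definition conv_bound :: "real \<Rightarrow> real \<Rightarrow> real \<Rightarrow> real \<Rightarrow> real \<Rightarrow> real" where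
  "conv_bound K r M b e = weak_const r * M * K * min 1 (b * e) powr (1 / r) * e powr (1 - 1 / r)"

text \<open>
  By Tonelli the convolution with the kernel moves to the indicator of \<open>E\<close>, which turns it into a
  function \<open>h\<close> with \<open>h \<le> K min(1, b e)\<close> and integral at most \<open>K e\<close>; this is then paired with \<open>\<phi>\<close>. Two
  dominating functions with different exponents are allowed because the potential splits into a
  critical and a subcritical part.
\<close>
lemma nn_integral_conv_le:
  fixes k :: "'a::euclidean_space \<Rightarrow> real" and \<phi> :: "'a \<Rightarrow> ennreal"
  assumes [measurable]: "k \<in> borel_measurable borel" "\<phi> \<in> borel_measurable borel" "E \<in> sets borel"
    and K: "K > 0" "b > 0" "e > 0"
    and k1: "(\<integral>\<^sup>+x. ennreal \<bar>k x\<bar> \<partial>lborel) \<le> ennreal K" and kb: "\<And>x. \<bar>k x\<bar> \<le> K * b"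
    and E: "emeasure lborel E = ennreal e"
    and r: "r\<^sub>1 > 1" "r\<^sub>2 > 1" "M\<^sub>1 > 0" "M\<^sub>2 > 0" and f: "weak_Lp r\<^sub>1 M\<^sub>1 f\<^sub>1" "weak_Lp r\<^sub>2 M\<^sub>2 f\<^sub>2"
    and le: "AE y in lborel. \<phi> y \<le> ennreal \<bar>f\<^sub>1 y\<bar> + ennreal \<bar>f\<^sub>2 y\<bar>"
  shows "(\<integral>\<^sup>+x. indicator E x * (\<integral>\<^sup>+y. ennreal \<bar>k (x - y)\<bar> * \<phi> y \<partial>lborel) \<partial>lborel)
    \<le> ennreal (conv_bound K r\<^sub>1 M\<^sub>1 b e) + ennreal (conv_bound K r\<^sub>2 M\<^sub>2 b e)"
proof -
  define h where "h y = (\<integral>\<^sup>+x. indicator E x * ennreal \<bar>k (x - y)\<bar> \<partial>lborel)" for y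
  have h_meas [measurable]: "h \<in> borel_measurable borel" unfolding h_def by measurable
  have trans: "(\<integral>\<^sup>+x. ennreal \<bar>k (x - y)\<bar> \<partial>lborel) = (\<integral>\<^sup>+x. ennreal \<bar>k x\<bar> \<partial>lborel)" for y
    using nn_integral_lborel_affine[of "\<lambda>x. ennreal \<bar>k x\<bar>" 1 "- y"] by simp
  have refl: "(\<integral>\<^sup>+y. ennreal \<bar>k (x - y)\<bar> \<partial>lborel) = (\<integral>\<^sup>+x. ennreal \<bar>k x\<bar> \<partial>lborel)" for x
    using nn_integral_lborel_affine[of "\<lambda>x. ennreal \<bar>k x\<bar>" "- 1" x] by simp
  have dual: "(\<integral>\<^sup>+x. indicator E x * (\<integral>\<^sup>+y. ennreal \<bar>k (x - y)\<bar> * \<phi> y \<partial>lborel) \<partial>lborel) = (\<integral>\<^sup>+y. \<phi> y * h y \<partial>lborel)"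
  proof -
    have "(\<integral>\<^sup>+x. indicator E x * (\<integral>\<^sup>+y. ennreal \<bar>k (x - y)\<bar> * \<phi> y \<partial>lborel) \<partial>lborel) =
      (\<integral>\<^sup>+x. (\<integral>\<^sup>+y. \<phi> y * (indicator E x * ennreal \<bar>k (x - y)\<bar>) \<partial>lborel) \<partial>lborel)"
      by (subst nn_integral_cmult[symmetric]) (auto simp: mult_ac)
    also have "\<dots> = (\<integral>\<^sup>+y. (\<integral>\<^sup>+x. \<phi> y * (indicator E x * ennreal \<bar>k (x - y)\<bar>) \<partial>lborel) \<partial>lborel)"
      by (rule lborel_pair.Fubini') measurable
    also have "\<dots> = (\<integral>\<^sup>+y. \<phi> y * h y \<partial>lborel)"
      unfolding h_def by (subst nn_integral_cmult) auto
    finally show ?thesis .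
  qed
  define A where "A = K * min 1 (b * e)"
  have A: "A > 0" unfolding A_def using K by simp
  have hA: "h y \<le> ennreal A" for y
  proof -
    have "h y \<le> (\<integral>\<^sup>+x. ennreal \<bar>k (x - y)\<bar> \<partial>lborel)"
      unfolding h_def by (intro nn_integral_mono) (auto simp: indicator_def)
    then have 1: "h y \<le> ennreal K" using k1 unfolding trans by (rule order_trans)
    have "h y \<le> (\<integral>\<^sup>+x. ennreal (K * b) * indicator E x \<partial>lborel)"
      unfolding h_def using kb by (intro nn_integral_mono) (auto simp: indicator_def intro!: ennreal_leI)
    also have "\<dots> = ennreal (K * b * e)" using K E by (simp add: nn_integral_cmult_indicator ennreal_mult)
    finally have 2: "h y \<le> ennreal (K * (b * e))" by (simp add: mult.assoc)
    show ?thesis using 1 2 unfolding A_def min_def by auto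
  qed
  have hB: "(\<integral>\<^sup>+y. h y \<partial>lborel) \<le> ennreal (K * e)"
  proof -
    have "(\<integral>\<^sup>+y. h y \<partial>lborel) = (\<integral>\<^sup>+x. (\<integral>\<^sup>+y. indicator E x * ennreal \<bar>k (x - y)\<bar> \<partial>lborel) \<partial>lborel)"
      unfolding h_def by (rule lborel_pair.Fubini') measurable
    also have "\<dots> = (\<integral>\<^sup>+x. indicator E x * (\<integral>\<^sup>+x. ennreal \<bar>k x\<bar> \<partial>lborel) \<partial>lborel)"
      by (subst nn_integral_cmult) (auto simp: refl)
    also have "\<dots> = (\<integral>\<^sup>+x. ennreal \<bar>k x\<bar> \<partial>lborel) * ennreal e"
      using E by (simp add: nn_integral_multc mult.commute)
    also have "\<dots> \<le> ennreal K * ennreal e" by (intro mult_right_mono k1) auto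
    finally show ?thesis using K by (simp add: ennreal_mult)
  qed
  have one: "(\<integral>\<^sup>+y. ennreal \<bar>f y\<bar> * h y \<partial>lborel) \<le> ennreal (conv_bound K r M b e)"
    if "weak_Lp r M f" "r > 1" "M > 0" for r M f
  proof -
    have "(\<integral>\<^sup>+y. ennreal \<bar>f y\<bar> * h y \<partial>lebesgue) \<le> ennreal (weak_const r * M * A powr (1 / r) * (K * e) powr (1 - 1 / r))"
      by (rule nn_integral_weak_Lp_mult_le[OF that])
         (use A K hA hB h_meas in \<open>auto simp: nn_integral_completion measurable_completion\<close>)
    also have "weak_const r * M * A powr (1 / r) * (K * e) powr (1 - 1 / r) = conv_bound K r M b e"
    proof -
      have "K powr (1 / r) * K powr (1 - 1 / r) = K" using K by (simp flip: powr_add)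
      then show ?thesis unfolding conv_bound_def A_def using K
        by (simp add: powr_mult mult_ac)
    qed
    finally show ?thesis by (simp add: nn_integral_completion)
  qed
  note [measurable] = weak_Lp_measurable[OF f(1)] weak_Lp_measurable[OF f(2)]
  have [measurable]: "h \<in> borel_measurable lebesgue"
    using h_meas by (intro measurable_completion) simp
  have "(\<integral>\<^sup>+y. \<phi> y * h y \<partial>lborel) \<le> (\<integral>\<^sup>+y. ennreal \<bar>f\<^sub>1 y\<bar> * h y + ennreal \<bar>f\<^sub>2 y\<bar> * h y \<partial>lborel)"
    using le by (intro nn_integral_mono_AE) (auto elim!: eventually_mono simp: distrib_right[symmetric] intro!: mult_right_mono)
  also have "\<dots> = (\<integral>\<^sup>+y. ennreal \<bar>f\<^sub>1 y\<bar> * h y + ennreal \<bar>f\<^sub>2 y\<bar> * h y \<partial>lebesgue)"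
    by (simp add: nn_integral_completion)
  also have "\<dots> = (\<integral>\<^sup>+y. ennreal \<bar>f\<^sub>1 y\<bar> * h y \<partial>lebesgue) + (\<integral>\<^sup>+y. ennreal \<bar>f\<^sub>2 y\<bar> * h y \<partial>lebesgue)"
    by (rule nn_integral_add) measurable
  also have "\<dots> = (\<integral>\<^sup>+y. ennreal \<bar>f\<^sub>1 y\<bar> * h y \<partial>lborel) + (\<integral>\<^sup>+y. ennreal \<bar>f\<^sub>2 y\<bar> * h y \<partial>lborel)"
    by (simp add: nn_integral_completion)
  also have "\<dots> \<le> ennreal (conv_bound K r\<^sub>1 M\<^sub>1 b e) + ennreal (conv_bound K r\<^sub>2 M\<^sub>2 b e)"
    by (intro add_mono one f r)
  finally show ?thesis unfolding dual .
qed

text \<open>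
  What is used of the heat kernel; for order \<open>2m\<close> in dimension \<open>n\<close> the decay rate is \<open>d = n/2m\<close>.
\<close>
locale smoothing_kernel =
  fixes k :: "real \<Rightarrow> 'a::euclidean_space \<Rightarrow> real" and K d :: real
  assumes k_borel: "(\<lambda>(s, x). k s x) \<in> borel_measurable borel"
    and K_pos: "K > 0"
    and k_L1: "\<And>s. s > 0 \<Longrightarrow> (\<integral>\<^sup>+x. ennreal \<bar>k s x\<bar> \<partial>lborel) \<le> ennreal K"
    and k_sup: "\<And>s x. s > 0 \<Longrightarrow> \<bar>k s x\<bar> \<le> K * s powr (- d)"
begin

lemma k_measurable [measurable (raw)]:
  assumes [measurable]: "f \<in> borel_measurable M" "g \<in> borel_measurable M"
  shows "(\<lambda>x. k (f x) (g x)) \<in> borel_measurable M"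
proof -
  have "(\<lambda>x. (f x, g x)) \<in> M \<rightarrow>\<^sub>M borel" by (rule borel_measurable_Pair) fact+
  from measurable_compose[OF this k_borel] show ?thesis by simp
qed

text \<open>
  Absolute values are taken of the kernel only and the source is nonnegative, so that the integral is
  always defined and Tonelli applies without integrability conditions.
\<close>
definition duhamel :: "(real \<Rightarrow> 'a \<Rightarrow> ennreal) \<Rightarrow> real \<Rightarrow> 'a \<Rightarrow> ennreal" where
  "duhamel \<phi> t x = (\<integral>\<^sup>+\<tau>. indicator {0<..<t} \<tau> * (\<integral>\<^sup>+y. ennreal \<bar>k (t - \<tau>) (x - y)\<bar> * \<phi> \<tau> y \<partial>lborel) \<partial>lborel)"

lemma duhamel_measurable [measurable]:
  assumes [measurable]: "(\<lambda>(\<tau>, y). \<phi> \<tau> y) \<in> borel_measurable (borel \<Otimes>\<^sub>M borel)"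
  shows "duhamel \<phi> t \<in> borel_measurable borel"
  unfolding duhamel_def by measurable

lemma duhamel_set_integral_le:
  assumes [measurable]: "(\<lambda>(\<tau>, y). \<phi> \<tau> y) \<in> borel_measurable (borel \<Otimes>\<^sub>M borel)" "E \<in> sets borel"
    and [measurable]: "\<Psi> \<in> borel_measurable borel"
    and le: "AE \<tau> in lborel. 0 < \<tau> \<longrightarrow> \<tau> < t \<longrightarrow>
      (\<integral>\<^sup>+x. indicator E x * (\<integral>\<^sup>+y. ennreal \<bar>k (t - \<tau>) (x - y)\<bar> * \<phi> \<tau> y \<partial>lborel) \<partial>lborel) \<le> \<Psi> (t - \<tau>)"
  shows "(\<integral>\<^sup>+x. duhamel \<phi> t x * indicator E x \<partial>lborel) \<le> (\<integral>\<^sup>+s. \<Psi> s * indicator {0<..} s \<partial>lborel)"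
proof -
  have "(\<integral>\<^sup>+x. duhamel \<phi> t x * indicator E x \<partial>lborel) =
    (\<integral>\<^sup>+x. (\<integral>\<^sup>+\<tau>. indicator {0<..<t} \<tau> * (indicator E x * (\<integral>\<^sup>+y. ennreal \<bar>k (t - \<tau>) (x - y)\<bar> * \<phi> \<tau> y \<partial>lborel)) \<partial>lborel) \<partial>lborel)"
    unfolding duhamel_def by (subst nn_integral_multc[symmetric]) (auto simp: mult_ac)
  also have "\<dots> = (\<integral>\<^sup>+\<tau>. (\<integral>\<^sup>+x. indicator {0<..<t} \<tau> * (indicator E x * (\<integral>\<^sup>+y. ennreal \<bar>k (t - \<tau>) (x - y)\<bar> * \<phi> \<tau> y \<partial>lborel)) \<partial>lborel) \<partial>lborel)"
    by (rule lborel_pair.Fubini') measurable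
  also have "\<dots> = (\<integral>\<^sup>+\<tau>. indicator {0<..<t} \<tau> * (\<integral>\<^sup>+x. indicator E x * (\<integral>\<^sup>+y. ennreal \<bar>k (t - \<tau>) (x - y)\<bar> * \<phi> \<tau> y \<partial>lborel) \<partial>lborel) \<partial>lborel)"
    by (subst nn_integral_cmult) auto
  also have "\<dots> \<le> (\<integral>\<^sup>+\<tau>. \<Psi> (t - \<tau>) * indicator {0<..} (t - \<tau>) \<partial>lborel)"
    using le by (intro nn_integral_mono_AE) (auto elim!: eventually_mono simp: indicator_def)
  also have "\<dots> = (\<integral>\<^sup>+s. \<Psi> s * indicator {0<..} s \<partial>lborel)"
    using nn_integral_real_affine[of "\<lambda>s. \<Psi> s * indicator {0<..} s" "-1" t] by simp
  finally show ?thesis .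
qed

end

section \<open>Differences of Duhamel integrals\<close>

text \<open>
  Joint measurability is only given with respect to the Lebesgue measure on the product, so sections are
  controlled for almost every time. At almost every time a Borel representative agrees with the given function
  almost everywhere, which suffices inside the time integral.
\<close>
lemma borel_representative:
  fixes u :: "real \<Rightarrow> 'a::euclidean_space \<Rightarrow> real"
  assumes u: "(\<lambda>(x, t). u t x) \<in> borel_measurable (lebesgue_on (UNIV \<times> {0<..}))"
  obtains u' :: "real \<Rightarrow> 'a \<Rightarrow> real" where
    "(\<lambda>(t, x). u' t x) \<in> borel_measurable borel"
    "AE (x, t) in lborel. t > 0 \<longrightarrow> u t x = u' t x"
    "AE t in lborel. t > 0 \<longrightarrow> (AE x in lborel. u t x = u' t x)"
proof -
  let ?S = "(UNIV :: 'a set) \<times> {0::real<..}"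
  have S: "?S \<in> sets lebesgue" by (intro sets_completionI_sets) (simp add: borel_prod[symmetric])
  have "(\<lambda>p. if p \<in> ?S then (case p of (x, t) \<Rightarrow> u t x) else 0) \<in> borel_measurable lebesgue"
    using borel_measurable_if[OF S, THEN iffD1] u by (simp add: borel_measurable_if S)
  then obtain U where U: "U \<in> borel_measurable lborel"
      "AE p in lborel. (if p \<in> ?S then (case p of (x, t) \<Rightarrow> u t x) else 0) = U p"
    using completion_ex_borel_measurable_real by blast
  have U_borel: "U \<in> borel_measurable (borel \<Otimes>\<^sub>M borel)" using U(1) by (simp add: borel_prod)
  define u' where "u' t x = U (x, t)" for t x
  have eq: "AE (x, t) in lborel. t > 0 \<longrightarrow> u t x = u' t x"
    using U(2) by eventually_elim (auto simp: u'_def split: if_splits)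
  have swap: "AE p in lborel \<Otimes>\<^sub>M lborel. case p of (t, x) \<Rightarrow> (t::real) > 0 \<longrightarrow> u t x = u' t x"
  proof -
    have "AE p in lborel \<Otimes>\<^sub>M lborel. case p of (x::'a, t::real) \<Rightarrow> t > 0 \<longrightarrow> u t x = u' t x"
      unfolding lborel_prod by (rule eq)
    then have "AE p in distr (lborel \<Otimes>\<^sub>M lborel) (lborel \<Otimes>\<^sub>M lborel) (\<lambda>(x, y). (y, x)).
        case p of (x::'a, t::real) \<Rightarrow> t > 0 \<longrightarrow> u t x = u' t x"
      by (subst lborel_pair.distr_pair_swap[symmetric])
    then have "AE p in lborel \<Otimes>\<^sub>M lborel. case (case p of (x, y) \<Rightarrow> (y, x)) of (x::'a, t::real) \<Rightarrow> t > 0 \<longrightarrow> u t x = u' t x"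
      by (rule AE_distrD[rotated]) measurable
    then show ?thesis by eventually_elim auto
  qed
  show ?thesis
  proof (rule that[OF _ eq])
    show "(\<lambda>(t, x). u' t x) \<in> borel_measurable borel"
      unfolding u'_def borel_prod[symmetric] using U_borel by measurable
    have "AE t in lborel. AE x in lborel. t > 0 \<longrightarrow> u t x = u' t x"
      using lborel_pair.AE_pair[OF swap] by simp
    then show "AE t in lborel. t > 0 \<longrightarrow> (AE x in lborel. u t x = u' t x)"
      by eventually_elim auto
  qed
qed

context smoothing_kernel begin

text \<open>
  When the Duhamel integral of the absolute values is finite at \<open>x\<close>, the iterated integral in the
  equation is an absolutely convergent double integral of Borel functions, so differences of two such
  integrals may be taken under the integral sign.
\<close>
lemma heat_integral_representation:
  fixes g :: "real \<Rightarrow> 'a \<Rightarrow> real" and f f' :: "real \<Rightarrow> 'a \<Rightarrow> real"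
  assumes g: "\<And>s. s > 0 \<Longrightarrow> AE x in lborel. g s x = k s x"
    and f'_meas [measurable]: "(\<lambda>(\<tau>, y). f' \<tau> y) \<in> borel_measurable (borel \<Otimes>\<^sub>M borel)"
    and f: "AE \<tau> in lborel. 0 < \<tau> \<longrightarrow> (AE y in lborel. f \<tau> y = f' \<tau> y)"
    and fin: "duhamel (\<lambda>\<tau> y. ennreal \<bar>f' \<tau> y\<bar>) t x < \<infinity>"
  defines "\<kappa> \<equiv> \<lambda>(\<tau>, y). indicator {0<..<t} \<tau> * (k (t - \<tau>) (x - y) * f' \<tau> y)"
  shows "integrable (lborel \<Otimes>\<^sub>M lborel) \<kappa>"
    and "(LINT \<tau>:{0<..<t}|lebesgue. (LINT y|lebesgue. g (t - \<tau>) (x - y) * f \<tau> y)) = integral\<^sup>L (lborel \<Otimes>\<^sub>M lborel) \<kappa>"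
proof -
  have \<kappa>_meas [measurable]: "\<kappa> \<in> borel_measurable (lborel \<Otimes>\<^sub>M lborel)"
    unfolding \<kappa>_def by measurable
  show int: "integrable (lborel \<Otimes>\<^sub>M lborel) \<kappa>"
  proof (rule integrableI_bounded)
    have "(\<integral>\<^sup>+p. ennreal (norm (\<kappa> p)) \<partial>(lborel \<Otimes>\<^sub>M lborel)) =
      (\<integral>\<^sup>+\<tau>. \<integral>\<^sup>+y. ennreal (norm (\<kappa> (\<tau>, y))) \<partial>lborel \<partial>lborel)"
      by (rule lborel.nn_integral_fst[symmetric]) measurable
    also have "\<dots> = duhamel (\<lambda>\<tau> y. ennreal \<bar>f' \<tau> y\<bar>) t x"
      unfolding duhamel_def
    proof (rule nn_integral_cong)
      fix \<tau> :: real
      show "(\<integral>\<^sup>+y. ennreal (norm (\<kappa> (\<tau>, y))) \<partial>lborel) =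
        indicator {0<..<t} \<tau> * (\<integral>\<^sup>+y. ennreal \<bar>k (t - \<tau>) (x - y)\<bar> * ennreal \<bar>f' \<tau> y\<bar> \<partial>lborel)"
        by (cases "\<tau> \<in> {0<..<t}") (auto simp: \<kappa>_def abs_mult ennreal_mult)
    qed
    finally show "(\<integral>\<^sup>+p. ennreal (norm (\<kappa> p)) \<partial>(lborel \<Otimes>\<^sub>M lborel)) < \<infinity>" using fin by simp
  qed measurable
  have inner: "AE \<tau> in lebesgue. indicator {0<..<t} \<tau> *\<^sub>R (LINT y|lebesgue. g (t - \<tau>) (x - y) * f \<tau> y) =
      (\<integral>y. \<kappa> (\<tau>, y) \<partial>lborel)"
    using AE_completion[OF f]
  proof eventually_elim
    case (elim \<tau>)
    show ?case
    proof (cases "\<tau> \<in> {0<..<t}")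
      case True
      have "AE y in lborel. g (t - \<tau>) (x - y) = k (t - \<tau>) (x - y)"
      proof -
        have "AE z in distr lborel borel (\<lambda>y. x - y). g (t - \<tau>) z = k (t - \<tau>) z"
        proof -
          have distr: "distr lborel borel (\<lambda>y. x - y) = (lborel :: 'a measure)"
            by (subst (2) lborel_affine[of "-1" x]) (simp_all add: density_1)
          show ?thesis unfolding distr by (rule g) (use True in simp)
        qed
        then show ?thesis by (rule AE_distrD[rotated]) measurable
      qed
      moreover have "AE y in lborel. f \<tau> y = f' \<tau> y" using elim True by simp
      ultimately have "AE y in lborel. g (t - \<tau>) (x - y) * f \<tau> y = \<kappa> (\<tau>, y)"
        by eventually_elim (use True in \<open>simp add: \<kappa>_def\<close>)
      then have "(LINT y|lebesgue. g (t - \<tau>) (x - y) * f \<tau> y) = (\<integral>y. \<kappa> (\<tau>, y) \<partial>lborel)"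
        by (intro lebesgue_integral_AE_eq_lborel(2) AE_completion) measurable
      then show ?thesis using True by simp
    next
      case False
      then show ?thesis by (simp add: \<kappa>_def)
    qed
  qed
  have "(LINT \<tau>:{0<..<t}|lebesgue. (LINT y|lebesgue. g (t - \<tau>) (x - y) * f \<tau> y)) = (\<integral>\<tau>. (\<integral>y. \<kappa> (\<tau>, y) \<partial>lborel) \<partial>lborel)"
    unfolding set_lebesgue_integral_def
    by (rule lebesgue_integral_AE_eq_lborel(2)[OF _ inner]) measurable
  also have "\<dots> = integral\<^sup>L (lborel \<Otimes>\<^sub>M lborel) \<kappa>"
    by (rule lborel_pair.integral_fst'[OF int])
  finally show "(LINT \<tau>:{0<..<t}|lebesgue. (LINT y|lebesgue. g (t - \<tau>) (x - y) * f \<tau> y)) = integral\<^sup>L (lborel \<Otimes>\<^sub>M lborel) \<kappa>" .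
qed

lemma heat_integral_difference_le:
  fixes g :: "real \<Rightarrow> 'a \<Rightarrow> real" and f\<^sub>1 f\<^sub>2 f\<^sub>1' f\<^sub>2' :: "real \<Rightarrow> 'a \<Rightarrow> real"
  assumes g: "\<And>s. s > 0 \<Longrightarrow> AE x in lborel. g s x = k s x"
    and meas [measurable]: "(\<lambda>(\<tau>, y). f\<^sub>1' \<tau> y) \<in> borel_measurable (borel \<Otimes>\<^sub>M borel)" "(\<lambda>(\<tau>, y). f\<^sub>2' \<tau> y) \<in> borel_measurable (borel \<Otimes>\<^sub>M borel)"
    and f: "AE \<tau> in lborel. 0 < \<tau> \<longrightarrow> (AE y in lborel. f\<^sub>1 \<tau> y = f\<^sub>1' \<tau> y)" "AE \<tau> in lborel. 0 < \<tau> \<longrightarrow> (AE y in lborel. f\<^sub>2 \<tau> y = f\<^sub>2' \<tau> y)"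
    and fin: "duhamel (\<lambda>\<tau> y. ennreal \<bar>f\<^sub>1' \<tau> y\<bar>) t x < \<infinity>" "duhamel (\<lambda>\<tau> y. ennreal \<bar>f\<^sub>2' \<tau> y\<bar>) t x < \<infinity>"
  shows "ennreal \<bar>(LINT \<tau>:{0<..<t}|lebesgue. (LINT y|lebesgue. g (t - \<tau>) (x - y) * f\<^sub>1 \<tau> y)) -
      (LINT \<tau>:{0<..<t}|lebesgue. (LINT y|lebesgue. g (t - \<tau>) (x - y) * f\<^sub>2 \<tau> y))\<bar>
    \<le> duhamel (\<lambda>\<tau> y. ennreal \<bar>f\<^sub>1' \<tau> y - f\<^sub>2' \<tau> y\<bar>) t x"
proof -
  define \<kappa> where "\<kappa> f' = (\<lambda>(\<tau>, y). indicator {0<..<t} \<tau> * (k (t - \<tau>) (x - y) * (f' \<tau> y :: real)))" for f'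
  have rep1: "integrable (lborel \<Otimes>\<^sub>M lborel) (\<kappa> f\<^sub>1')"
    "(LINT \<tau>:{0<..<t}|lebesgue. (LINT y|lebesgue. g (t - \<tau>) (x - y) * f\<^sub>1 \<tau> y)) = integral\<^sup>L (lborel \<Otimes>\<^sub>M lborel) (\<kappa> f\<^sub>1')"
    unfolding \<kappa>_def by (rule heat_integral_representation[OF g meas(1) f(1) fin(1)]; assumption)+
  have rep2: "integrable (lborel \<Otimes>\<^sub>M lborel) (\<kappa> f\<^sub>2')"
    "(LINT \<tau>:{0<..<t}|lebesgue. (LINT y|lebesgue. g (t - \<tau>) (x - y) * f\<^sub>2 \<tau> y)) = integral\<^sup>L (lborel \<Otimes>\<^sub>M lborel) (\<kappa> f\<^sub>2')"
    unfolding \<kappa>_def by (rule heat_integral_representation[OF g meas(2) f(2) fin(2)]; assumption)+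
  have [measurable]: "(\<lambda>(\<tau>, y). f\<^sub>1' \<tau> y - f\<^sub>2' \<tau> y) \<in> borel_measurable (borel \<Otimes>\<^sub>M borel)" by measurable
  have diff: "\<kappa> f\<^sub>1' p - \<kappa> f\<^sub>2' p = \<kappa> (\<lambda>\<tau> y. f\<^sub>1' \<tau> y - f\<^sub>2' \<tau> y) p" for p
    by (cases p) (simp add: \<kappa>_def algebra_simps)
  have "ennreal \<bar>integral\<^sup>L (lborel \<Otimes>\<^sub>M lborel) (\<kappa> f\<^sub>1') - integral\<^sup>L (lborel \<Otimes>\<^sub>M lborel) (\<kappa> f\<^sub>2')\<bar>
    = ennreal (norm (\<integral>p. \<kappa> f\<^sub>1' p - \<kappa> f\<^sub>2' p \<partial>(lborel \<Otimes>\<^sub>M lborel)))"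
    using rep1(1) rep2(1) by simp
  also have "\<dots> \<le> (\<integral>\<^sup>+p. norm (\<kappa> f\<^sub>1' p - \<kappa> f\<^sub>2' p) \<partial>(lborel \<Otimes>\<^sub>M lborel))"
    by (rule integral_norm_bound_ennreal) (intro Bochner_Integration.integrable_diff rep1(1) rep2(1))
  also have "\<dots> = (\<integral>\<^sup>+\<tau>. \<integral>\<^sup>+y. ennreal (norm (\<kappa> (\<lambda>\<tau> y. f\<^sub>1' \<tau> y - f\<^sub>2' \<tau> y) (\<tau>, y))) \<partial>lborel \<partial>lborel)"
    unfolding diff by (rule lborel.nn_integral_fst[symmetric]) (unfold \<kappa>_def, measurable)
  also have "\<dots> = duhamel (\<lambda>\<tau> y. ennreal \<bar>f\<^sub>1' \<tau> y - f\<^sub>2' \<tau> y\<bar>) t x"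
    unfolding duhamel_def
  proof (rule nn_integral_cong)
    fix \<tau> :: real
    show "(\<integral>\<^sup>+y. ennreal (norm (\<kappa> (\<lambda>\<tau> y. f\<^sub>1' \<tau> y - f\<^sub>2' \<tau> y) (\<tau>, y))) \<partial>lborel) =
        indicator {0<..<t} \<tau> * (\<integral>\<^sup>+y. ennreal \<bar>k (t - \<tau>) (x - y)\<bar> * ennreal \<bar>f\<^sub>1' \<tau> y - f\<^sub>2' \<tau> y\<bar> \<partial>lborel)"
      by (cases "\<tau> \<in> {0<..<t}") (auto simp: \<kappa>_def abs_mult ennreal_mult)
  qed
  finally show ?thesis by (simp only: rep1(2) rep2(2))
qed

end

section \<open>Estimates at the critical exponent\<close>

text \<open>
  Functions in \<open>L\<^sup>q\<close> are bounded up to a part that is small in weak \<open>L\<^sup>q\<close>, by dominated convergence.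
  This fails for general functions in weak \<open>L\<^sup>q\<close>.
\<close>
lemma weak_Lp_tail:
  fixes f :: "'a::euclidean_space \<Rightarrow> real"
  assumes [measurable]: "f \<in> borel_measurable lebesgue" and int: "integrable lebesgue (\<lambda>x. \<bar>f x\<bar> powr q)"
    and q: "q > 0" and \<delta>: "\<delta> > 0"
  obtains L where "L > 0" "weak_Lp q \<delta> (\<lambda>x. if L < \<bar>f x\<bar> then f x else 0)"
proof -
  define g where "g j x = (if real j < \<bar>f x\<bar> then f x else 0)" for j x
  have [measurable]: "g j \<in> borel_measurable lebesgue" for j unfolding g_def by measurable
  have le: "\<bar>g j x\<bar> powr q \<le> \<bar>f x\<bar> powr q" for j x by (simp add: g_def)
  have "(\<lambda>j. LINT x|lebesgue. \<bar>g j x\<bar> powr q) \<longlonglongrightarrow> (LINT x|(lebesgue :: 'a measure). 0)"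
  proof (rule Bochner_Integration.integral_dominated_convergence[OF _ _ int])
    show "AE x in lebesgue. (\<lambda>j. \<bar>g j x\<bar> powr q) \<longlonglongrightarrow> 0"
    proof (rule AE_I2)
      fix x
      obtain N :: nat where N: "\<bar>f x\<bar> \<le> real N" using real_arch_simple by blast
      have "\<bar>g j x\<bar> powr q = 0" if "j \<ge> N" for j
      proof -
        have "\<not> real j < \<bar>f x\<bar>" using N that by linarith
        then show ?thesis by (simp add: g_def)
      qed
      then have "\<forall>\<^sub>F j in sequentially. \<bar>g j x\<bar> powr q = 0" by (auto simp: eventually_sequentially)
      then show "(\<lambda>j. \<bar>g j x\<bar> powr q) \<longlonglongrightarrow> 0" by (rule tendsto_eventually)
    qed
    show "AE x in lebesgue. norm (\<bar>g j x\<bar> powr q) \<le> \<bar>f x\<bar> powr q" for j using le by simp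
  qed measurable
  then have "\<forall>\<^sub>F j in sequentially. (LINT x|lebesgue. \<bar>g j x\<bar> powr q) < \<delta> powr q"
    by (rule order_tendstoD(2)) (use \<delta> in simp)
  then have "\<forall>\<^sub>F j in sequentially. (LINT x|lebesgue. \<bar>g j x\<bar> powr q) < \<delta> powr q \<and> j \<ge> 1"
    using eventually_ge_at_top by (rule eventually_conj)
  then obtain j where j: "(LINT x|lebesgue. \<bar>g j x\<bar> powr q) < \<delta> powr q" "j \<ge> 1"
    by (auto simp: eventually_sequentially)
  have "weak_Lp q \<delta> (g j)"
  proof (rule weak_Lp_chebyshev)
    show "integrable lebesgue (\<lambda>x. \<bar>g j x\<bar> powr q)"
      by (rule Bochner_Integration.integrable_bound[OF int]) (use le in auto)
  qed (use j q \<delta> in auto)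
  then show ?thesis using that[of "real j"] j(2) unfolding g_def by simp
qed

text \<open>
  The numerology of the problem. The exponents \<open>r\<close> and \<open>r\<^sub>1\<close> introduced below are those of
  \<open>|x| powr (-\<alpha>) |b| powr (p - 1) w\<close> and of \<open>|x| powr (-\<alpha>) w\<close> when \<open>b\<close> and \<open>w\<close> are in weak \<open>L\<^sup>q\<close>.
\<close>
locale critical_exponents =
  smoothing_kernel k K "n / (2 * m)" for k :: "real \<Rightarrow> 'a::euclidean_space \<Rightarrow> real" and K n m :: real +
  fixes \<alpha> p q :: real
  assumes n_dim: "n = real DIM('a)" and m_less: "2 * m < n" and \<alpha>_pos: "0 < \<alpha>" and \<alpha>_less: "\<alpha> < 2 * m"
    and p_gt: "p > (n - \<alpha>) / (n - 2 * m)"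
    and q_eq: "q = n * (p - 1) / (2 * m - \<alpha>)"
begin

definition "r = 1 / (2 * m / n + 1 / q)"
definition "r\<^sub>1 = 1 / (\<alpha> / n + 1 / q)"

lemma m_pos: "m > 0" and n_pos: "n > 0" using \<alpha>_pos \<alpha>_less m_less by auto

lemma p_minus_1: "p - 1 > (2 * m - \<alpha>) / (n - 2 * m)"
proof -
  have "(n - \<alpha>) / (n - 2 * m) = 1 + (2 * m - \<alpha>) / (n - 2 * m)" using m_less by (simp add: field_simps)
  then show ?thesis using p_gt by simp
qed

lemma p_gt_1: "p > 1"
proof -
  have "(2 * m - \<alpha>) / (n - 2 * m) > 0" using m_less \<alpha>_less by simp
  then show ?thesis using p_minus_1 by simp
qed

lemma q_pos: "q > 0" unfolding q_eq using n_pos p_gt_1 \<alpha>_less by simp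

lemma q_inverse: "(p - 1) / q = (2 * m - \<alpha>) / n" unfolding q_eq using p_gt_1 \<alpha>_less n_pos by simp

lemma inverse_r: "1 / r = 2 * m / n + 1 / q" and inverse_r1: "1 / r\<^sub>1 = \<alpha> / n + 1 / q"
  by (simp_all add: r_def r\<^sub>1_def)

text \<open>
  Here the lower bound on \<open>p\<close> enters: it is equivalent to \<open>q > n/(n - 2m)\<close>.
\<close>
lemma inverse_r_less: "2 * m / n + 1 / q < 1"
proof -
  have "(2 * m - \<alpha>) / (n - 2 * m) < p - 1" by (rule p_minus_1)
  then have "(2 * m - \<alpha>) < (p - 1) * (n - 2 * m)" using m_less by (simp add: field_simps)
  then have "(2 * m - \<alpha>) / (p - 1) < n - 2 * m" using p_gt_1 by (simp add: pos_divide_less_eq mult.commute)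
  then have "(2 * m - \<alpha>) / (p - 1) / n < (n - 2 * m) / n" using n_pos by (rule divide_strict_right_mono)
  then have "1 / q < (n - 2 * m) / n" unfolding q_eq by (simp add: mult.commute)
  then show ?thesis using n_pos by (simp add: field_simps)
qed

lemma r_gt_1: "r > 1"
proof -
  have "0 < 2 * m / n + 1 / q" using m_pos n_pos q_pos by (simp add: add_pos_pos)
  then show ?thesis unfolding r_def using inverse_r_less by simp
qed

lemma r1_gt_1: "r\<^sub>1 > 1"
proof -
  have "0 < \<alpha> / n + 1 / q" using \<alpha>_pos n_pos q_pos by (simp add: add_pos_pos)
  moreover have "\<alpha> / n < 2 * m / n" using \<alpha>_less n_pos by (simp add: divide_strict_right_mono)
  then have "\<alpha> / n + 1 / q < 1" using inverse_r_less by linarith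
  ultimately show ?thesis unfolding r\<^sub>1_def by simp
qed

text \<open>
  Hoelder's inequality with the exponents \<open>n/\<alpha>\<close>, \<open>q/(p - 1) = n/(2m - \<alpha>)\<close> and \<open>q\<close>, whose reciprocals add up
  to \<open>2m/n + 1/q\<close>.
\<close>
lemma critical_product_weak:
  obtains c where "c > 0"
    "\<And>b w D S. weak_Lp q D b \<Longrightarrow> weak_Lp q S w \<Longrightarrow> D > 0 \<Longrightarrow> S > 0 \<Longrightarrow>
      weak_Lp r (c * (D powr (p - 1) * S)) (\<lambda>y::'a. norm y powr (- \<alpha>) * (\<bar>b y\<bar> powr (p - 1) * w y))"
proof -
  define V where "V = unit_ball_vol n powr (\<alpha> / n)"
  define s where "s = 1 / ((2 * m - \<alpha>) / n + 1 / q)"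
  have V: "V > 0" unfolding V_def using unit_ball_vol_pos[OF less_imp_le[OF n_pos]] by simp
  have s: "1 / s = (2 * m - \<alpha>) / n + 1 / q" "s > 0"
    unfolding s_def using \<alpha>_less n_pos q_pos by (auto simp: add_pos_pos)
  have "weak_Lp r (2 powr (1 / r) * (V * (2 powr (1 / s) * (D powr (p - 1) * S))))
     (\<lambda>y::'a. norm y powr (- \<alpha>) * (\<bar>b y\<bar> powr (p - 1) * w y))"
    if b: "weak_Lp q D b" and w: "weak_Lp q S w" and pos: "D > 0" "S > 0" for b w D S
  proof (rule weak_Lp_mult)
    show "weak_Lp (n / \<alpha>) V (\<lambda>y::'a. norm y powr (- \<alpha>))"
      unfolding V_def n_dim by (rule weak_Lp_norm_powr[OF \<alpha>_pos])
    show "weak_Lp s (2 powr (1 / s) * (D powr (p - 1) * S)) (\<lambda>y. \<bar>b y\<bar> powr (p - 1) * w y)"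
    proof (rule weak_Lp_mult[OF weak_Lp_powr[OF b] w])
      show "1 / s = 1 / (q / (p - 1)) + 1 / q" using s(1) q_inverse by simp
    qed (use pos q_pos p_gt_1 in auto)
    show "1 / r = 1 / (n / \<alpha>) + 1 / s" unfolding inverse_r s(1) using n_pos by (simp add: field_simps)
  qed (use V s pos n_pos \<alpha>_pos in auto)
  then show ?thesis using that[of "2 powr (1 / r) * (V * 2 powr (1 / s))"] V by (simp add: mult.assoc)
qed

lemma subcritical_product_weak:
  obtains c where "c > 0"
    "\<And>w S. weak_Lp q S w \<Longrightarrow> S > 0 \<Longrightarrow> weak_Lp r\<^sub>1 (c * S) (\<lambda>y::'a. norm y powr (- \<alpha>) * w y)"
proof -
  define V where "V = unit_ball_vol n powr (\<alpha> / n)"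
  have V: "V > 0" unfolding V_def using unit_ball_vol_pos[OF less_imp_le[OF n_pos]] by simp
  have "weak_Lp r\<^sub>1 (2 powr (1 / r\<^sub>1) * (V * S)) (\<lambda>y::'a. norm y powr (- \<alpha>) * w y)"
    if w: "weak_Lp q S w" and pos: "S > 0" for w S
  proof (rule weak_Lp_mult[OF _ w])
    show "weak_Lp (n / \<alpha>) V (\<lambda>y::'a. norm y powr (- \<alpha>))"
      unfolding V_def n_dim by (rule weak_Lp_norm_powr[OF \<alpha>_pos])
    show "1 / r\<^sub>1 = 1 / (n / \<alpha>) + 1 / q" unfolding inverse_r1 by simp
  qed (use V pos n_pos \<alpha>_pos q_pos in auto)
  then show ?thesis using that[of "2 powr (1 / r\<^sub>1) * V"] V by (simp add: mult.assoc)
qed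

text \<open>
  Bounds for the norms of the Duhamel operator to weak \<open>L\<^sup>q\<close> from weak \<open>L\<^sup>r\<close>, and from weak \<open>L\<close> with exponent
  \<open>r\<^sub>1\<close> on a time interval of unit length.
\<close>
definition "c_crit = weak_const r * K * (1 + 1 / (n / (2 * m) / r - 1))"
definition "c_sub = weak_const r\<^sub>1 * K / (1 - \<alpha> / (2 * m))"

lemma d_over_r: "n / (2 * m) / r > 1"
proof -
  have "n / (2 * m) / r = n / (2 * m) * (1 / r)" by simp
  also have "\<dots> = 1 + n / (2 * m) * (1 / q)" unfolding inverse_r distrib_left using n_pos m_pos by simp
  finally show ?thesis using n_pos m_pos q_pos by simp
qed

lemma c_crit_pos: "c_crit > 0"
  unfolding c_crit_def using weak_const_pos[OF r_gt_1] K_pos d_over_r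
  by (intro mult_pos_pos add_pos_pos divide_pos_pos) auto

lemma \<alpha>_ratio: "\<alpha> / (2 * m) < 1" using \<alpha>_less m_pos by simp

lemma c_sub_pos: "c_sub > 0"
  unfolding c_sub_def using weak_const_pos[OF r1_gt_1] K_pos \<alpha>_ratio by simp

lemma time_integral_critical:
  assumes e: "e > 0" and M: "M > 0"
  shows "(\<integral>\<^sup>+s. ennreal (conv_bound K r M (s powr (- (n / (2 * m)))) e) * indicator {0<..} s \<partial>lborel)
    \<le> ennreal (c_crit * M * e powr (1 - 1 / q))"
proof -
  define c where "c = weak_const r * M * K * e powr (1 - 1 / r)"
  have c: "c \<ge> 0" unfolding c_def using weak_const_pos[OF r_gt_1] M K_pos by simp
  let ?I = "\<lambda>s. ennreal (min 1 (s powr (- (n / (2 * m))) * e) powr (1 / r)) * indicator {0<..} s"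
  have "(\<integral>\<^sup>+s. ennreal (conv_bound K r M (s powr (- (n / (2 * m)))) e) * indicator {0<..} s \<partial>lborel)
    = (\<integral>\<^sup>+s. ennreal c * ?I s \<partial>lborel)"
    using c by (intro nn_integral_cong) (simp add: conv_bound_def c_def ennreal_mult'[symmetric] mult_ac)
  also have "\<dots> = ennreal c * (\<integral>\<^sup>+s. ?I s \<partial>lborel)" by (rule nn_integral_cmult) measurable
  also have "\<dots> \<le> ennreal c * ennreal (e powr (1 / (n / (2 * m))) * (1 + 1 / (n / (2 * m) / r - 1)))"
    by (intro mult_left_mono nn_integral_min_powr_le) (use e n_pos m_pos r_gt_1 d_over_r in auto)
  also have "\<dots> = ennreal (c * (e powr (1 / (n / (2 * m))) * (1 + 1 / (n / (2 * m) / r - 1))))"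
    using c by (simp add: ennreal_mult')
  also have "c * (e powr (1 / (n / (2 * m))) * (1 + 1 / (n / (2 * m) / r - 1))) =
    c_crit * M * (e powr (1 - 1 / r) * e powr (2 * m / n))"
    by (simp add: c_def c_crit_def mult_ac)
  also have "e powr (1 - 1 / r) * e powr (2 * m / n) = e powr (1 - 1 / q)"
    using inverse_r by (simp flip: powr_add)
  finally show ?thesis .
qed

text \<open>
  As \<open>1/r\<^sub>1 \<ge> \<alpha>/n\<close>, the minimum to the power \<open>1/r\<^sub>1\<close> is at most its second argument to the power \<open>\<alpha>/n\<close>.
  This exponent produces the right power of \<open>e\<close> and the singularity \<open>s powr (-\<alpha>/2m)\<close>, which is integrable
  at \<open>0\<close>.
\<close>
lemma time_integral_subcritical:
  assumes e: "e > 0" and M: "M > 0" and H: "H > 0"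
  shows "(\<integral>\<^sup>+s. ennreal (conv_bound K r\<^sub>1 M (s powr (- (n / (2 * m)))) e) * indicator {0<..<H} s \<partial>lborel)
    \<le> ennreal (c_sub * M * H powr (1 - \<alpha> / (2 * m)) * e powr (1 - 1 / q))"
proof -
  define c where "c = weak_const r\<^sub>1 * M * K * e powr (1 - 1 / q)"
  have c: "c \<ge> 0" unfolding c_def using weak_const_pos[OF r1_gt_1] M K_pos by simp
  have le: "conv_bound K r\<^sub>1 M (s powr (- (n / (2 * m)))) e \<le> c * s powr (- (\<alpha> / (2 * m)))" if "s > 0" for s
  proof -
    let ?z = "s powr (- (n / (2 * m))) * e"
    have z: "?z > 0" using that e by simp
    have "min 1 ?z powr (1 / r\<^sub>1) \<le> min 1 ?z powr (\<alpha> / n)"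
      using z q_pos by (intro powr_mono') (auto simp: inverse_r1)
    also have "\<dots> \<le> ?z powr (\<alpha> / n)" using z \<alpha>_pos n_pos by (intro powr_mono2) auto
    also have "\<dots> = s powr (- (\<alpha> / (2 * m))) * e powr (\<alpha> / n)"
      using that e n_pos by (simp add: powr_mult powr_powr)
    finally have "conv_bound K r\<^sub>1 M (s powr (- (n / (2 * m)))) e \<le>
      weak_const r\<^sub>1 * M * K * (s powr (- (\<alpha> / (2 * m))) * e powr (\<alpha> / n)) * e powr (1 - 1 / r\<^sub>1)"
      unfolding conv_bound_def using weak_const_pos[OF r1_gt_1] M K_pos by (intro mult_right_mono mult_left_mono) auto
    also have "\<dots> = weak_const r\<^sub>1 * M * K * (e powr (\<alpha> / n) * e powr (1 - 1 / r\<^sub>1)) * s powr (- (\<alpha> / (2 * m)))"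
      by (simp add: mult_ac)
    also have "e powr (\<alpha> / n) * e powr (1 - 1 / r\<^sub>1) = e powr (1 - 1 / q)"
      using inverse_r1 by (simp flip: powr_add)
    finally show ?thesis by (simp add: c_def)
  qed
  have "(\<integral>\<^sup>+s. ennreal (conv_bound K r\<^sub>1 M (s powr (- (n / (2 * m)))) e) * indicator {0<..<H} s \<partial>lborel)
    \<le> (\<integral>\<^sup>+s. ennreal c * (ennreal (s powr (- (\<alpha> / (2 * m)))) * indicator {0<..<H} s) \<partial>lborel)"
    using le c by (intro nn_integral_mono) (auto simp: indicator_def ennreal_mult'[symmetric] intro!: ennreal_leI)
  also have "\<dots> = ennreal c * (\<integral>\<^sup>+s. ennreal (s powr (- (\<alpha> / (2 * m)))) * indicator {0<..<H} s \<partial>lborel)"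
    by (rule nn_integral_cmult) measurable
  also have "\<dots> \<le> ennreal c * ennreal (H powr (1 - \<alpha> / (2 * m)) / (1 - \<alpha> / (2 * m)))"
    by (intro mult_left_mono nn_integral_powr_Ioo \<alpha>_ratio H) auto
  also have "\<dots> = ennreal (c * (H powr (1 - \<alpha> / (2 * m)) / (1 - \<alpha> / (2 * m))))"
    by (rule ennreal_mult'[OF c, symmetric])
  also have "c * (H powr (1 - \<alpha> / (2 * m)) / (1 - \<alpha> / (2 * m))) = c_sub * M * H powr (1 - \<alpha> / (2 * m)) * e powr (1 - 1 / q)"
    by (simp add: c_def c_sub_def)
  finally show ?thesis .
qed

text \<open>
  The endpoint estimate. The part \<open>f\<^sub>1\<close> of the source is integrated over all positive times at no loss;
  the part \<open>f\<^sub>2\<close> only acts during the last \<open>H\<close> units of time, since the source vanishes before \<open>T\<close>.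
\<close>
lemma duhamel_weak_estimate:
  fixes \<phi> :: "real \<Rightarrow> 'a \<Rightarrow> ennreal"
  assumes \<phi> [measurable]: "(\<lambda>(\<tau>, y). \<phi> \<tau> y) \<in> borel_measurable (borel \<Otimes>\<^sub>M borel)"
    and H: "H > 0" "t < T + H" and M: "M\<^sub>1 > 0" "M\<^sub>2 > 0"
    and zero: "AE \<tau> in lborel. 0 < \<tau> \<longrightarrow> \<tau> < T \<longrightarrow> (AE y in lborel. \<phi> \<tau> y = 0)"
    and split: "AE \<tau> in lborel. 0 < \<tau> \<longrightarrow> T \<le> \<tau> \<longrightarrow> \<tau> < t \<longrightarrow>
      (\<exists>f\<^sub>1 f\<^sub>2. weak_Lp r M\<^sub>1 f\<^sub>1 \<and> weak_Lp r\<^sub>1 M\<^sub>2 f\<^sub>2 \<and> (AE y in lborel. \<phi> \<tau> y \<le> ennreal \<bar>f\<^sub>1 y\<bar> + ennreal \<bar>f\<^sub>2 y\<bar>))"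
    and E: "E \<in> sets borel" "e > 0" "emeasure lborel E = ennreal e"
  shows "(\<integral>\<^sup>+x. duhamel \<phi> t x * indicator E x \<partial>lborel) \<le>
    ennreal ((c_crit * M\<^sub>1 + c_sub * M\<^sub>2 * H powr (1 - \<alpha> / (2 * m))) * e powr (1 - 1 / q))"
proof -
  let ?d = "n / (2 * m)"
  define \<Psi> where "\<Psi> s = ennreal (conv_bound K r M\<^sub>1 (s powr (- ?d)) e) +
    ennreal (conv_bound K r\<^sub>1 M\<^sub>2 (s powr (- ?d)) e) * indicator {0<..<H} s" for s
  have \<Psi>_meas: "\<Psi> \<in> borel_measurable borel" unfolding \<Psi>_def conv_bound_def by measurable
  have "(\<integral>\<^sup>+x. duhamel \<phi> t x * indicator E x \<partial>lborel) \<le> (\<integral>\<^sup>+s. \<Psi> s * indicator {0<..} s \<partial>lborel)"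
  proof (rule duhamel_set_integral_le[OF \<phi> E(1) \<Psi>_meas])
    show "AE \<tau> in lborel. 0 < \<tau> \<longrightarrow> \<tau> < t \<longrightarrow>
      (\<integral>\<^sup>+x. indicator E x * (\<integral>\<^sup>+y. ennreal \<bar>k (t - \<tau>) (x - y)\<bar> * \<phi> \<tau> y \<partial>lborel) \<partial>lborel) \<le> \<Psi> (t - \<tau>)"
      using zero split
    proof eventually_elim
      case (elim \<tau>)
      show ?case
      proof (intro impI)
        assume \<tau>: "0 < \<tau>" "\<tau> < t"
        have [measurable]: "(\<lambda>y. \<phi> \<tau> y) \<in> borel_measurable borel"
          using measurable_compose[OF measurable_Pair1' \<phi>, of \<tau>] by simp
        show "(\<integral>\<^sup>+x. indicator E x * (\<integral>\<^sup>+y. ennreal \<bar>k (t - \<tau>) (x - y)\<bar> * \<phi> \<tau> y \<partial>lborel) \<partial>lborel) \<le> \<Psi> (t - \<tau>)"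
        proof (cases "\<tau> < T")
          case True
          have "(\<integral>\<^sup>+y. ennreal \<bar>k (t - \<tau>) (x - y)\<bar> * \<phi> \<tau> y \<partial>lborel) = 0" for x
          proof (subst nn_integral_0_iff_AE)
            show "AE y in lborel. ennreal \<bar>k (t - \<tau>) (x - y)\<bar> * \<phi> \<tau> y = 0"
              using elim(1) \<tau> True by (auto elim!: eventually_mono)
          qed measurable
          then show ?thesis by simp
        next
          case False
          then obtain f\<^sub>1 f\<^sub>2 where f: "weak_Lp r M\<^sub>1 f\<^sub>1" "weak_Lp r\<^sub>1 M\<^sub>2 f\<^sub>2"
              "AE y in lborel. \<phi> \<tau> y \<le> ennreal \<bar>f\<^sub>1 y\<bar> + ennreal \<bar>f\<^sub>2 y\<bar>"
            using elim \<tau> by auto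
          have s: "t - \<tau> > 0" "t - \<tau> < H" using \<tau> False H by auto
          have [measurable]: "k (t - \<tau>) \<in> borel_measurable borel" by measurable
          have "(\<integral>\<^sup>+x. indicator E x * (\<integral>\<^sup>+y. ennreal \<bar>k (t - \<tau>) (x - y)\<bar> * \<phi> \<tau> y \<partial>lborel) \<partial>lborel)
            \<le> ennreal (conv_bound K r M\<^sub>1 ((t - \<tau>) powr (- ?d)) e) + ennreal (conv_bound K r\<^sub>1 M\<^sub>2 ((t - \<tau>) powr (- ?d)) e)"
            by (rule nn_integral_conv_le[OF _ _ E(1) K_pos _ E(2) k_L1[OF s(1)] k_sup[OF s(1)] E(3) r_gt_1 r1_gt_1 M f])
               (use s in auto)
          also have "\<dots> = \<Psi> (t - \<tau>)" using s by (simp add: \<Psi>_def)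
          finally show ?thesis .
        qed
      qed
    qed
  qed
  also have "\<dots> = (\<integral>\<^sup>+s. ennreal (conv_bound K r M\<^sub>1 (s powr (- ?d)) e) * indicator {0<..} s +
    ennreal (conv_bound K r\<^sub>1 M\<^sub>2 (s powr (- ?d)) e) * indicator {0<..<H} s \<partial>lborel)"
    by (intro nn_integral_cong) (auto simp: \<Psi>_def indicator_def)
  also have "\<dots> = (\<integral>\<^sup>+s. ennreal (conv_bound K r M\<^sub>1 (s powr (- ?d)) e) * indicator {0<..} s \<partial>lborel) +
    (\<integral>\<^sup>+s. ennreal (conv_bound K r\<^sub>1 M\<^sub>2 (s powr (- ?d)) e) * indicator {0<..<H} s \<partial>lborel)"
    unfolding conv_bound_def by (rule nn_integral_add) measurable
  also have "\<dots> \<le> ennreal (c_crit * M\<^sub>1 * e powr (1 - 1 / q)) + ennreal (c_sub * M\<^sub>2 * H powr (1 - \<alpha> / (2 * m)) * e powr (1 - 1 / q))"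
    by (intro add_mono time_integral_critical time_integral_subcritical E M H)
  also have "\<dots> = ennreal ((c_crit * M\<^sub>1 + c_sub * M\<^sub>2 * H powr (1 - \<alpha> / (2 * m))) * e powr (1 - 1 / q))"
    using c_crit_pos c_sub_pos M by (simp add: distrib_right flip: ennreal_plus)
  finally show ?thesis .
qed

end

section \<open>Propagation of uniqueness\<close>

text \<open>
  Turns the repeatedly halved bound of the contraction step into vanishing almost everywhere.
\<close>
lemma AE_eq_0_if_weak_Lp_null:
  fixes f :: "'a::euclidean_space \<Rightarrow> real"
  assumes f: "\<And>j::nat. weak_Lp q (S / 2 ^ j) f" and S: "S > 0" and q: "q > 0"
  shows "AE x in lebesgue. f x = 0"
proof -
  note [measurable] = weak_Lp_measurable[OF f[of 0]]
  have null: "emeasure lebesgue {x. l < \<bar>f x\<bar>} = 0" if l: "l > 0" for l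
  proof -
    have "(\<lambda>j. S / l * (1 / 2) ^ j) \<longlonglongrightarrow> S / l * 0"
      by (intro tendsto_mult tendsto_const LIMSEQ_realpow_zero) auto
    then have "(\<lambda>j. (S / 2 ^ j / l) powr q) \<longlonglongrightarrow> 0"
      using S l q by (intro tendsto_zero_powrI[where b=q]) (auto simp: power_one_over mult.commute)
    then have lim: "(\<lambda>j. ennreal ((S / 2 ^ j / l) powr q)) \<longlonglongrightarrow> ennreal 0"
      by (rule tendsto_ennrealI)
    have "emeasure lebesgue {x. l < \<bar>f x\<bar>} \<le> ennreal 0"
      by (rule LIMSEQ_le_const[OF lim]) (use weak_Lp_le[OF f l] in blast)
    then show ?thesis by simp
  qed
  have "AE x in lebesgue. \<forall>i. \<not> 1 / real (Suc i) < \<bar>f x\<bar>"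
    unfolding AE_all_countable
  proof
    fix i
    have "{x. 1 / real (Suc i) < \<bar>f x\<bar>} \<in> null_sets lebesgue"
      using null[of "1 / real (Suc i)"] by (intro null_setsI sets_superlevel) auto
    from AE_not_in[OF this] show "AE x in lebesgue. \<not> 1 / real (Suc i) < \<bar>f x\<bar>" by simp
  qed
  then show ?thesis
  proof eventually_elim
    case (elim x)
    show ?case
    proof (rule ccontr)
      assume "f x \<noteq> 0"
      then have "\<bar>f x\<bar> > 0" by simp
      then obtain i where "inverse (real (Suc i)) < \<bar>f x\<bar>" using reals_Archimedean by blast
      then show False using elim by (simp add: inverse_eq_divide)
    qed
  qed
qed

lemma power_lipschitz_split:
  fixes F :: "real \<Rightarrow> real"
  assumes lip: "\<And>a b. \<bar>F a - F b\<bar> \<le> C * \<bar>a - b\<bar> * (\<bar>a\<bar> powr s + \<bar>b\<bar> powr s)"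
    and C: "C > 0" and s: "s > 0" and L: "L > 0" and le: "\<bar>a\<bar> + \<bar>b\<bar> \<le> L + \<bar>d\<bar>"
  shows "\<bar>F a - F b\<bar> \<le> 2 * C * 2 powr s * (\<bar>d\<bar> powr s * \<bar>a - b\<bar> + L powr s * \<bar>a - b\<bar>)"
proof -
  have max: "z powr s \<le> 2 powr s * (\<bar>d\<bar> powr s + L powr s)" if z: "0 \<le> z" "z \<le> L + \<bar>d\<bar>" for z
  proof -
    have "z powr s \<le> (2 * max L \<bar>d\<bar>) powr s" using z s by (intro powr_mono2) auto
    also have "\<dots> = 2 powr s * max L \<bar>d\<bar> powr s" using L by (simp add: powr_mult)
    also have "max L \<bar>d\<bar> powr s \<le> \<bar>d\<bar> powr s + L powr s" by (auto simp: max_def)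
    finally show ?thesis by simp
  qed
  have "\<bar>F a - F b\<bar> \<le> C * \<bar>a - b\<bar> * (\<bar>a\<bar> powr s + \<bar>b\<bar> powr s)" by (rule lip)
  also have "\<dots> \<le> C * \<bar>a - b\<bar> * (2 powr s * (\<bar>d\<bar> powr s + L powr s) + 2 powr s * (\<bar>d\<bar> powr s + L powr s))"
    using C le by (intro mult_left_mono add_mono max) auto
  finally show ?thesis by (simp add: algebra_simps)
qed

context critical_exponents begin

text \<open>
  The contraction step. The width \<open>\<delta>\<close> of the small part is fixed first, by the constants of the endpoint
  estimate; it determines the bound \<open>L\<close> of the remaining part, and \<open>L\<close> determines the length \<open>H\<close>. The
  hypothesis \<open>split\<close> is the place where continuity in time with values in \<open>L\<^sup>q\<close> is used.
\<close>
lemma uniqueness_extension: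
  fixes u v u' v' :: "real \<Rightarrow> 'a \<Rightarrow> real" and F :: "real \<Rightarrow> real"
  defines "\<phi> \<equiv> \<lambda>\<tau> y. ennreal \<bar>norm y powr (- \<alpha>) * F (u' \<tau> y) - norm y powr (- \<alpha>) * F (v' \<tau> y)\<bar>"
  assumes lip: "\<And>a b. \<bar>F a - F b\<bar> \<le> C * \<bar>a - b\<bar> * (\<bar>a\<bar> powr (p - 1) + \<bar>b\<bar> powr (p - 1))" and C: "C > 0"
    and \<phi> [measurable]: "(\<lambda>(\<tau>, y). \<phi> \<tau> y) \<in> borel_measurable (borel \<Otimes>\<^sub>M borel)"
    and rep: "AE \<tau> in lborel. 0 < \<tau> \<longrightarrow> (AE y in lborel. u \<tau> y = u' \<tau> y)"
      "AE \<tau> in lborel. 0 < \<tau> \<longrightarrow> (AE y in lborel. v \<tau> y = v' \<tau> y)"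
    and ineq: "\<And>t. t > 0 \<Longrightarrow> AE x in lebesgue. ennreal \<bar>u t x - v t x\<bar> \<le> duhamel \<phi> t x"
    and B: "B > 0" "\<And>t. t > 0 \<Longrightarrow> weak_Lp q B (u t)" "\<And>t. t > 0 \<Longrightarrow> weak_Lp q B (v t)"
    and split: "\<And>\<delta>. \<delta> > 0 \<Longrightarrow> \<exists>L>0. \<exists>H>0. \<forall>\<tau>. T \<le> \<tau> \<longrightarrow> \<tau> < T + H \<longrightarrow>
      (\<exists>b. weak_Lp q \<delta> b \<and> (\<forall>x. \<bar>u \<tau> x\<bar> + \<bar>v \<tau> x\<bar> \<le> L + \<bar>b x\<bar>))"
    and eq: "\<And>t. 0 < t \<Longrightarrow> t < T \<Longrightarrow> AE x in lebesgue. u t x = v t x"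
  obtains H where "H > 0" "\<And>t. 0 < t \<Longrightarrow> t < T + H \<Longrightarrow> AE x in lebesgue. u t x = v t x"
proof -
  obtain c\<^sub>0 where c0: "c\<^sub>0 > 0"
    "\<And>b w D S. weak_Lp q D b \<Longrightarrow> weak_Lp q S w \<Longrightarrow> D > 0 \<Longrightarrow> S > 0 \<Longrightarrow>
      weak_Lp r (c\<^sub>0 * (D powr (p - 1) * S)) (\<lambda>y::'a. norm y powr (- \<alpha>) * (\<bar>b y\<bar> powr (p - 1) * w y))"
    using critical_product_weak by blast
  obtain c\<^sub>1 where c1: "c\<^sub>1 > 0"
    "\<And>w S. weak_Lp q S w \<Longrightarrow> S > 0 \<Longrightarrow> weak_Lp r\<^sub>1 (c\<^sub>1 * S) (\<lambda>y::'a. norm y powr (- \<alpha>) * w y)"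
    using subcritical_product_weak by blast
  define c where "c = 2 * C * 2 powr (p - 1)"
  have c: "c > 0" using C by (simp add: c_def)
  \<comment> \<open>The critical part is to contribute exactly \<open>S/4\<close>, and below the subcritical part at most \<open>S/4\<close>.\<close>
  define \<delta> where "\<delta> = (1 / (4 * c_crit * c * c\<^sub>0)) powr (1 / (p - 1))"
  have \<delta>: "\<delta> > 0" "\<delta> powr (p - 1) = 1 / (4 * c_crit * c * c\<^sub>0)"
    using c_crit_pos c c0(1) p_gt_1 by (auto simp: \<delta>_def powr_powr)
  obtain L H\<^sub>0 where L: "L > 0" and H0: "H\<^sub>0 > 0" and b: "\<And>\<tau>. T \<le> \<tau> \<Longrightarrow> \<tau> < T + H\<^sub>0 \<Longrightarrow>
      \<exists>b. weak_Lp q \<delta> b \<and> (\<forall>x. \<bar>u \<tau> x\<bar> + \<bar>v \<tau> x\<bar> \<le> L + \<bar>b x\<bar>)"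
    using split[OF \<delta>(1)] by auto
  define a where "a = 1 - \<alpha> / (2 * m)"
  have a: "a > 0" using \<alpha>_ratio by (simp add: a_def)
  define c\<^sub>2 where "c\<^sub>2 = c_sub * (c * L powr (p - 1) * c\<^sub>1)"
  have c2: "c\<^sub>2 > 0" using c_sub_pos c L c1(1) by (simp add: c\<^sub>2_def)
  define H where "H = min H\<^sub>0 ((1 / (4 * c\<^sub>2)) powr (1 / a))"
  have H: "H > 0" using H0 c2 by (simp add: H_def)
  have H_le: "c\<^sub>2 * H powr a \<le> 1 / 4"
  proof -
    have "H powr a \<le> ((1 / (4 * c\<^sub>2)) powr (1 / a)) powr a"
      using H a by (intro powr_mono2) (auto simp: H_def)
    also have "\<dots> = 1 / (4 * c\<^sub>2)" using a c2 by (simp add: powr_powr)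
    finally have "c\<^sub>2 * H powr a \<le> c\<^sub>2 * (1 / (4 * c\<^sub>2))" using c2 by (intro mult_left_mono) auto
    then show ?thesis using c2 by simp
  qed
  define w where "w t x = u t x - v t x" for t x
  have halve: "weak_Lp q (S / 2) (w t)"
    if S: "S > 0" and ih: "\<And>t. 0 < t \<Longrightarrow> t < T + H \<Longrightarrow> weak_Lp q S (w t)" and t: "0 < t" "t < T + H" for S t
  proof (rule weak_Lp_of_set_integrals[where W="duhamel \<phi> t"])
    show "duhamel \<phi> t \<in> borel_measurable borel" by measurable
    show "w t \<in> borel_measurable lebesgue" using ih[OF t] by (rule weak_Lp_measurable)
    show "AE x in lebesgue. ennreal \<bar>w t x\<bar> \<le> duhamel \<phi> t x" unfolding w_def using ineq[OF t(1)] .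
    fix E :: "'a set" and e :: real
    assume E: "E \<in> sets borel" "e > 0" "emeasure lborel E = ennreal e"
    define M\<^sub>1 where "M\<^sub>1 = c * (c\<^sub>0 * (\<delta> powr (p - 1) * S))"
    define M\<^sub>2 where "M\<^sub>2 = c * L powr (p - 1) * (c\<^sub>1 * S)"
    have M: "M\<^sub>1 > 0" "M\<^sub>2 > 0" unfolding M\<^sub>1_def M\<^sub>2_def using c c0(1) c1(1) \<delta>(1) S L by auto
    have "(\<integral>\<^sup>+x. duhamel \<phi> t x * indicator E x \<partial>lborel) \<le>
      ennreal ((c_crit * M\<^sub>1 + c_sub * M\<^sub>2 * H powr (1 - \<alpha> / (2 * m))) * e powr (1 - 1 / q))"
    proof (rule duhamel_weak_estimate[OF \<phi> H t(2) M _ _ E])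
      show "AE \<tau> in lborel. 0 < \<tau> \<longrightarrow> \<tau> < T \<longrightarrow> (AE y in lborel. \<phi> \<tau> y = 0)"
        using rep
      proof eventually_elim
        case (elim \<tau>)
        show ?case
        proof (intro impI)
          assume \<tau>: "0 < \<tau>" "\<tau> < T"
          have "AE y in lborel. u \<tau> y = v \<tau> y" using eq[OF \<tau>] by (simp add: AE_completion_iff)
          moreover have "AE y in lborel. u \<tau> y = u' \<tau> y" "AE y in lborel. v \<tau> y = v' \<tau> y" using elim \<tau> by auto
          ultimately show "AE y in lborel. \<phi> \<tau> y = 0"
            by eventually_elim (simp add: \<phi>_def)
        qed
      qed
      show "AE \<tau> in lborel. 0 < \<tau> \<longrightarrow> T \<le> \<tau> \<longrightarrow> \<tau> < t \<longrightarrow>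
        (\<exists>f\<^sub>1 f\<^sub>2. weak_Lp r M\<^sub>1 f\<^sub>1 \<and> weak_Lp r\<^sub>1 M\<^sub>2 f\<^sub>2 \<and> (AE y in lborel. \<phi> \<tau> y \<le> ennreal \<bar>f\<^sub>1 y\<bar> + ennreal \<bar>f\<^sub>2 y\<bar>))"
        using rep
      proof eventually_elim
        case (elim \<tau>)
        show ?case
        proof (intro impI)
          assume \<tau>: "0 < \<tau>" "T \<le> \<tau>" "\<tau> < t"
          have "\<tau> < T + H\<^sub>0" using \<tau> t by (simp add: H_def)
          then obtain d where d: "weak_Lp q \<delta> d" "\<And>x. \<bar>u \<tau> x\<bar> + \<bar>v \<tau> x\<bar> \<le> L + \<bar>d x\<bar>"
            using b[OF \<tau>(2)] by auto
          have w: "weak_Lp q S (w \<tau>)" using ih[of \<tau>] \<tau> t by simp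
          let ?f\<^sub>1 = "\<lambda>y. c * (norm y powr (- \<alpha>) * (\<bar>d y\<bar> powr (p - 1) * w \<tau> y))"
          let ?f\<^sub>2 = "\<lambda>y. c * L powr (p - 1) * (norm y powr (- \<alpha>) * w \<tau> y)"
          have "weak_Lp r M\<^sub>1 ?f\<^sub>1" unfolding M\<^sub>1_def by (rule weak_Lp_cmult[OF c0(2)[OF d(1) w \<delta>(1) S] c])
          moreover have "weak_Lp r\<^sub>1 M\<^sub>2 ?f\<^sub>2" unfolding M\<^sub>2_def
            by (rule weak_Lp_cmult[OF c1(2)[OF w S]]) (use c L in simp)
          moreover have "AE y in lborel. \<phi> \<tau> y \<le> ennreal \<bar>?f\<^sub>1 y\<bar> + ennreal \<bar>?f\<^sub>2 y\<bar>"
          proof -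
            have "AE y in lborel. u \<tau> y = u' \<tau> y" "AE y in lborel. v \<tau> y = v' \<tau> y" using elim \<tau> by auto
            then show ?thesis
            proof eventually_elim
              case (elim y)
              have "\<bar>norm y powr (- \<alpha>) * F (u' \<tau> y) - norm y powr (- \<alpha>) * F (v' \<tau> y)\<bar>
                = norm y powr (- \<alpha>) * \<bar>F (u \<tau> y) - F (v \<tau> y)\<bar>"
                using elim by (simp add: abs_mult flip: right_diff_distrib)
              also have "\<dots> \<le> norm y powr (- \<alpha>) * (c * (\<bar>d y\<bar> powr (p - 1) * \<bar>w \<tau> y\<bar> + L powr (p - 1) * \<bar>w \<tau> y\<bar>))"
                unfolding c_def w_def using p_gt_1 C L d(2)
                by (intro mult_left_mono power_lipschitz_split[OF lip]) auto
              also have "\<dots> = \<bar>?f\<^sub>1 y\<bar> + \<bar>?f\<^sub>2 y\<bar>" using c by (simp add: abs_mult algebra_simps)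
              finally show ?case unfolding \<phi>_def by (simp add: ennreal_leI flip: ennreal_plus)
            qed
          qed
          ultimately show "\<exists>f\<^sub>1 f\<^sub>2. weak_Lp r M\<^sub>1 f\<^sub>1 \<and> weak_Lp r\<^sub>1 M\<^sub>2 f\<^sub>2 \<and>
            (AE y in lborel. \<phi> \<tau> y \<le> ennreal \<bar>f\<^sub>1 y\<bar> + ennreal \<bar>f\<^sub>2 y\<bar>)" by blast
        qed
      qed
    qed
    also have "\<dots> \<le> ennreal (S / 2 * e powr (1 - 1 / q))"
    proof (intro ennreal_leI mult_right_mono)
      have "c_crit * M\<^sub>1 = S / 4" unfolding M\<^sub>1_def \<delta>(2) using c_crit_pos c c0(1) by simp
      moreover have "c_sub * M\<^sub>2 * H powr (1 - \<alpha> / (2 * m)) = S * (c\<^sub>2 * H powr a)"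
        by (simp add: M\<^sub>2_def c\<^sub>2_def a_def mult_ac)
      moreover have "S * (c\<^sub>2 * H powr a) \<le> S * (1 / 4)" using S H_le by (intro mult_left_mono) auto
      ultimately show "c_crit * M\<^sub>1 + c_sub * M\<^sub>2 * H powr (1 - \<alpha> / (2 * m)) \<le> S / 2" by simp
    qed simp
    finally show "(\<integral>\<^sup>+x. duhamel \<phi> t x * indicator E x \<partial>lborel) \<le> ennreal (S / 2 * e powr (1 - 1 / q))" .
  qed (use q_pos S in auto)
  define S where "S = 2 powr (1 + 1 / q) * B"
  have S: "S > 0" using B by (simp add: S_def)
  have iter: "weak_Lp q (S / 2 ^ j) (w t)" if "0 < t" "t < T + H" for j t
    using that
  proof (induction j arbitrary: t)
    case 0
    have "weak_Lp q B (\<lambda>x. - v t x)"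
      by (rule weak_Lp_AE_mono[OF B(3)]) (use 0 weak_Lp_measurable[OF B(3)[of t]] in auto)
    from weak_Lp_add[OF B(2)[OF 0(1)] this q_pos] B(1) show ?case
      by (simp add: S_def w_def)
  next
    case (Suc j)
    have "weak_Lp q (S / 2 ^ j / 2) (w t)"
      by (rule halve) (use S Suc in auto)
    then show ?case by (simp add: mult.commute)
  qed
  have "AE x in lebesgue. u t x = v t x" if "0 < t" "t < T + H" for t
  proof -
    have "AE x in lebesgue. w t x = 0" by (rule AE_eq_0_if_weak_Lp_null[OF iter[OF that] S q_pos])
    then show ?thesis by (simp add: w_def)
  qed
  then show ?thesis using that H by blast
qed

end

text \<open>
  The infimum \<open>T\<close> of the bad times is preceded by good times only, so the extension step would push it
  to \<open>T + H\<close>.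
\<close>
lemma global_from_extension:
  fixes P :: "real \<Rightarrow> bool"
  assumes ext: "\<And>T. T \<ge> 0 \<Longrightarrow> (\<And>t. 0 < t \<Longrightarrow> t < T \<Longrightarrow> P t) \<Longrightarrow> \<exists>H>0. \<forall>t. 0 < t \<longrightarrow> t < T + H \<longrightarrow> P t"
    and t: "t > 0"
  shows "P t"
proof (rule ccontr)
  assume "\<not> P t"
  define X where "X = {t. 0 < t \<and> \<not> P t}"
  have X: "X \<noteq> {}" "bdd_below X" using t \<open>\<not> P t\<close> by (auto simp: X_def intro!: bdd_belowI[of _ 0])
  have "Inf X \<ge> 0" using X(1) by (intro cInf_greatest) (auto simp: X_def)
  moreover have "P s" if "0 < s" "s < Inf X" for s
  proof (rule ccontr)
    assume "\<not> P s"
    then have "Inf X \<le> s" using that X(2) by (intro cInf_lower) (auto simp: X_def)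
    then show False using that by simp
  qed
  ultimately obtain H where H: "H > 0" "\<And>s. 0 < s \<Longrightarrow> s < Inf X + H \<Longrightarrow> P s" using ext by blast
  obtain s where "s \<in> X" "s < Inf X + H" using cInf_lessD[OF X(1), of "Inf X + H"] H(1) by auto
  then show False using H(2) by (auto simp: X_def)
qed

section \<open>Solutions in the critical Lebesgue space\<close>

lemma weak_Lp_if_Lp_norm_le:
  assumes f: "in_Lp q f" and le: "Lp_norm q f \<le> A" and q: "q > 0"
  shows "weak_Lp q A f"
proof (rule weak_Lp_chebyshev)
  have I: "(LINT x|lebesgue. \<bar>f x\<bar> powr q) \<ge> 0" by (intro integral_nonneg_AE) simp
  have 0: "Lp_norm q f \<ge> 0" by (simp add: Lp_norm_def)
  then show "A \<ge> 0" using le by simp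
  have "(LINT x|lebesgue. \<bar>f x\<bar> powr q) = Lp_norm q f powr q"
    using I q by (simp add: Lp_norm_def powr_powr)
  also have "\<dots> \<le> A powr q" using le 0 q by (intro powr_mono2) auto
  finally show "(LINT x|lebesgue. \<bar>f x\<bar> powr q) \<le> A powr q" .
qed (use f q in \<open>auto simp: in_Lp_def\<close>)

lemma in_Lp_diff:
  assumes f: "in_Lp q f" and g: "in_Lp q g" and q: "q > 0"
  shows "in_Lp q (\<lambda>x. f x - g x)"
  unfolding in_Lp_def
proof
  have [measurable]: "f \<in> borel_measurable lebesgue" "g \<in> borel_measurable lebesgue"
    using f g by (auto simp: in_Lp_def)
  show "(\<lambda>x. f x - g x) \<in> borel_measurable lebesgue" by measurable
  have int: "integrable lebesgue (\<lambda>x. 2 powr q * (\<bar>f x\<bar> powr q + \<bar>g x\<bar> powr q))"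
    using f g by (auto simp: in_Lp_def)
  show "integrable lebesgue (\<lambda>x. \<bar>f x - g x\<bar> powr q)"
  proof (rule Bochner_Integration.integrable_bound[OF int])
    have "\<bar>f x - g x\<bar> powr q \<le> 2 powr q * (\<bar>f x\<bar> powr q + \<bar>g x\<bar> powr q)" for x
    proof -
      have "\<bar>f x - g x\<bar> powr q \<le> (2 * max \<bar>f x\<bar> \<bar>g x\<bar>) powr q" using q by (intro powr_mono2) auto
      also have "\<dots> = 2 powr q * max \<bar>f x\<bar> \<bar>g x\<bar> powr q" by (simp add: powr_mult)
      also have "max \<bar>f x\<bar> \<bar>g x\<bar> powr q \<le> \<bar>f x\<bar> powr q + \<bar>g x\<bar> powr q" by (auto simp: max_def)
      finally show ?thesis by simp
    qed
    then show "AE x in lebesgue. norm (\<bar>f x - g x\<bar> powr q) \<le> norm (2 powr q * (\<bar>f x\<bar> powr q + \<bar>g x\<bar> powr q))"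
      by simp
  qed measurable
qed

text \<open>
  \<open>u \<tau>\<close> is the sum of \<open>u T\<close> truncated at height \<open>L\<close>, of the tail of \<open>u T\<close> above \<open>L\<close>, and of \<open>u \<tau> - u T\<close>. The
  tail is small for large \<open>L\<close>, the difference is small for \<open>\<tau>\<close> near \<open>T\<close> by continuity.
\<close>
lemma Cb_Lp_split_near:
  fixes u :: "real \<Rightarrow> real ^ 'n::finite \<Rightarrow> real"
  assumes u: "Cb_Lp q u" and q: "q > 0" and T: "T \<ge> 0" and \<delta>: "\<delta> > 0"
  obtains L H where "L > 0" "H > 0"
    "\<And>\<tau>. T \<le> \<tau> \<Longrightarrow> \<tau> < T + H \<Longrightarrow> \<exists>b. weak_Lp q \<delta> b \<and> (\<forall>x. \<bar>u \<tau> x\<bar> \<le> L + \<bar>b x\<bar>)"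
proof -
  define c where "c = 2 powr (1 + 1 / q)"
  have c: "c > 0" by (simp add: c_def)
  define \<delta>' where "\<delta>' = \<delta> / c"
  have \<delta>': "\<delta>' > 0" using \<delta> c by (simp add: \<delta>'_def)
  have uT: "in_Lp q (u T)" using u T by (simp add: Cb_Lp_def)
  obtain L where L: "L > 0" "weak_Lp q \<delta>' (\<lambda>x. if L < \<bar>u T x\<bar> then u T x else 0)"
    using weak_Lp_tail[OF _ _ q \<delta>'] uT unfolding in_Lp_def by blast
  have "((\<lambda>s. Lp_norm q (\<lambda>x. u s x - u T x)) \<longlongrightarrow> 0) (at T within {0..})"
    using u T by (simp add: Cb_Lp_def)
  then have "\<forall>\<^sub>F s in at T within {0..}. Lp_norm q (\<lambda>x. u s x - u T x) < \<delta>'"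
    by (rule order_tendstoD(2)) (rule \<delta>')
  then obtain H where H: "H > 0" "\<And>s. s \<in> {0..} \<Longrightarrow> s \<noteq> T \<Longrightarrow> dist s T < H \<Longrightarrow> Lp_norm q (\<lambda>x. u s x - u T x) < \<delta>'"
    unfolding eventually_at by auto
  have "\<exists>b. weak_Lp q \<delta> b \<and> (\<forall>x. \<bar>u \<tau> x\<bar> \<le> L + \<bar>b x\<bar>)" if \<tau>: "T \<le> \<tau>" "\<tau> < T + H" for \<tau>
  proof -
    have "Lp_norm q (\<lambda>x. u \<tau> x - u T x) \<le> \<delta>'"
    proof (cases "\<tau> = T")
      case True
      then show ?thesis using \<delta>' q by (simp add: Lp_norm_def)
    next
      case False
      then show ?thesis using H(2)[of \<tau>] \<tau> T by (simp add: dist_real_def)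
    qed
    moreover have "in_Lp q (\<lambda>x. u \<tau> x - u T x)"
      using u \<tau> T by (intro in_Lp_diff uT q) (simp add: Cb_Lp_def)
    ultimately have 1: "weak_Lp q \<delta>' (\<lambda>x. u \<tau> x - u T x)" using q by (intro weak_Lp_if_Lp_norm_le)
    have 2: "weak_Lp q \<delta>' (\<lambda>x. \<bar>u \<tau> x - u T x\<bar>)"
      by (rule weak_Lp_AE_mono[OF 1]) (use weak_Lp_measurable[OF 1] in auto)
    have 3: "weak_Lp q \<delta>' (\<lambda>x. \<bar>if L < \<bar>u T x\<bar> then u T x else 0\<bar>)"
      by (rule weak_Lp_AE_mono[OF L(2)]) (use weak_Lp_measurable[OF L(2)] in auto)
    let ?b = "\<lambda>x. \<bar>u \<tau> x - u T x\<bar> + \<bar>if L < \<bar>u T x\<bar> then u T x else 0\<bar>"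
    have "weak_Lp q \<delta> ?b"
      using weak_Lp_add[OF 2 3 q] \<delta>' c by (simp add: \<delta>'_def flip: c_def)
    moreover have "\<bar>u \<tau> x\<bar> \<le> L + \<bar>?b x\<bar>" for x using L(1) by (cases "L < \<bar>u T x\<bar>") auto
    ultimately show ?thesis by blast
  qed
  then show ?thesis using that L(1) H(1) by blast
qed

lemma continuous_if_power_lipschitz:
  fixes F :: "real \<Rightarrow> real"
  assumes lip: "\<And>a b. \<bar>F a - F b\<bar> \<le> C * \<bar>a - b\<bar> * (\<bar>a\<bar> powr s + \<bar>b\<bar> powr s)"
    and C: "C > 0" and s: "s > 0"
  shows "continuous_on UNIV F"
  unfolding continuous_on_eq_continuous_at[OF open_UNIV]
proof
  fix a :: real
  define D where "D = C * (2 * (\<bar>a\<bar> + 1) powr s)"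
  have "((\<lambda>x. F x - F a) \<longlongrightarrow> 0) (at a)"
  proof (rule Lim_null_comparison)
    have "((\<lambda>x. D * \<bar>x - a\<bar>) \<longlongrightarrow> D * \<bar>a - a\<bar>) (at a)" by (intro tendsto_intros)
    then show "((\<lambda>x. D * \<bar>x - a\<bar>) \<longlongrightarrow> 0) (at a)" by simp
    have "\<forall>\<^sub>F x in at a. dist x a < 1" by (auto simp: eventually_at intro!: exI[of _ 1])
    then show "\<forall>\<^sub>F x in at a. norm (F x - F a) \<le> D * \<bar>x - a\<bar>"
    proof eventually_elim
      case (elim x)
      have "\<bar>x\<bar> powr s \<le> (\<bar>a\<bar> + 1) powr s" "\<bar>a\<bar> powr s \<le> (\<bar>a\<bar> + 1) powr s"
        using elim s by (auto intro!: powr_mono2 simp: dist_real_def)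
      then have "C * \<bar>x - a\<bar> * (\<bar>x\<bar> powr s + \<bar>a\<bar> powr s) \<le> C * \<bar>x - a\<bar> * (2 * (\<bar>a\<bar> + 1) powr s)"
        using C by (intro mult_left_mono) auto
      then show ?case using lip[of x a] by (simp add: D_def mult_ac)
    qed
  qed
  then show "isCont F a" unfolding isCont_def by (simp add: LIM_zero_cancel)
qed

context critical_exponents begin

text \<open>
  Two time integrals can only be subtracted if they converge. Each of them does at almost every point,
  by the endpoint estimate applied to a single solution, since its integral over every ball is finite.
\<close>
lemma duhamel_finite:
  fixes u u' :: "real \<Rightarrow> 'a \<Rightarrow> real" and F :: "real \<Rightarrow> real"
  assumes lip: "\<And>a b. \<bar>F a - F b\<bar> \<le> C * \<bar>a - b\<bar> * (\<bar>a\<bar> powr (p - 1) + \<bar>b\<bar> powr (p - 1))"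
    and C: "C > 0" and F0: "F 0 = 0" and F [measurable]: "F \<in> borel_measurable borel"
    and u' [measurable]: "(\<lambda>(\<tau>, y). u' \<tau> y) \<in> borel_measurable (borel \<Otimes>\<^sub>M borel)"
    and rep: "AE \<tau> in lborel. 0 < \<tau> \<longrightarrow> (AE y in lborel. u \<tau> y = u' \<tau> y)"
    and B: "B > 0" "\<And>t. t > 0 \<Longrightarrow> weak_Lp q B (u t)" and t: "t > 0"
  shows "AE x in lborel. duhamel (\<lambda>\<tau> y. ennreal \<bar>norm y powr (- \<alpha>) * F (u' \<tau> y)\<bar>) t x < \<infinity>"
proof -
  let ?\<phi> = "\<lambda>\<tau> y. ennreal \<bar>norm y powr (- \<alpha>) * F (u' \<tau> y)\<bar>"
  have \<phi> [measurable]: "(\<lambda>(\<tau>, y). ?\<phi> \<tau> y) \<in> borel_measurable (borel \<Otimes>\<^sub>M borel)" by measurable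
  obtain c\<^sub>0 where c0: "c\<^sub>0 > 0"
    "\<And>b w D S. weak_Lp q D b \<Longrightarrow> weak_Lp q S w \<Longrightarrow> D > 0 \<Longrightarrow> S > 0 \<Longrightarrow>
      weak_Lp r (c\<^sub>0 * (D powr (p - 1) * S)) (\<lambda>y::'a. norm y powr (- \<alpha>) * (\<bar>b y\<bar> powr (p - 1) * w y))"
    using critical_product_weak by blast
  define M where "M = C * (c\<^sub>0 * (B powr (p - 1) * B))"
  have M: "M > 0" using C c0(1) B by (simp add: M_def)
  \<comment> \<open>No subcritical part is present here; the endpoint estimate wants a positive bound for it.\<close>
  have weak0: "weak_Lp r\<^sub>1 1 (\<lambda>_::'a. 0)" by (simp add: weak_Lp_def)
  have ball: "AE x in lborel. x \<in> cball 0 (real (Suc R)) \<longrightarrow> duhamel ?\<phi> t x < \<infinity>" for R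
  proof -
    let ?E = "cball (0::'a) (real (Suc R))"
    define e where "e = measure lborel ?E"
    have E: "emeasure lborel ?E = ennreal e" "e > 0"
      using emeasure_compact_finite[OF compact_cball, of "0::'a" "real (Suc R)"] unit_ball_vol_pos[of "real DIM('a)"]
      by (auto simp: e_def emeasure_eq_ennreal_measure content_cball)
    have "(\<integral>\<^sup>+x. duhamel ?\<phi> t x * indicator ?E x \<partial>lborel) \<le>
      ennreal ((c_crit * M + c_sub * 1 * (t + 1) powr (1 - \<alpha> / (2 * m))) * e powr (1 - 1 / q))"
    proof (rule duhamel_weak_estimate[where T=0, OF \<phi>])
      show "AE \<tau> in lborel. 0 < \<tau> \<longrightarrow> 0 \<le> \<tau> \<longrightarrow> \<tau> < t \<longrightarrow>
        (\<exists>f\<^sub>1 f\<^sub>2. weak_Lp r M f\<^sub>1 \<and> weak_Lp r\<^sub>1 1 f\<^sub>2 \<and> (AE y in lborel. ?\<phi> \<tau> y \<le> ennreal \<bar>f\<^sub>1 y\<bar> + ennreal \<bar>f\<^sub>2 y\<bar>))"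
        using rep
      proof eventually_elim
        case (elim \<tau>)
        show ?case
        proof (intro impI exI conjI)
          assume \<tau>: "0 < \<tau>"
          show "weak_Lp r\<^sub>1 1 (\<lambda>_::'a. 0)" by (rule weak0)
          let ?f = "\<lambda>y. C * (norm y powr (- \<alpha>) * (\<bar>u \<tau> y\<bar> powr (p - 1) * u \<tau> y))"
          show "weak_Lp r M ?f" unfolding M_def
            by (rule weak_Lp_cmult[OF c0(2)[OF B(2)[OF \<tau>] B(2)[OF \<tau>] B(1) B(1)] C])
          have "AE y in lborel. u \<tau> y = u' \<tau> y" using elim \<tau> by simp
          then show "AE y in lborel. ?\<phi> \<tau> y \<le> ennreal \<bar>?f y\<bar> + ennreal \<bar>0\<bar>"
          proof eventually_elim
            case (elim y)
            have "\<bar>F (u \<tau> y)\<bar> \<le> C * (\<bar>u \<tau> y\<bar> powr (p - 1) * \<bar>u \<tau> y\<bar>)"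
              using lip[of "u \<tau> y" 0] F0 p_gt_1 by (simp add: mult_ac)
            then have "norm y powr (- \<alpha>) * \<bar>F (u \<tau> y)\<bar> \<le> norm y powr (- \<alpha>) * (C * (\<bar>u \<tau> y\<bar> powr (p - 1) * \<bar>u \<tau> y\<bar>))"
              by (rule mult_left_mono) simp
            then show ?case using elim C by (auto simp: abs_mult mult_ac intro!: ennreal_leI)
          qed
        qed
      qed
    qed (use t M E in auto)
    also have "\<dots> < \<infinity>" by simp
    finally have "AE x in lborel. duhamel ?\<phi> t x * indicator ?E x \<noteq> \<infinity>"
    proof (intro nn_integral_PInf_AE)
      have [measurable]: "duhamel ?\<phi> t \<in> borel_measurable borel" "?E \<in> sets borel"
        using duhamel_measurable[OF \<phi>] by auto
      show "(\<lambda>x. duhamel ?\<phi> t x * indicator ?E x) \<in> borel_measurable lborel" by measurable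
    qed auto
    then show ?thesis by eventually_elim (auto simp: top.not_eq_extremum)
  qed
  then have "AE x in lborel. \<forall>R. x \<in> cball 0 (real (Suc R)) \<longrightarrow> duhamel ?\<phi> t x < \<infinity>"
    unfolding AE_all_countable by blast
  then show ?thesis
  proof eventually_elim
    case (elim x)
    obtain R where "norm x \<le> real R" using real_arch_simple by blast
    then have "x \<in> cball 0 (real (Suc R))" by simp
    then show ?case using elim by blast
  qed
qed

end

theorem theorem2p4:
  fixes m \<alpha> p q\<^sub>c C :: real
    and F :: "real \<Rightarrow> real"
    and g u v :: "real \<Rightarrow> real ^ 'n::finite \<Rightarrow> real"
    and u\<^sub>0 :: "real ^ 'n \<Rightarrow> real"
  assumes "m \<in> {0<..<1} \<union> \<nat>"
    and "2 * m < real CARD('n)"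
    and "\<alpha> \<in> {0<..<2 * m}"
    and "p > (real CARD('n) - \<alpha>) / (real CARD('n) - 2 * m)"
    and "q\<^sub>c = real CARD('n) * (p - 1) / (2 * m - \<alpha>)"
    and "F 0 = 0"
    and "C > 0"
    and "\<And>a b. \<bar>F a - F b\<bar> \<le> C * \<bar>a - b\<bar> * (\<bar>a\<bar> powr (p - 1) + \<bar>b\<bar> powr (p - 1))"
    and "is_heat_kernel m g"
    and "in_Lp q\<^sub>c u\<^sub>0"
    and "Cb_Lp q\<^sub>c u" and "Cb_Lp q\<^sub>c v"
    and "(\<lambda>(x, t). u t x) \<in> borel_measurable (lebesgue_on (UNIV \<times> {0<..}))"
    and "(\<lambda>(x, t). v t x) \<in> borel_measurable (lebesgue_on (UNIV \<times> {0<..}))"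
    and "mild_solution g \<alpha> F u\<^sub>0 u" and "mild_solution g \<alpha> F u\<^sub>0 v"
  shows "AE (x, t) in lebesgue_on (UNIV \<times> {0<..}). u t x = v t x"
proof -
  note lip = assms(8)
  have m: "m > 0" using assms(3) by auto
  obtain k K where k: "K > 0" "(\<lambda>(s, x). k s x) \<in> borel_measurable borel"
      "\<And>s. s > 0 \<Longrightarrow> AE x in lborel. g s x = k s x"
      "\<And>s. s > 0 \<Longrightarrow> (\<integral>\<^sup>+x. ennreal \<bar>k s x\<bar> \<partial>lborel) \<le> ennreal K"
      "\<And>s x. s > 0 \<Longrightarrow> \<bar>k s x\<bar> \<le> K * s powr (- (real CARD('n) / (2 * m)))"
    by (rule heat_kernel_representative[OF assms(9) m], rule that; assumption)
  interpret critical_exponents k K "real CARD('n)" m \<alpha> p q\<^sub>c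
    by unfold_locales (use assms k in auto)
  have F_meas [measurable]: "F \<in> borel_measurable borel"
    by (rule borel_measurable_continuous_onI[OF continuous_if_power_lipschitz[OF lip assms(7)]]) (use p_gt_1 in simp)
  obtain u' where u': "(\<lambda>(t, x). u' t x) \<in> borel_measurable borel"
      "AE (x, t) in lborel. t > 0 \<longrightarrow> u t x = u' t x"
      "AE t in lborel. t > 0 \<longrightarrow> (AE x in lborel. u t x = u' t x)"
    using borel_representative[OF assms(13)] by blast
  obtain v' where v': "(\<lambda>(t, x). v' t x) \<in> borel_measurable borel"
      "AE (x, t) in lborel. t > 0 \<longrightarrow> v t x = v' t x"
      "AE t in lborel. t > 0 \<longrightarrow> (AE x in lborel. v t x = v' t x)"
    using borel_representative[OF assms(14)] by blast
  have [measurable]: "(\<lambda>(t, x). u' t x) \<in> borel_measurable (borel \<Otimes>\<^sub>M borel)"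
    "(\<lambda>(t, x). v' t x) \<in> borel_measurable (borel \<Otimes>\<^sub>M borel)"
    using u'(1) v'(1) by (simp_all add: borel_prod)
  obtain B where B: "B > 0" "\<And>t. t > 0 \<Longrightarrow> weak_Lp q\<^sub>c B (u t)" "\<And>t. t > 0 \<Longrightarrow> weak_Lp q\<^sub>c B (v t)"
  proof -
    obtain B\<^sub>u B\<^sub>v where "\<And>t. t \<ge> 0 \<Longrightarrow> Lp_norm q\<^sub>c (u t) \<le> B\<^sub>u" "\<And>t. t \<ge> 0 \<Longrightarrow> Lp_norm q\<^sub>c (v t) \<le> B\<^sub>v"
      using assms(11,12) unfolding Cb_Lp_def by blast
    then have le: "t > 0 \<Longrightarrow> Lp_norm q\<^sub>c (u t) \<le> max 1 (max B\<^sub>u B\<^sub>v)" "t > 0 \<Longrightarrow> Lp_norm q\<^sub>c (v t) \<le> max 1 (max B\<^sub>u B\<^sub>v)" for t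
      by (simp_all add: le_max_iff_disj)
    have Lp: "t > 0 \<Longrightarrow> in_Lp q\<^sub>c (u t)" "t > 0 \<Longrightarrow> in_Lp q\<^sub>c (v t)" for t
      using assms(11,12) unfolding Cb_Lp_def by auto
    show ?thesis
    proof (rule that)
      show "0 < max 1 (max B\<^sub>u B\<^sub>v)" by simp
    qed (intro weak_Lp_if_Lp_norm_le le Lp q_pos; assumption)+
  qed
  define source where "source w \<tau> y = norm y powr (- \<alpha>) * F (w \<tau> y)" for w :: "real \<Rightarrow> real ^ 'n \<Rightarrow> real" and \<tau> y
  have source_meas: "(\<lambda>(\<tau>, y). source u' \<tau> y) \<in> borel_measurable (borel \<Otimes>\<^sub>M borel)"
    "(\<lambda>(\<tau>, y). source v' \<tau> y) \<in> borel_measurable (borel \<Otimes>\<^sub>M borel)"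
    unfolding source_def by measurable
  have source_AE: "AE \<tau> in lborel. 0 < \<tau> \<longrightarrow> (AE y in lborel. source w \<tau> y = source w' \<tau> y)"
    if "AE \<tau> in lborel. 0 < \<tau> \<longrightarrow> (AE y in lborel. w \<tau> y = w' \<tau> y)" for w w'
    using that
  proof eventually_elim
    case (elim \<tau>)
    show ?case
    proof
      assume "0 < \<tau>"
      with elim have "AE y in lborel. w \<tau> y = w' \<tau> y" by simp
      then show "AE y in lborel. source w \<tau> y = source w' \<tau> y" by eventually_elim (simp add: source_def)
    qed
  qed
  have source_rep: "AE \<tau> in lborel. 0 < \<tau> \<longrightarrow> (AE y in lborel. source u \<tau> y = source u' \<tau> y)"
    "AE \<tau> in lborel. 0 < \<tau> \<longrightarrow> (AE y in lborel. source v \<tau> y = source v' \<tau> y)"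
    using source_AE[OF u'(3)] source_AE[OF v'(3)] .
  let ?\<phi> = "\<lambda>\<tau> y. ennreal \<bar>source u' \<tau> y - source v' \<tau> y\<bar>"
  have \<phi>_meas: "(\<lambda>(\<tau>, y). ?\<phi> \<tau> y) \<in> borel_measurable (borel \<Otimes>\<^sub>M borel)"
    using source_meas by measurable
  have ineq: "AE x in lebesgue. ennreal \<bar>u t x - v t x\<bar> \<le> duhamel ?\<phi> t x" if t: "t > 0" for t
  proof -
    have fin: "AE x in lborel. duhamel (\<lambda>\<tau> y. ennreal \<bar>source u' \<tau> y\<bar>) t x < \<infinity>"
      "AE x in lborel. duhamel (\<lambda>\<tau> y. ennreal \<bar>source v' \<tau> y\<bar>) t x < \<infinity>"
      unfolding source_def
      using duhamel_finite[OF lip assms(7,6) F_meas _ u'(3) B(1,2) t] duhamel_finite[OF lip assms(7,6) F_meas _ v'(3) B(1,3) t]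
      by measurable
    have mild: "AE x in lebesgue. u t x = heat_semigroup g t u\<^sub>0 x +
          (LINT \<tau>:{0<..<t}|lebesgue. heat_semigroup g (t - \<tau>) (source u \<tau>) x)"
      "AE x in lebesgue. v t x = heat_semigroup g t u\<^sub>0 x +
          (LINT \<tau>:{0<..<t}|lebesgue. heat_semigroup g (t - \<tau>) (source v \<tau>) x)"
      using assms(15,16) t unfolding mild_solution_def source_def by auto
    from mild AE_completion[OF fin(1)] AE_completion[OF fin(2)] show ?thesis
    proof eventually_elim
      case (elim x)
      from heat_integral_difference_le[OF k(3) source_meas source_rep elim(3,4)]
      show ?case unfolding elim(1,2) heat_semigroup_def by simp
    qed
  qed
  have eq: "AE x in lebesgue. u t x = v t x" if "t > 0" for t
  proof (rule global_from_extension[where P="\<lambda>t. AE x in lebesgue. u t x = v t x", OF _ that])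
    fix T :: real
    assume T: "T \<ge> 0" and eq: "\<And>t. 0 < t \<Longrightarrow> t < T \<Longrightarrow> AE x in lebesgue. u t x = v t x"
    have split: "\<exists>L>0. \<exists>H>0. \<forall>\<tau>. T \<le> \<tau> \<longrightarrow> \<tau> < T + H \<longrightarrow>
      (\<exists>b. weak_Lp q\<^sub>c \<delta> b \<and> (\<forall>x. \<bar>u \<tau> x\<bar> + \<bar>v \<tau> x\<bar> \<le> L + \<bar>b x\<bar>))" if \<delta>: "\<delta> > 0" for \<delta>
    proof -
      define \<delta>' where "\<delta>' = \<delta> / 2 powr (1 + 1 / q\<^sub>c)"
      have \<delta>': "\<delta>' > 0" using \<delta> by (simp add: \<delta>'_def)
      obtain L\<^sub>u H\<^sub>u where Lu: "L\<^sub>u > 0" "H\<^sub>u > 0"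
        "\<And>\<tau>. T \<le> \<tau> \<Longrightarrow> \<tau> < T + H\<^sub>u \<Longrightarrow> \<exists>b. weak_Lp q\<^sub>c \<delta>' b \<and> (\<forall>x. \<bar>u \<tau> x\<bar> \<le> L\<^sub>u + \<bar>b x\<bar>)"
        using Cb_Lp_split_near[OF assms(11) q_pos T \<delta>'] by blast
      obtain L\<^sub>v H\<^sub>v where Lv: "L\<^sub>v > 0" "H\<^sub>v > 0"
        "\<And>\<tau>. T \<le> \<tau> \<Longrightarrow> \<tau> < T + H\<^sub>v \<Longrightarrow> \<exists>b. weak_Lp q\<^sub>c \<delta>' b \<and> (\<forall>x. \<bar>v \<tau> x\<bar> \<le> L\<^sub>v + \<bar>b x\<bar>)"
        using Cb_Lp_split_near[OF assms(12) q_pos T \<delta>'] by blast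
      have "\<exists>b. weak_Lp q\<^sub>c \<delta> b \<and> (\<forall>x. \<bar>u \<tau> x\<bar> + \<bar>v \<tau> x\<bar> \<le> L\<^sub>u + L\<^sub>v + \<bar>b x\<bar>)"
        if \<tau>: "T \<le> \<tau>" "\<tau> < T + min H\<^sub>u H\<^sub>v" for \<tau>
      proof -
        have "\<tau> < T + H\<^sub>u" "\<tau> < T + H\<^sub>v" using \<tau>(2) by linarith+
        note \<tau> = \<tau>(1) this
        obtain b where b: "weak_Lp q\<^sub>c \<delta>' b" "\<And>x. \<bar>u \<tau> x\<bar> \<le> L\<^sub>u + \<bar>b x\<bar>" using Lu(3)[of \<tau>] \<tau> by auto
        obtain d where d: "weak_Lp q\<^sub>c \<delta>' d" "\<And>x. \<bar>v \<tau> x\<bar> \<le> L\<^sub>v + \<bar>d x\<bar>" using Lv(3)[of \<tau>] \<tau> by auto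
        have b': "weak_Lp q\<^sub>c \<delta>' (\<lambda>x. \<bar>b x\<bar>)" by (rule weak_Lp_AE_mono[OF b(1)]) (use weak_Lp_measurable[OF b(1)] in auto)
        have d': "weak_Lp q\<^sub>c \<delta>' (\<lambda>x. \<bar>d x\<bar>)" by (rule weak_Lp_AE_mono[OF d(1)]) (use weak_Lp_measurable[OF d(1)] in auto)
        have "weak_Lp q\<^sub>c \<delta> (\<lambda>x. \<bar>b x\<bar> + \<bar>d x\<bar>)"
          using weak_Lp_add[OF b' d' q_pos] \<delta>' by (simp add: \<delta>'_def)
        moreover have "\<bar>u \<tau> x\<bar> + \<bar>v \<tau> x\<bar> \<le> L\<^sub>u + L\<^sub>v + \<bar>\<bar>b x\<bar> + \<bar>d x\<bar>\<bar>" for x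
          using b(2)[of x] d(2)[of x] by simp
        ultimately show ?thesis by blast
      qed
      then show ?thesis using Lu(1,2) Lv(1,2) by (intro exI[of _ "L\<^sub>u + L\<^sub>v"] exI[of _ "min H\<^sub>u H\<^sub>v"] conjI) auto
    qed
    obtain H where "H > 0" "\<And>t. 0 < t \<Longrightarrow> t < T + H \<Longrightarrow> AE x in lebesgue. u t x = v t x"
      using uniqueness_extension[OF lip assms(7) \<phi>_meas[unfolded source_def] u'(3) v'(3) ineq[unfolded source_def] B split eq] by blast
    then show "\<exists>H>0. \<forall>t. 0 < t \<longrightarrow> t < T + H \<longrightarrow> (AE x in lebesgue. u t x = v t x)" by blast
  qed
  have "AE t in lborel. AE x in lborel. t > 0 \<longrightarrow> u' t x = v' t x"
    using u'(3) v'(3)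
  proof eventually_elim
    case (elim t)
    show ?case
    proof (cases "t > 0")
      case True
      have "AE x in lborel. u t x = v t x" using eq[OF True] by (simp add: AE_completion_iff)
      moreover have "AE x in lborel. u t x = u' t x" "AE x in lborel. v t x = v' t x" using elim True by auto
      ultimately show ?thesis by eventually_elim simp
    qed simp
  qed
  then have "AE x in lborel. AE t in lborel. t > 0 \<longrightarrow> u' t x = v' t x"
    by (subst lborel_pair.AE_commute) measurable
  then have ae: "AE x in lborel. AE t in lborel. snd (x, t) > 0 \<longrightarrow> u' (snd (x, t)) (fst (x, t)) = v' (snd (x, t)) (fst (x, t))"
    by simp
  have "{p \<in> space (lborel \<Otimes>\<^sub>M lborel). snd p > 0 \<longrightarrow> u' (snd p) (fst p) = v' (snd p) (fst p)}
      \<in> sets (lborel \<Otimes>\<^sub>M lborel)" by measurable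
  from lborel_pair.AE_pair_measure[OF this ae]
  have "AE p in lborel \<Otimes>\<^sub>M lborel. snd p > 0 \<longrightarrow> u' (snd p) (fst p) = v' (snd p) (fst p)" .
  then have "AE p in lborel. snd p > 0 \<longrightarrow> u' (snd p) (fst p) = v' (snd p) (fst p)"
    unfolding lborel_prod .
  with u'(2) v'(2) have "AE (x, t) in lborel. t > 0 \<longrightarrow> u t x = v t x"
    by eventually_elim auto
  from AE_completion[OF this] have "AE p in lebesgue. p \<in> UNIV \<times> {0<..} \<longrightarrow> (case p of (x, t) \<Rightarrow> u t x = v t x)"
    by eventually_elim auto
  moreover have "(UNIV :: (real ^ 'n) set) \<times> {0::real<..} \<in> sets lebesgue"
    by (intro sets_completionI_sets) (simp add: borel_prod[symmetric])
  ultimately show ?thesis by (subst AE_restrict_space_iff) auto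
qed

end
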